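(* Let $H$ be a generalized Halin graph with maximum degree $\Delta \geq 13$. Then $\mathrm{ch}'_{\mathrm{star}}(H) \leq \left\lfloor \frac{3\Delta}{2} \right\rfloor$. Moreover, this upper bound is tight: for every integer $\Delta \geq 13$ there exists a generalized Halin graph $H$ with maximum degree $\Delta$ and $\mathrm{ch}'_{\mathrm{star}}(H) = \left\lfloor \frac{3\Delta}{2} \right\rfloor$.
   Context: All graphs are finite and simple. A star $k$-edge coloring of a graph $G$ is a proper edge coloring $\phi: E(G) \to \{1,\dots,k\}$ such that no path or cycle of length four (i.e. with four edges) in $G$ is bichromatic. Given a list assignment $L$ assigning a finite set $L(e)$ to each edge $e$, $G$ is star $k$-edge choosable if for every $L$ with $|L(e)| \geq k$ for all $e$ there is a star edge coloring $\varphi$ with $\varphi(e) \in L(e)$ for all $e$. The list star chromatic index $\mathrm{ch}'_{\mathrm{star}}(G)$ is the minimum such $k$. A generalized Halin graph $H = T \cup C$ is a plane graph consisting of a plane embedding of a tree $T$ with $\Delta(T) \geq 3$ together with a cycle $C$ connecting all the leaves of $T$ such that $C$ is the boundary of the exterior face. *)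

theory Defs
  imports "HOL-Analysis.Analysis"
begin

text \<open>A graph is given by its vertex set \<open>V\<close> and its set \<open>E\<close> of two-element edges.\<close>

definition simple_graph :: "'v set \<Rightarrow> 'v set set \<Rightarrow> bool" where
  "simple_graph V E \<longleftrightarrow> finite V \<and> (\<forall>e\<in>E. e \<subseteq> V \<and> card e = 2)"

definition degree :: "'v set set \<Rightarrow> 'v \<Rightarrow> nat" where
  "degree E v = card {e \<in> E. v \<in> e}"

definition max_degree :: "'v set \<Rightarrow> 'v set set \<Rightarrow> nat" where
  "max_degree V E = Max (degree E ` V)"

fun walk_edges :: "'v list \<Rightarrow> 'v set list" where
  "walk_edges (u # v # p) = {u, v} # walk_edges (v # p)"
| "walk_edges _ = []"

definition graph_path :: "'v set \<Rightarrow> 'v set set \<Rightarrow> 'v list \<Rightarrow> bool" where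
  "graph_path V E p \<longleftrightarrow> p \<noteq> [] \<and> distinct p \<and> set p \<subseteq> V \<and> set (walk_edges p) \<subseteq> E"

text \<open>A cycle is listed without repeating its first vertex, so its length is the length of the
  list.\<close>

definition cycle_edges :: "'v list \<Rightarrow> 'v set list" where
  "cycle_edges p = walk_edges (p @ [hd p])"

definition graph_cycle :: "'v set \<Rightarrow> 'v set set \<Rightarrow> 'v list \<Rightarrow> bool" where
  "graph_cycle V E p \<longleftrightarrow>
     3 \<le> length p \<and> distinct p \<and> set p \<subseteq> V \<and> set (cycle_edges p) \<subseteq> E"

definition graph_connected :: "'v set \<Rightarrow> 'v set set \<Rightarrow> bool" where
  "graph_connected V E \<longleftrightarrow>
     V \<noteq> {} \<and> (\<forall>u\<in>V. \<forall>v\<in>V. \<exists>p. graph_path V E p \<and> hd p = u \<and> last p = v)"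

definition tree :: "'v set \<Rightarrow> 'v set set \<Rightarrow> bool" where
  "tree V E \<longleftrightarrow> simple_graph V E \<and> graph_connected V E \<and> (\<nexists>p. graph_cycle V E p)"

definition leaves :: "'v set \<Rightarrow> 'v set set \<Rightarrow> 'v set" where
  "leaves V E = {v \<in> V. degree E v = 1}"


definition proper_edge_coloring :: "'v set set \<Rightarrow> ('v set \<Rightarrow> nat) \<Rightarrow> bool" where
  "proper_edge_coloring E \<phi> \<longleftrightarrow>
     (\<forall>e\<in>E. \<forall>f\<in>E. e \<noteq> f \<and> e \<inter> f \<noteq> {} \<longrightarrow> \<phi> e \<noteq> \<phi> f)"

definition bichromatic :: "('v set \<Rightarrow> nat) \<Rightarrow> 'v set set \<Rightarrow> bool" where
  "bichromatic \<phi> F \<longleftrightarrow> card (\<phi> ` F) = 2"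

text \<open>The length of a path or cycle is its number of edges: a path of length four has five
  vertices, a cycle of length four has four.\<close>

definition star_edge_coloring :: "'v set \<Rightarrow> 'v set set \<Rightarrow> ('v set \<Rightarrow> nat) \<Rightarrow> bool" where
  "star_edge_coloring V E \<phi> \<longleftrightarrow>
     proper_edge_coloring E \<phi> \<and>
     (\<forall>p. graph_path V E p \<and> length p = 5 \<longrightarrow> \<not> bichromatic \<phi> (set (walk_edges p))) \<and>
     (\<forall>p. graph_cycle V E p \<and> length p = 4 \<longrightarrow> \<not> bichromatic \<phi> (set (cycle_edges p)))"

definition star_edge_choosable :: "'v set \<Rightarrow> 'v set set \<Rightarrow> nat \<Rightarrow> bool" where
  "star_edge_choosable V E k \<longleftrightarrow>
     (\<forall>L :: 'v set \<Rightarrow> nat set. (\<forall>e\<in>E. finite (L e) \<and> k \<le> card (L e)) \<longrightarrow>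
       (\<exists>\<phi>. star_edge_coloring V E \<phi> \<and> (\<forall>e\<in>E. \<phi> e \<in> L e)))"

text \<open>For a finite graph the minimum exists: lists of size \<open>card E\<close> admit a choice of pairwise
  distinct colors.\<close>

definition list_star_chromatic_index :: "'v set \<Rightarrow> 'v set set \<Rightarrow> nat" where
  "list_star_chromatic_index V E = (LEAST k. star_edge_choosable V E k)"


text \<open>A drawing without crossings: vertices are distinct points, edges are arcs joining their two
  ends, and the interior of an edge meets neither a vertex nor another edge.\<close>

definition plane_embedding ::
  "'v set \<Rightarrow> 'v set set \<Rightarrow> ('v \<Rightarrow> complex) \<Rightarrow> ('v set \<Rightarrow> real \<Rightarrow> complex) \<Rightarrow> bool" where
  "plane_embedding V E pos \<gamma> \<longleftrightarrow>
     inj_on pos V \<and>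
     (\<forall>e\<in>E. arc (\<gamma> e) \<and> {pathstart (\<gamma> e), pathfinish (\<gamma> e)} = pos ` e) \<and>
     (\<forall>e\<in>E. (path_image (\<gamma> e) - pos ` e) \<inter> pos ` V = {}) \<and>
     (\<forall>e\<in>E. \<forall>f\<in>E. e \<noteq> f \<longrightarrow> (path_image (\<gamma> e) - pos ` e) \<inter> path_image (\<gamma> f) = {})"

definition drawing ::
  "'v set \<Rightarrow> 'v set set \<Rightarrow> ('v \<Rightarrow> complex) \<Rightarrow> ('v set \<Rightarrow> real \<Rightarrow> complex) \<Rightarrow> complex set" where
  "drawing V E pos \<gamma> = pos ` V \<union> (\<Union>e\<in>E. path_image (\<gamma> e))"

text \<open>The drawing of a finite graph is compact, so \<^const>\<open>outside\<close> of it is the unique unbounded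
  component of its complement, that is, the exterior face.\<close>

definition exterior_face ::
  "'v set \<Rightarrow> 'v set set \<Rightarrow> ('v \<Rightarrow> complex) \<Rightarrow> ('v set \<Rightarrow> real \<Rightarrow> complex) \<Rightarrow> complex set" where
  "exterior_face V E pos \<gamma> = outside (drawing V E pos \<gamma>)"

text \<open>\<open>F\<close> is the edge set of the tree, which spans all vertices, and \<open>c\<close> lists the vertices of
  the cycle through its leaves.\<close>

definition generalized_halin_graph :: "'v set \<Rightarrow> 'v set set \<Rightarrow> bool" where
  "generalized_halin_graph V E \<longleftrightarrow>
     (\<exists>F c pos \<gamma>.
        tree V F \<and> 3 \<le> max_degree V F \<and>
        graph_cycle V E c \<and> set c = leaves V F \<and>
        E = F \<union> set (cycle_edges c) \<and>
        plane_embedding V E pos \<gamma> \<and>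
        frontier (exterior_face V E pos \<gamma>) = (\<Union>e\<in>set (cycle_edges c). path_image (\<gamma> e)))"

end

theory Submission imports Defs begin

text \<open>
  Let \<open>\<Delta>\<close> be the maximum degree and \<open>h = \<Delta> div 2\<close>; lists have size \<open>\<Delta> + h\<close>.
  The tree is colored from a root outwards. Around each inner vertex \<open>m\<close> the neighbors carry the
  labels of a rotational tournament on \<open>2 h + 1\<close> points, and the edges at a neighbor \<open>l\<close> avoid the
  colors of the edges from \<open>m\<close> to the at most \<open>h\<close> neighbors that \<open>l\<close> beats. Since one of any two
  neighbors beats the other, no bichromatic path of length four has \<open>m\<close> in its middle.
  When \<open>m\<close> is reached from \<open>p\<close>, its other edges avoid at most \<open>h + 1\<close> colors. At most \<open>h\<close> of them
  repeat a color at \<open>p\<close>, so these can be given the labels of points that beat \<open>p\<close>, which is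
  exactly what keeps the condition at \<open>p\<close> true.

  In addition, consecutive leaves on the cycle must get tree edges of different colors. Planarity
  makes this cheap: the leaves of a vertex with at most two inner neighbors form at most two runs
  on the cycle, as paths joining alternating vertices of the outer cycle would cross.

  For an edge of the cycle, at most \<open>2 h\<close> colors are then forbidden by the tournaments at the
  parents of its ends, and four more by the tree edges of nearby leaves. As \<open>\<Delta> \<ge> 13\<close>, three colors
  are left, and a cycle of length at least six has a star coloring from lists of size three.

  For tightness, let the center and all its neighbors have degree \<open>\<Delta>\<close>. Each two neighbors of the
  center compete for using each other's color, so some neighbor uses at most \<open>(\<Delta> - 1) div 2\<close> of the
  colors at the center, and sees at least \<open>\<Delta> + h\<close> colors together with the center.
\<close>

section \<open>Star colorings of a cycle from lists of size three\<close>

text \<open>The count at an inner vertex has no slack: of \<Delta> + h colors, h + 1 are forbidden,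
  and a vertex of degree \<Delta> has \<Delta> - 1 edges left to color. The condition on consecutive
  leaves takes up to two more colors from a leaf edge, and this is the obstacle: greedy choice then
  works outright only below degree \<Delta> - 1. At other vertices two edges without outside demands
  are kept for the end; the rest, at most \<Delta> - 3, are chosen from at least \<Delta> - 3 colors
  each. Three inner neighbors supply such edges at once, since they are not on the cycle; otherwise
  planarity leaves only the ends of two runs of leaves exposed.

  The condition itself is needed for paths that pass from a parent to its leaf, to the next leaf and
  on to the parent of that leaf. The cycle edge between the leaves cannot afford to avoid every
  color at a parent, so the two tree edges have to differ.

  The bound 13 is exactly \<Delta> - h \<ge> 7: four tree edges near a cycle edge, and three colors
  to choose from.\<close>

lemma ex_in_diff_two:
  assumes "3 \<le> card A"
  shows "\<exists>x\<in>A. x \<noteq> y \<and> x \<noteq> z"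
proof -
  have "finite A" using assms card.infinite by fastforce
  have "card {y, z} \<le> 2" by (simp add: card_insert_if)
  then have "\<not> A \<subseteq> {y, z}"
    using card_mono[of "{y,z}" A] assms by auto
  then show ?thesis by blast
qed

text \<open>The edge colors of a cycle are read along its infinite unrolling, so that nothing
  special happens where the cycle closes. The second clause excludes the pattern a b a b on four
  consecutive edges.\<close>

definition star_periodic :: "(nat \<Rightarrow> 'a) \<Rightarrow> bool" where
  "star_periodic g \<longleftrightarrow>
     (\<forall>i. g i \<noteq> g (i + 1)) \<and> (\<forall>i. g i = g (i + 2) \<longrightarrow> g (i + 1) \<noteq> g (i + 3))"

lemma periodic_mod:
  fixes f :: "nat \<Rightarrow> 'a"
  assumes "\<And>i. f (i + n) = f i"
  shows "f (i mod n) = f i"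
proof -
  have "f (j + k * n) = f j" for j k
  proof (induction k)
    case (Suc k)
    then show ?case using assms[of "j + k * n"] by (simp add: algebra_simps)
  qed simp
  from this[of "i mod n" "i div n"] show ?thesis by simp
qed

lemma star_periodicI:
  assumes n: "0 < n" and per: "\<And>i. g (i + n) = g i"
    and key: "\<And>j. j < n \<Longrightarrow> g j \<noteq> g (j + 1) \<and> (g j = g (j + 2) \<longrightarrow> g (j + 1) \<noteq> g (j + 3))"
  shows "star_periodic g"
proof -
  have "g (i mod n + c) = g (i + c)" for i c
    using periodic_mod[of g n "i mod n + c", OF per] periodic_mod[of g n "i + c", OF per]
    by (simp add: mod_add_left_eq)
  note mod = this
  have "g i \<noteq> g (i + 1) \<and> (g i = g (i + 2) \<longrightarrow> g (i + 1) \<noteq> g (i + 3))" for i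
    using key[of "i mod n"] n mod[of i 0] mod[of i 1] mod[of i 2] mod[of i 3] by simp
  then show ?thesis unfolding star_periodic_def by blast
qed

text \<open>A color of \<open>L 0\<close> missing from \<open>L (n - 1)\<close> decouples the two ends of the greedy coloring.\<close>

lemma cycle_list_coloring_distinct:
  fixes L :: "nat \<Rightarrow> 'a set"
  assumes n: "6 \<le> n" and L: "\<And>i. 3 \<le> card (L i)"
    and per: "\<And>i. L (i + n) = L i"
    and \<alpha>: "\<alpha> \<in> L 0" "\<alpha> \<notin> L (n - 1)"
  shows "\<exists>g. (\<forall>i. g (i + n) = g i) \<and> (\<forall>i. g i \<in> L i) \<and> star_periodic g"
proof -
  have perm: "L (i mod n) = L i" for i using periodic_mod[of L n] per by blast
  \<comment> \<open>The greedy choice carries the pair of colors at places \<open>i\<close> and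
    \<open>i + 1\<close>, so that the next color can differ from both.\<close>
  define P where "P i q \<longleftrightarrow> fst q \<in> L i \<and> snd q \<in> L (i + 1) \<and> fst q \<noteq> snd q \<and> (i = 0 \<longrightarrow> fst q = \<alpha>)"
    for i and q :: "'a \<times> 'a"
  have "\<exists>f. \<forall>i. P i (f i) \<and> (fst (f (Suc i)) = snd (f i) \<and> snd (f (Suc i)) \<noteq> fst (f i))"
  proof (rule dependent_nat_choice)
    obtain b where "b \<in> L 1" "b \<noteq> \<alpha>" using ex_in_diff_two[OF L] by blast
    then show "\<exists>x. P 0 x" using \<alpha> by (intro exI[of _ "(\<alpha>, b)"]) (auto simp: P_def)
  next
    fix q i assume "P i q"
    moreover obtain b where "b \<in> L (i + 2)" "b \<noteq> fst q" "b \<noteq> snd q" using ex_in_diff_two[OF L] by blast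
    ultimately show "\<exists>y. P (Suc i) y \<and> (fst y = snd q \<and> snd y \<noteq> fst q)"
      by (intro exI[of _ "(snd q, b)"]) (auto simp: P_def)
  qed
  then obtain f where f: "\<And>i. P i (f i)" "\<And>i. fst (f (Suc i)) = snd (f i)"
    "\<And>i. snd (f (Suc i)) \<noteq> fst (f i)"
    by blast
  define s where "s i = fst (f i)" for i
  have s0: "s 0 = \<alpha>" using f(1)[of 0] by (auto simp: P_def s_def)
  have sL: "s i \<in> L i" for i using f(1)[of i] by (auto simp: P_def s_def)
  have s1: "s i \<noteq> s (Suc i)" for i using f(1)[of i] f(2)[of i] by (auto simp: P_def s_def)
  have s2: "s i \<noteq> s (Suc (Suc i))" for i using f(3)[of i] f(2)[of "Suc i"] by (auto simp: s_def)
  \<comment> \<open>The color \<open>u\<close> may repeat the color two places back; this is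
    harmless because \<open>w\<close> differs from \<open>s (n - 3)\<close>. As \<alpha> is not in
    the last list, \<open>w\<close> avoids it for free, and its two exclusions can be spent on
    \<open>u\<close> and \<open>s (n - 3)\<close>.\<close>
  obtain u where u: "u \<in> L (n - 2)" "u \<noteq> s (n - 3)" "u \<noteq> \<alpha>" using ex_in_diff_two[OF L] by blast
  obtain w where w: "w \<in> L (n - 1)" "w \<noteq> u" "w \<noteq> s (n - 3)" using ex_in_diff_two[OF L] by blast
  have w\<alpha>: "w \<noteq> \<alpha>" using w \<alpha> by auto
  obtain k where k: "n = k + 6" using n by (metis add.commute le_Suc_ex)
  define g where "g i = (if i mod n = n - 2 then u else if i mod n = n - 1 then w else s (i mod n))"
    for i
  have per_g: "g (i + n) = g i" for i by (simp add: g_def)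
  moreover have "g i \<in> L i" for i
  proof -
    have "g i \<in> L (i mod n)" unfolding g_def using sL[of "i mod n"] u(1) w(1) by presburger
    then show ?thesis using perm by simp
  qed
  moreover have "star_periodic g"
  proof -
    have key: "g j \<noteq> g (j + 1) \<and> (g j = g (j + 2) \<longrightarrow> g (j + 1) \<noteq> g (j + 3))" if "j < n" for j
    proof -
      have lt: "g i = s i" if i: "i < k + 4" for i
      proof -
        have "i mod n = i" "i \<noteq> n - 2" "i \<noteq> n - 1" using i k by simp_all
        then show ?thesis unfolding g_def by presburger
      qed
      have g4: "g (k + 4) = u" "g (k + 5) = w" using k by (simp_all add: g_def)
      have gn: "g (k + 6) = s 0" "g (k + 7) = s 1" "g (k + 8) = s 2"
        using k per_g[of 0] per_g[of 1] per_g[of 2] lt[of 0] lt[of 1] lt[of 2]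
          by (simp_all add: algebra_simps)
      have lk: "g (k + 1) = s (k + 1)" "g (k + 2) = s (k + 2)" "g (k + 3) = s (k + 3)"
        by (simp_all add: lt)
      have sk: "s (k + 1) \<noteq> s (k + 2)" "s (k + 2) \<noteq> s (k + 3)" "s (k + 1) \<noteq> s (k + 3)"
        "s 0 \<noteq> s 1" "s 0 \<noteq> s 2"
        using s1[of "k + 1"] s1[of "k + 2"] s2[of "k + 1"] s1[of 0] s2[of 0]
        by (simp_all add: eval_nat_numeral)
      have uw: "u \<noteq> s (k + 3)" "w \<noteq> s (k + 3)" "u \<noteq> s 0" "w \<noteq> s 0" "w \<noteq> u"
        using u w w\<alpha> s0 k by (simp_all add: add.commute)
      consider "j + 3 < k + 4" | "j = k + 1" | "j = k + 2" | "j = k + 3" | "j = k + 4" | "j = k + 5"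
        using \<open>j < n\<close> k by linarith
      then show ?thesis
      proof cases
        case 1 then show ?thesis using lt s1[of j] s2[of j] by simp
      next
        case 2
        then have j: "j = k + 1" "j + 1 = k + 2" "j + 2 = k + 3" "j + 3 = k + 4" by simp_all
        show ?thesis unfolding j(2-) unfolding j(1) lk g4 gn using sk uw by auto
      next
        case 3
        then have j: "j = k + 2" "j + 1 = k + 3" "j + 2 = k + 4" "j + 3 = k + 5" by simp_all
        show ?thesis unfolding j(2-) unfolding j(1) lk g4 gn using sk uw by auto
      next
        case 4
        then have j: "j = k + 3" "j + 1 = k + 4" "j + 2 = k + 5" "j + 3 = k + 6" by simp_all
        show ?thesis unfolding j(2-) unfolding j(1) lk g4 gn using sk uw by auto
      next
        case 5
        then have j: "j = k + 4" "j + 1 = k + 5" "j + 2 = k + 6" "j + 3 = k + 7" by simp_all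
        show ?thesis unfolding j(2-) unfolding j(1) lk g4 gn using sk uw by auto
      next
        case 6
        then have j: "j = k + 5" "j + 1 = k + 6" "j + 2 = k + 7" "j + 3 = k + 8" by simp_all
        show ?thesis unfolding j(2-) unfolding j(1) lk g4 gn using sk uw by auto
      qed
    qed
    show ?thesis using n key per_g by (intro star_periodicI[of n]) auto
  qed
  ultimately show ?thesis using per_g by blast
qed

text \<open>Concatenation of \<open>n mod 3\<close> blocks a b a c followed by blocks a b c. All
  blocks start with a b, so every junction looks alike. The length 5 is not a sum of threes and
  fours, which explains the lower bound on \<open>n\<close>.\<close>

lemma cycle_coloring_three:
  assumes n: "6 \<le> n" and abc: "a \<noteq> b" "a \<noteq> c" "b \<noteq> c"
  shows "\<exists>g. (\<forall>i::nat. g (i + n) = g i) \<and> (\<forall>i. g i \<in> {a, b, c}) \<and> star_periodic g"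
proof -
  define r where "r = n mod 3"
  have r: "r < 3" by (simp add: r_def)
  have "\<exists>q. n = 4 * r + 3 * q" unfolding r_def using n by presburger
  then obtain q where q: "n = 4 * r + 3 * q" by blast
  define p where "p j = (if j < 4 * r then (if j mod 4 = 1 then b else if j mod 4 = 3 then c else a)
     else (let t = (j - 4 * r) mod 3 in if t = 0 then a else if t = 1 then b else c))" for j
  define g where "g i = p (i mod n)" for i
  have per_g: "g (i + n) = g i" for i by (simp add: g_def)
  moreover have "g i \<in> {a, b, c}" for i by (auto simp: g_def p_def Let_def)
  moreover have "star_periodic g"
  proof -
    have head: "g j = (if j mod 4 = 1 then b else if j mod 4 = 3 then c else a)" if "j < 4 * r" for j
      using that q by (simp add: g_def p_def)
    \<comment> \<open>The range goes two places beyond the end, which covers the windows that wrap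
      around to the initial a b.\<close>
    have tail: "g (4 * r + t) = (if t mod 3 = 0 then a else if t mod 3 = 1 then b else c)"
      if t: "t < 3 * q + 2" for t
    proof (cases "t < 3 * q")
      case True
      then show ?thesis using q by (simp add: g_def p_def Let_def)
    next
      case False
      then consider "t = 3 * q" | "t = 3 * q + 1" using t by linarith
      then show ?thesis
      proof cases
        case 1
        then have "g (4 * r + t) = p 0" using q per_g[of 0] n by (simp add: g_def)
        then show ?thesis using 1 by (simp add: p_def)
      next
        case 2
        then have "g (4 * r + t) = p 1" using q per_g[of 1] n by (simp add: g_def)
        then show ?thesis using 2 by (cases "r = 0") (simp_all add: p_def mod_Suc)
      qed
    qed
    have key: "g j \<noteq> g (j + 1) \<and> (g j = g (j + 2) \<longrightarrow> g (j + 1) \<noteq> g (j + 3))" if "j < n" for j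
    proof (cases "4 * r \<le> j")
      case True
      define t where "t = j - 4 * r"
      have t: "j = 4 * r + t" "t < 3 * q" using True \<open>j < n\<close> q by (simp_all add: t_def)
      have "g j \<noteq> g (j + 1)" "g j \<noteq> g (j + 2)"
        using tail[of t] tail[of "t + 1"] tail[of "t + 2"] t abc
          by (auto simp: add.assoc mod_Suc split: if_splits)
      then show ?thesis by simp
    next
      case False
      define u where "u = j div 4"
      have u: "u < r" using False by (simp add: u_def)
      have val: "g (4 * u) = a" "g (4 * u + 1) = b" "g (4 * u + 2) = a" "g (4 * u + 3) = c"
      proof -
        have "(4 * u) mod 4 = 0" "(4 * u + 1) mod 4 = 1" "(4 * u + 2) mod 4 = 2" "(4 * u + 3) mod 4 = 3"
          by presburger+
        then show "g (4 * u) = a" "g (4 * u + 1) = b" "g (4 * u + 2) = a" "g (4 * u + 3) = c"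
          using u head[of "4 * u"] head[of "4 * u + 1"] head[of "4 * u + 2"] head[of "4 * u + 3"]
          by auto
      qed
      have val': "g (4 * u + 4) = a" "g (4 * u + 5) = b"
      proof -
        have *: "g (4 * Suc u) = a \<and> g (4 * Suc u + 1) = b"
        proof (cases "Suc u < r")
          case True
          then show ?thesis using head[of "4 * Suc u"] head[of "4 * Suc u + 1"] by simp
        next
          case False
          then have "r = Suc u" using u by simp
          then show ?thesis using tail[of 0] tail[of 1] by simp
        qed
        have "4 * Suc u = 4 * u + 4" "4 * Suc u + 1 = 4 * u + 5" by simp_all
        then show "g (4 * u + 4) = a" "g (4 * u + 5) = b" using * by metis+
      qed
      have "j = 4 * u + j mod 4" "j mod 4 < 4" by (simp_all add: u_def)
      then consider "j = 4 * u" | "j = 4 * u + 1" | "j = 4 * u + 2" | "j = 4 * u + 3" by linarith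
      then show ?thesis
      proof cases
        case 1
        then have j: "j = 4 * u" "j + 1 = 4 * u + 1" "j + 2 = 4 * u + 2" "j + 3 = 4 * u + 3" by simp_all
        show ?thesis unfolding j(2-) unfolding j(1) val val' using abc by simp
      next
        case 2
        then have j: "j = 4 * u + 1" "j + 1 = 4 * u + 2" "j + 2 = 4 * u + 3" "j + 3 = 4 * u + 4"
          by simp_all
        show ?thesis unfolding j(2-) unfolding j(1) val val' using abc by simp
      next
        case 3
        then have j: "j = 4 * u + 2" "j + 1 = 4 * u + 3" "j + 2 = 4 * u + 4" "j + 3 = 4 * u + 5"
          by simp_all
        show ?thesis unfolding j(2-) unfolding j(1) val val' using abc by simp
      next
        case 4
        then have j: "j = 4 * u + 3" "j + 1 = 4 * u + 4" "j + 2 = 4 * u + 5" by simp_all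
        show ?thesis unfolding j(2-) unfolding j(1) val val' using abc by simp
      qed
    qed
    show ?thesis using n key per_g by (intro star_periodicI[of n]) auto
  qed
  ultimately show ?thesis using per_g by blast
qed

text \<open>After shrinking to three colors per list, either all lists agree, or two consecutive
  lists differ. In the second case equal sizes yield a color of the later list that is missing from
  the earlier one, and the cycle is rotated to start there.\<close>

lemma cycle_list_coloring:
  fixes L :: "nat \<Rightarrow> 'a set"
  assumes n: "6 \<le> n" and L: "\<And>i. 3 \<le> card (L i)"
    and per: "\<And>i. L (i + n) = L i"
  shows "\<exists>g. (\<forall>i. g (i + n) = g i) \<and> (\<forall>i. g i \<in> L i) \<and> star_periodic g"
proof -
  \<comment> \<open>The choice depends on the set \<open>L i\<close> only, so \<open>M\<close>
    inherits the period of \<open>L\<close>.\<close>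
  define M where "M i = (SOME S. S \<subseteq> L i \<and> card S = 3)" for i
  have "\<exists>S. S \<subseteq> L i \<and> card S = 3" for i using obtain_subset_with_card_n[OF L] by metis
  then have M: "M i \<subseteq> L i" "card (M i) = 3" for i unfolding M_def
    by (metis (mono_tags, lifting) someI_ex)+
  have Mper: "M (i + n) = M i" for i by (simp add: M_def per)
  show ?thesis
  proof (cases "\<forall>i<n. M i = M (Suc i)")
    case True
    have eq: "M i = M 0" if "i \<le> n" for i using that
      by (induction i) (use True in auto)
    obtain a b c where abc: "M 0 = {a, b, c}" "a \<noteq> b" "a \<noteq> c" "b \<noteq> c"
      using M(2)[of 0] by (auto simp: card_3_iff)
    obtain g where g: "\<forall>i. g (i + n) = g i" "\<forall>i::nat. g i \<in> {a, b, c}" "star_periodic g"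
      using cycle_coloring_three[OF n abc(2-)] by blast
    have "M (i mod n) = M i" for i using periodic_mod[of M n] Mper by blast
    then have "M i = M 0" for i using eq[of "i mod n"] n by (simp add: less_imp_le)
    then show ?thesis using g abc M(1) by (intro exI[of _ g]) blast
  next
    case False
    then obtain s where s: "s < n" "M s \<noteq> M (Suc s)" by blast
    have "\<not> M (Suc s) \<subseteq> M s"
      using s M(2) by (metis card_subset_eq card.infinite zero_neq_numeral)
    then obtain \<alpha> where \<alpha>: "\<alpha> \<in> M (Suc s)" "\<alpha> \<notin> M s" by blast
    define M' where "M' j = M (j + Suc s)" for j
    have "\<exists>g. (\<forall>i. g (i + n) = g i) \<and> (\<forall>i. g i \<in> M' i) \<and> star_periodic g"
    proof (rule cycle_list_coloring_distinct[OF n])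
      show "3 \<le> card (M' i)" for i by (simp add: M'_def M)
      show "M' (i + n) = M' i" for i using Mper[of "i + Suc s"] by (simp add: M'_def algebra_simps)
      show "\<alpha> \<in> M' 0" using \<alpha> by (simp add: M'_def)
      show "\<alpha> \<notin> M' (n - 1)" using \<alpha> Mper[of s] s by (simp add: M'_def algebra_simps)
    qed
    then obtain g where g: "\<And>i. g (i + n) = g i" "\<And>i. g i \<in> M' i" "star_periodic g" by blast
    define g' where "g' j = g (j + (n - Suc s))" for j
    have "g' (i + n) = g' i" for i using g(1)[of "i + (n - Suc s)"] by (simp add: g'_def algebra_simps)
    moreover have "g' i \<in> L i" for i
      using g(2)[of "i + (n - Suc s)"] s Mper[of i] M(1)[of i] by (auto simp: g'_def M'_def)
    moreover have "star_periodic g'"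
    proof -
      have "g' (i + k) = g (i + (n - Suc s) + k)" for i k by (simp add: g'_def algebra_simps)
      then show ?thesis using g(3) unfolding star_periodic_def by (simp add: g'_def)
    qed
    ultimately show ?thesis by blast
  qed
qed

section \<open>Growing a tree from a root\<close>

lemma walk_edges_Cons: "p \<noteq> [] \<Longrightarrow> walk_edges (u # p) = {u, hd p} # walk_edges p"
  by (cases p) auto

lemma walk_edges_snoc: "p \<noteq> [] \<Longrightarrow> walk_edges (p @ [v]) = walk_edges p @ [{last p, v}]"
  by (induction p rule: walk_edges.induct) auto

lemma length_walk_edges: "length (walk_edges p) = length p - 1"
  by (induction p rule: walk_edges.induct) auto

lemma walk_edges_nth: "Suc i < length p \<Longrightarrow> walk_edges p ! i = {p ! i, p ! Suc i}"
proof (induction p arbitrary: i rule: walk_edges.induct)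
  case (1 u v p)
  then show ?case by (cases i) auto
qed auto

lemma set_walk_edges: "set (walk_edges p) = {{p ! i, p ! Suc i} |i. Suc i < length p}"
proof -
  have "i < length (walk_edges p) \<longleftrightarrow> Suc i < length p" for i
    by (auto simp: length_walk_edges)
  then show ?thesis unfolding set_conv_nth using walk_edges_nth by (metis (no_types, lifting))
qed

definition nbhd :: "'v set set \<Rightarrow> 'v \<Rightarrow> 'v set" where
  "nbhd E v = {w. {v, w} \<in> E}"

lemma nbhd_iff: "w \<in> nbhd E v \<longleftrightarrow> {v, w} \<in> E"
  by (simp add: nbhd_def)

lemma simple_graph_edgeD:
  assumes "simple_graph V E" "{u, v} \<in> E"
  shows "u \<noteq> v" "u \<in> V" "v \<in> V"
  using assms by (auto simp: simple_graph_def)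

lemma simple_graph_edgeE:
  assumes "simple_graph V E" "e \<in> E" "v \<in> e"
  obtains w where "e = {v, w}" "w \<noteq> v" "w \<in> nbhd E v"
proof -
  have "card e = 2" using assms by (auto simp: simple_graph_def)
  then obtain a b where "e = {a, b}" "a \<noteq> b" by (auto simp: card_2_iff)
  with assms(2,3) that show thesis by (auto simp: nbhd_iff insert_commute)
qed

lemma nbhd_subset: "simple_graph V E \<Longrightarrow> nbhd E v \<subseteq> V"
  by (auto simp: nbhd_iff dest: simple_graph_edgeD)

lemma finite_nbhd: "simple_graph V E \<Longrightarrow> finite (nbhd E v)"
  using nbhd_subset by (metis finite_subset simple_graph_def)

lemma incident_edges_eq:
  assumes "simple_graph V E"
  shows "{e \<in> E. v \<in> e} = (\<lambda>w. {v, w}) ` nbhd E v"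
  using assms by (auto simp: nbhd_iff elim: simple_graph_edgeE)

lemma degree_eq_card_nbhd:
  assumes "simple_graph V E"
  shows "degree E v = card (nbhd E v)"
proof -
  have "inj_on (\<lambda>w. {v, w}) (nbhd E v)"
    by (auto simp: inj_on_def doubleton_eq_iff)
  then show ?thesis
    unfolding degree_def incident_edges_eq[OF assms] by (rule card_image)
qed

lemma finite_edges: "simple_graph V E \<Longrightarrow> finite E"
  by (auto simp: simple_graph_def intro!: finite_subset[of E "Pow V"])

lemma tree_simple: "tree V F \<Longrightarrow> simple_graph V F"
  by (simp add: tree_def)

lemma graph_connectedE:
  assumes "graph_connected D F" "u \<in> D" "v \<in> D"
  obtains p where "graph_path D F p" "hd p = u" "last p = v"
  using assms unfolding graph_connected_def by blast

text \<open>A path in \<open>D\<close> between two neighbors of \<open>w\<close> would close to a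
  cycle through \<open>w\<close>. Hence a connected part of the tree is attached to each outside
  vertex by at most one edge.\<close>

lemma nbr_unique_of_connected:
  assumes T: "tree V F" and D: "graph_connected D F" "D \<subseteq> V" and w: "w \<notin> D"
    and u: "u \<in> D" "{w, u} \<in> F" and u': "u' \<in> D" "{w, u'} \<in> F"
  shows "u = u'"
proof (rule ccontr)
  assume ne: "u \<noteq> u'"
  obtain p where p: "graph_path D F p" "hd p = u" "last p = u'"
    using graph_connectedE[OF D(1) u(1) u'(1)] by blast
  have pne: "p \<noteq> []" using p by (simp add: graph_path_def)
  have len: "2 \<le> length p"
    using p ne pne by (cases p; cases "tl p") (auto simp: neq_Nil_conv)
  have wV: "w \<in> V" using T u by (auto dest: tree_simple simple_graph_edgeD)
  have "graph_cycle V F (w # p)"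
    unfolding graph_cycle_def
  proof (intro conjI)
    show "3 \<le> length (w # p)" using len by simp
    show "distinct (w # p)" "set (w # p) \<subseteq> V" using p w D wV by (auto simp: graph_path_def)
    have "cycle_edges (w # p) = {w, u} # walk_edges p @ [{u', w}]"
      using pne p by (simp add: cycle_edges_def walk_edges_Cons walk_edges_snoc)
    then show "set (cycle_edges (w # p)) \<subseteq> F"
      using u u' p by (auto simp: graph_path_def insert_commute)
  qed
  then show False using T by (auto simp: tree_def)
qed

lemma graph_connected_insert:
  assumes D: "graph_connected D F" and m: "m \<notin> D" and p: "p \<in> D" "{p, m} \<in> F"
  shows "graph_connected (insert m D) F"
  unfolding graph_connected_def
proof (intro conjI ballI)
  show "insert m D \<noteq> {}" by simp
next
  have mono: "graph_path (insert m D) F q" if "graph_path D F q" for q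
    using that by (auto simp: graph_path_def)
  have to: "\<exists>q. graph_path (insert m D) F q \<and> hd q = u \<and> last q = m" if uD: "u \<in> D" for u
  proof -
    obtain q where q: "graph_path D F q" "hd q = u" "last q = p"
      using graph_connectedE[OF D uD p(1)] by blast
    then have "graph_path (insert m D) F (q @ [m])" "hd (q @ [m]) = u" "last (q @ [m]) = m"
      using m p by (auto simp: graph_path_def walk_edges_snoc)
    then show ?thesis by blast
  qed
  have from': "\<exists>q. graph_path (insert m D) F q \<and> hd q = m \<and> last q = u" if uD: "u \<in> D" for u
  proof -
    obtain q where q: "graph_path D F q" "hd q = p" "last q = u"
      using graph_connectedE[OF D p(1) uD] by blast
    then have "graph_path (insert m D) F (m # q)" "hd (m # q) = m" "last (m # q) = u"
      using m p by (auto simp: graph_path_def walk_edges_Cons insert_commute)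
    then show ?thesis by blast
  qed
  fix u v assume u: "u \<in> insert m D" and v: "v \<in> insert m D"
  consider "u = m" "v = m" | "u = m" "v \<in> D" | "u \<in> D" "v = m" | "u \<in> D" "v \<in> D" using u v by blast
  then show "\<exists>q. graph_path (insert m D) F q \<and> hd q = u \<and> last q = v"
  proof cases
    case 1 then show ?thesis by (intro exI[of _ "[m]"]) (auto simp: graph_path_def)
  next
    case 2 then show ?thesis using from' by blast
  next
    case 3 then show ?thesis using to by blast
  next
    case 4 then show ?thesis using graph_connectedE[OF D, of u v] mono by blast
  qed
qed

lemma graph_path_edge: "graph_path V F q \<Longrightarrow> Suc i < length q \<Longrightarrow> {q ! i, q ! Suc i} \<in> F"
  unfolding graph_path_def set_walk_edges by blast

lemma inner_degree:
  assumes "simple_graph V F" "graph_path V F q" "0 < i" "Suc i < length q"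
  shows "2 \<le> degree F (q ! i)"
proof -
  obtain j where j: "i = Suc j" using assms(3) by (cases i) auto
  have "{q ! j, q ! i} \<in> F" "{q ! i, q ! Suc i} \<in> F"
    using graph_path_edge[OF assms(2)] assms(4) j by simp_all
  moreover have "q ! j \<noteq> q ! Suc i"
    using assms(2,4) j by (simp add: graph_path_def nth_eq_iff_index_eq)
  ultimately have "{q ! j, q ! Suc i} \<subseteq> nbhd F (q ! i)" by (auto simp: nbhd_iff insert_commute)
  then have "card {q ! j, q ! Suc i} \<le> card (nbhd F (q ! i))"
    by (rule card_mono[OF finite_nbhd[OF assms(1)]])
  then show ?thesis using \<open>q ! j \<noteq> q ! Suc i\<close> degree_eq_card_nbhd[OF assms(1)] by simp
qed

text \<open>Only inner vertices are added. The next one is found where a path from \<open>r\<close>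
  to a missing inner vertex first steps out of \<open>D\<close>; it is no leaf, being either
  interior to that path or its end. The last premise of \<open>step\<close> says that a single edge
  at \<open>m\<close> has been treated before.\<close>

lemma tree_grow_induct [consumes 2, case_names root step]:
  assumes T: "tree V F" and r: "r \<in> V - leaves V F"
    and root: "P {r}"
    and step: "\<And>D m p. \<lbrakk>graph_connected D F; r \<in> D; D \<subseteq> V - leaves V F; P D;
        m \<in> V - leaves V F; m \<notin> D; p \<in> D; {p, m} \<in> F; nbhd F m \<inter> D = {p}\<rbrakk> \<Longrightarrow> P (insert m D)"
  shows "P (V - leaves V F)"
proof -
  let ?N = "V - leaves V F"
  have fin: "finite ?N" using T by (auto simp: tree_def simple_graph_def)
  have *: "P ?N" if "graph_connected D F" "r \<in> D" "D \<subseteq> ?N" "P D" for D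
    using that
  proof (induction "card (?N - D)" arbitrary: D rule: less_induct)
    case less
    show ?case
    proof (cases "D = ?N")
      case True then show ?thesis using less by simp
    next
      case False
      then obtain x where x: "x \<in> ?N" "x \<notin> D" using less by blast
      obtain q where q: "graph_path V F q" "hd q = r" "last q = x"
        using T r x unfolding tree_def graph_connected_def by blast
      have qne: "q \<noteq> []" using q by (simp add: graph_path_def)
      have q0: "q ! 0 \<in> D" using q qne less.prems by (simp add: hd_conv_nth[symmetric])
      have ql: "q ! (length q - 1) \<notin> D" using q qne x by (metis last_conv_nth)
      obtain i where i: "Suc i < length q" "q ! i \<in> D" "q ! Suc i \<notin> D"
      proof -
        have "\<exists>i<length q - 1. q ! i \<in> D \<and> q ! Suc i \<notin> D"
        proof (rule ccontr)
          assume "\<not> ?thesis"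
          then have "q ! i \<in> D" if "i \<le> length q - 1" for i
            using that q0 by (induction i) auto
          then show False using ql by simp
        qed
        then obtain i where "i < length q - 1" "q ! i \<in> D" "q ! Suc i \<notin> D" by blast
        then show thesis using that[of i] by simp
      qed
      let ?m = "q ! Suc i"
      have pm: "{q ! i, ?m} \<in> F" using q i by (auto simp: graph_path_def set_walk_edges)
      have mN: "?m \<in> ?N"
      proof (cases "Suc (Suc i) < length q")
        case True
        then have "2 \<le> degree F ?m" using inner_degree[of V F q "Suc i"] T q by (auto simp: tree_simple)
        moreover have "?m \<in> V" using q i unfolding graph_path_def by (meson nth_mem subsetD)
        ultimately show ?thesis by (auto simp: leaves_def)
      next
        case False
        then have "Suc i = length q - 1" using i by simp
        then have "?m = x" using q qne by (simp add: last_conv_nth)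
        then show ?thesis using x by simp
      qed
      have nb: "nbhd F ?m \<inter> D = {q ! i}"
      proof -
        have DV: "D \<subseteq> V" using less.prems by blast
        have "x = q ! i" if "x \<in> nbhd F ?m" "x \<in> D" for x
          using nbr_unique_of_connected[OF T less.prems(1) DV i(3), of x "q ! i"] that i pm
          by (simp add: nbhd_iff insert_commute)
        moreover have "q ! i \<in> nbhd F ?m" using pm by (simp add: nbhd_iff insert_commute)
        ultimately show ?thesis using i(2) by blast
      qed
      have "P (insert ?m D)" by (rule step[OF less.prems mN i(3) i(2) pm nb])
      moreover have "card (?N - insert ?m D) < card (?N - D)"
        using mN i fin by (intro psubset_card_mono) auto
      moreover have "graph_connected (insert ?m D) F"
        by (rule graph_connected_insert[OF less.prems(1) i(3) i(2) pm])
      ultimately show ?thesis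
        by (intro less.hyps[of "insert ?m D"]) (use less.prems mN in simp_all)
    qed
  qed
  have "graph_connected {r} F"
    unfolding graph_connected_def
  proof (intro conjI ballI)
    fix u v assume "u \<in> {r}" "v \<in> {r}"
    then show "\<exists>p. graph_path {r} F p \<and> hd p = u \<and> last p = v"
      by (intro exI[of _ "[r]"]) (simp add: graph_path_def)
  qed simp
  then show ?thesis by (intro *[of "{r}"]) (use root r in simp_all)
qed

text \<open>The boundary \<open>B D\<close> starts as the neighborhood of \<open>r\<close> and never
  shrinks: an added inner vertex leaves it, but at least one further neighbor enters. In the end the
  boundary consists of leaves. This makes the outer cycle long enough for the cycle
  coloring.\<close>

lemma leaves_ge_degree:
  assumes T: "tree V F" and r: "r \<in> V - leaves V F"
  shows "degree F r \<le> card (leaves V F)"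
proof -
  note S = tree_simple[OF T]
  define B where "B D = {w \<in> V - D. \<exists>u\<in>D. {u, w} \<in> F}" for D
  have fin: "finite (B D)" for D using S by (auto simp: B_def simple_graph_def)
  have "degree F r \<le> card (B (V - leaves V F))"
    using T r
  proof (induction rule: tree_grow_induct)
    case root
    have "B {r} = nbhd F r" using nbhd_subset[OF S, of r] simple_graph_edgeD(1)[OF S, of r r]
      by (auto simp: B_def nbhd_iff)
    then show ?case by (simp add: degree_eq_card_nbhd[OF S])
  next
    case (step D m p)
    have "m \<in> B D" using step by (auto simp: B_def)
    have "2 \<le> degree F m"
    proof -
      have "degree F m \<noteq> 1" "m \<in> V" using step by (auto simp: leaves_def)
      moreover have "p \<in> nbhd F m" using step by (auto simp: nbhd_iff insert_commute)
      then have "degree F m \<noteq> 0" using finite_nbhd[OF S] by (auto simp: degree_eq_card_nbhd[OF S])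
      ultimately show ?thesis by linarith
    qed
    then have "\<not> nbhd F m \<subseteq> {p}" using card_mono[of "{p}" "nbhd F m"]
      by (auto simp: degree_eq_card_nbhd[OF S])
    then obtain w where w: "w \<in> nbhd F m" "w \<noteq> p" by blast
    have wm: "w \<noteq> m" "w \<in> V" "{w, m} \<in> F" using w simple_graph_edgeD[OF S]
      by (auto simp: nbhd_iff insert_commute)
    have wD: "w \<notin> D" using w step by blast
    have conn: "graph_connected (insert m D) F" using graph_connected_insert step by metis
    have "w \<notin> B D"
    proof
      assume "w \<in> B D"
      then obtain u where u: "u \<in> D" "{w, u} \<in> F" by (auto simp: B_def insert_commute)
      then have "u = m" using nbr_unique_of_connected[OF T conn, of w u m] wD wm step by auto
      then show False using u step by blast
    qed
    have "insert w (B D - {m}) \<subseteq> B (insert m D)"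
      using w wm wD by (auto simp: B_def nbhd_iff)
    then have "card (insert w (B D - {m})) \<le> card (B (insert m D))" using fin card_mono by blast
    moreover have "card (insert w (B D - {m})) = card (B D)"
      using \<open>w \<notin> B D\<close> fin[of D] card.remove[OF fin \<open>m \<in> B D\<close>] by simp
    ultimately show ?case using step.IH by linarith
  qed
  also have "\<dots> \<le> card (leaves V F)"
  proof (rule card_mono)
    show "finite (leaves V F)" using S by (auto simp: leaves_def simple_graph_def)
    show "B (V - leaves V F) \<subseteq> leaves V F" by (auto simp: B_def)
  qed
  finally show ?thesis .
qed

section \<open>Greedy choices and the rotational tournament\<close>

text \<open>Systems of distinct representatives, chosen greedily: every set in the second group is
  large enough to survive all other choices.\<close>

lemma sdr_extend:
  assumes "finite W1" "finite W0" "inj_on g W0" "W0 \<inter> W1 = {}"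
    and "\<And>w. w \<in> W1 \<Longrightarrow> finite (S w) \<and> card W0 + card W1 \<le> card (S w)"
  shows "\<exists>g'. (\<forall>w\<in>W0. g' w = g w) \<and> inj_on g' (W0 \<union> W1) \<and> (\<forall>w\<in>W1. g' w \<in> S w)"
  using assms
proof (induction W1 rule: finite_induct)
  case empty
  then show ?case by (intro exI[of _ g]) auto
next
  case (insert x W1)
  have "\<exists>g'. (\<forall>w\<in>W0. g' w = g w) \<and> inj_on g' (W0 \<union> W1) \<and> (\<forall>w\<in>W1. g' w \<in> S w)"
  proof (rule insert.IH)
    fix w assume "w \<in> W1"
    then show "finite (S w) \<and> card W0 + card W1 \<le> card (S w)"
      using insert.prems(4)[of w] insert.hyps by auto
  qed (use insert.prems in auto)
  then obtain g' where g': "\<forall>w\<in>W0. g' w = g w" "inj_on g' (W0 \<union> W1)" "\<forall>w\<in>W1. g' w \<in> S w" by blast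
  have "card (g' ` (W0 \<union> W1)) \<le> card W0 + card W1"
    by (meson card_Un_le card_image_le finite_UnI insert.hyps(1) insert.prems(1) le_trans)
  also have "\<dots> < card (S x)" using insert.prems(4)[of x] insert.hyps by auto
  finally have "\<not> S x \<subseteq> g' ` (W0 \<union> W1)"
    using card_mono[of "g' ` (W0 \<union> W1)" "S x"] insert.hyps insert.prems by auto
  then obtain c where c: "c \<in> S x" "c \<notin> g' ` (W0 \<union> W1)" by blast
  have x: "x \<notin> W0 \<union> W1" using insert by auto
  show ?case
  proof (intro exI[of _ "g'(x := c)"] conjI)
    show "\<forall>w\<in>W0. (g'(x := c)) w = g w" using g' x by auto
    show "\<forall>w\<in>insert x W1. (g'(x := c)) w \<in> S w" using g' x c by auto
    have "(g'(x := c)) ` (W0 \<union> W1) = g' ` (W0 \<union> W1)" using x by auto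
    moreover have "inj_on (g'(x := c)) (W0 \<union> W1)" using g'(2) x by (auto simp: inj_on_def)
    ultimately show "inj_on (g'(x := c)) (W0 \<union> insert x W1)"
      using c x by (auto simp: inj_on_insert)
  qed
qed

text \<open>Elements with small sets choose first and compete only among themselves; those in
  \<open>Z\<close> have sets large enough to choose last.\<close>

lemma sdr_two_stage:
  assumes "finite W" "Z \<subseteq> W" "card W \<le> n" "card (W - Z) \<le> k"
    and S: "\<And>w. w \<in> W \<Longrightarrow> finite (S w) \<and> k \<le> card (S w)"
    and SZ: "\<And>w. w \<in> Z \<Longrightarrow> n \<le> card (S w)"
  shows "\<exists>g. inj_on g W \<and> (\<forall>w\<in>W. g w \<in> S w)"
proof -
  have "\<exists>g. (\<forall>w\<in>{}. g w = undefined w) \<and> inj_on g ({} \<union> (W - Z)) \<and> (\<forall>w\<in>W - Z. g w \<in> S w)"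
  proof (intro sdr_extend)
    fix w assume w: "w \<in> W - Z"
    then show "finite (S w) \<and> card ({} :: 'a set) + card (W - Z) \<le> card (S w)"
      using S[of w] assms(4) by auto
  qed (use assms(1) in auto)
  then obtain g where g: "inj_on g (W - Z)" "\<forall>w\<in>W - Z. g w \<in> S w" by auto
  have fin: "finite Z" "finite (W - Z)" using assms(1,2) finite_subset by auto
  have "card (W - Z) + card Z = card W"
    using card_Diff_subset[OF fin(1) assms(2)] card_mono[OF assms(1,2)] by simp
  then have "\<exists>g'. (\<forall>w\<in>W - Z. g' w = g w) \<and> inj_on g' ((W - Z) \<union> Z) \<and> (\<forall>w\<in>Z. g' w \<in> S w)"
  proof (intro sdr_extend)
    fix w assume w: "w \<in> Z"
    then show "finite (S w) \<and> card (W - Z) + card Z \<le> card (S w)"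
      using S[of w] SZ[OF w] assms(2,3) \<open>card (W - Z) + card Z = card W\<close> by auto
  next
    show "inj_on g (W - Z)" by (rule g(1))
  qed (use fin in auto)
  then obtain g' where "\<forall>w\<in>W - Z. g' w = g w" "inj_on g' ((W - Z) \<union> Z)" "\<forall>w\<in>Z. g' w \<in> S w" by blast
  moreover have "(W - Z) \<union> Z = W" using assms by blast
  ultimately show ?thesis using g by (intro exI[of _ g']) auto
qed

text \<open>The rotational tournament on \<open>{..2 * h}\<close>: \<open>beats h a b\<close> iff \<open>a - b\<close> is congruent to one of
  \<open>1, \<dots>, h\<close> modulo \<open>2 * h + 1\<close>.\<close>

definition beats :: "nat \<Rightarrow> nat \<Rightarrow> nat \<Rightarrow> bool" where
  "beats h a b \<longleftrightarrow> (b < a \<and> a \<le> b + h) \<or> a + h < b"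

lemma beats_total: "a \<noteq> b \<Longrightarrow> beats h a b \<or> beats h b a"
  by (auto simp: beats_def)

lemma card_beats_out: "a \<le> 2 * h \<Longrightarrow> card {b. b \<le> 2 * h \<and> beats h a b} \<le> h"
proof -
  assume a: "a \<le> 2 * h"
  have "{b. b \<le> 2 * h \<and> beats h a b} \<subseteq> {a - h..<a} \<union> {a + h<..2 * h}" by (auto simp: beats_def)
  then have "card {b. b \<le> 2 * h \<and> beats h a b} \<le> card ({a - h..<a} \<union> {a + h<..2 * h})"
    by (intro card_mono) auto
  also have "\<dots> \<le> card {a - h..<a} + card {a + h<..2 * h}" by (rule card_Un_le)
  also have "\<dots> \<le> h" using a by auto
  finally show ?thesis .
qed

lemma card_beats_in: "a \<le> 2 * h \<Longrightarrow> card {b. b \<le> 2 * h \<and> beats h b a} \<le> h"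
proof -
  assume a: "a \<le> 2 * h"
  have "{b. b \<le> 2 * h \<and> beats h b a} \<subseteq> {a<..min (a + h) (2 * h)} \<union> {..<a - h}" by (auto simp: beats_def)
  then have "card {b. b \<le> 2 * h \<and> beats h b a} \<le> card ({a<..min (a + h) (2 * h)} \<union> {..<a - h})"
    by (intro card_mono) auto
  also have "\<dots> \<le> card {a<..min (a + h) (2 * h)} + card {..<a - h}" by (rule card_Un_le)
  also have "\<dots> \<le> h" using a by (auto simp: min_def)
  finally show ?thesis .
qed

lemma card_labels_le:
  assumes "inj_on f N" "f ` N \<subseteq> {..2 * h}" "finite N" "card {b. b \<le> 2 * h \<and> Q b} \<le> h"
  shows "card {r \<in> N. Q (f r)} \<le> h"
proof -
  have "card {r \<in> N. Q (f r)} = card (f ` {r \<in> N. Q (f r)})"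
    using assms(1) by (intro card_image[symmetric]) (auto simp: inj_on_def)
  also have "\<dots> \<le> card {b. b \<le> 2 * h \<and> Q b}" using assms(2) by (intro card_mono) auto
  finally show ?thesis using assms(4) by simp
qed

text \<open>The labels \<open>1..h\<close> are exactly the points that beat 0. As the tournament is
  rotational, placing \<open>p\<close> at 0 loses nothing.\<close>

lemma labelling_exists:
  assumes N: "finite N" "card N \<le> 2 * h + 1" "p \<in> N" and A: "A \<subseteq> N - {p}" "card A \<le> h"
  shows "\<exists>\<nu>. inj_on \<nu> N \<and> \<nu> ` N \<subseteq> {..2 * h} \<and> \<nu> p = (0::nat) \<and> \<nu> ` A \<subseteq> {1..h}"
proof -
  have finA: "finite A" using A N finite_subset by blast
  have pA: "p \<notin> A" using A by blast
  have "\<exists>g. (\<forall>w\<in>{p}. g w = (\<lambda>_. 0) w) \<and> inj_on g ({p} \<union> A) \<and> (\<forall>w\<in>A. g w \<in> {..h})"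
  proof (intro sdr_extend)
    fix w show "finite {..h} \<and> card {p} + card A \<le> card {..h}" using A by simp
  qed (use pA finA in auto)
  then obtain g where g: "g p = (0::nat)" "inj_on g ({p} \<union> A)" "\<forall>w\<in>A. g w \<in> {..h}" by auto
  have sub: "{p} \<union> A \<subseteq> N" using A N by blast
  have cardN: "card ({p} \<union> A) + card (N - ({p} \<union> A)) = card N"
    using card_Diff_subset[OF _ sub] card_mono[OF N(1) sub] finA by simp
  have "\<exists>g'. (\<forall>w\<in>{p} \<union> A. g' w = g w) \<and> inj_on g' (({p} \<union> A) \<union> (N - ({p} \<union> A)))
      \<and> (\<forall>w\<in>N - ({p} \<union> A). g' w \<in> {..2 * h})"
  proof (intro sdr_extend)
    fix w show "finite {..2 * h} \<and> card ({p} \<union> A) + card (N - ({p} \<union> A)) \<le> card {..2 * h}"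
      using cardN N by simp
  next
    show "inj_on g ({p} \<union> A)" by (rule g(2))
  qed (use N finA in auto)
  then obtain g' where g': "\<forall>w\<in>{p} \<union> A. g' w = g w" "inj_on g' (({p} \<union> A) \<union> (N - ({p} \<union> A)))"
    "\<forall>w\<in>N - ({p} \<union> A). g' w \<in> {..2 * h}" by blast
  have eq: "({p} \<union> A) \<union> (N - ({p} \<union> A)) = N" using N A by blast
  show ?thesis
  proof (intro exI[of _ g'] conjI)
    show inj: "inj_on g' N" using g'(2) unfolding eq .
    show p0: "g' p = 0" using g' g by simp
    have *: "g' a \<le> h" if "a \<in> A" for a using that g' g by auto
    show "g' ` N \<subseteq> {..2 * h}"
    proof (rule image_subsetI)
      fix x assume "x \<in> N"
      then consider "x = p" | "x \<in> A" | "x \<in> N - ({p} \<union> A)" by blast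
      then show "g' x \<in> {..2 * h}"
      proof cases
        case 1 then show ?thesis using p0 by simp
      next
        case 2 then show ?thesis using *[of x] by simp
      next
        case 3 then show ?thesis using g'(3) by blast
      qed
    qed
    show "g' ` A \<subseteq> {1..h}"
    proof (rule image_subsetI)
      fix a assume a: "a \<in> A"
      then have "a \<in> N" "a \<noteq> p" using A by auto
      then have "g' a \<noteq> g' p" using inj N(3) by (simp add: inj_on_eq_iff)
      then show "g' a \<in> {1..h}" using *[OF a] p0 by auto
    qed
  qed
qed

section \<open>Coloring the tree\<close>

text \<open>Partial colorings, defined on the edges that meet \<open>D\<close>. The labels \<open>f m\<close> place the neighbors of
  \<open>m\<close> in the tournament; edges at a neighbor \<open>l\<close> of \<open>m\<close> avoid the colors of the edges from \<open>m\<close> to the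
  neighbors beaten by \<open>l\<close>. The relation \<open>S\<close> stands for adjacency on the cycle.\<close>

definition tree_coloring ::
  "'v set set \<Rightarrow> ('v \<Rightarrow> 'v \<Rightarrow> bool) \<Rightarrow> nat \<Rightarrow> ('v set \<Rightarrow> 'c set) \<Rightarrow> 'v set \<Rightarrow>
    ('v set \<Rightarrow> 'c) \<Rightarrow> ('v \<Rightarrow> 'v \<Rightarrow> nat) \<Rightarrow> bool" where
  "tree_coloring F S h L D \<phi> f \<longleftrightarrow>
     (\<forall>e\<in>F. e \<inter> D \<noteq> {} \<longrightarrow> \<phi> e \<in> L e) \<and>
     (\<forall>e\<in>F. \<forall>e'\<in>F. e \<inter> D \<noteq> {} \<and> e' \<inter> D \<noteq> {} \<and> e \<noteq> e' \<and> e \<inter> e' \<noteq> {} \<longrightarrow> \<phi> e \<noteq> \<phi> e') \<and>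
     (\<forall>m\<in>D. inj_on (f m) (nbhd F m) \<and> f m ` nbhd F m \<subseteq> {..2 * h}) \<and>
     (\<forall>m\<in>D. \<forall>l\<in>D. {m, l} \<in> F \<longrightarrow> (\<forall>r\<in>nbhd F m. beats h (f m l) (f m r) \<longrightarrow>
        (\<forall>e\<in>F. l \<in> e \<and> e \<noteq> {m, l} \<longrightarrow> \<phi> e \<noteq> \<phi> {m, r}))) \<and>
     (\<forall>x y. \<forall>m\<in>D. \<forall>m'\<in>D. S x y \<and> {m, x} \<in> F \<and> {m', y} \<in> F \<longrightarrow> \<phi> {m, x} \<noteq> \<phi> {m', y})"

lemma tree_coloringD:
  assumes "tree_coloring F S h L D \<phi> f"
  shows "\<lbrakk>e \<in> F; e \<inter> D \<noteq> {}\<rbrakk> \<Longrightarrow> \<phi> e \<in> L e"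
    and "\<lbrakk>e \<in> F; e' \<in> F; e \<inter> D \<noteq> {}; e' \<inter> D \<noteq> {}; e \<noteq> e'; e \<inter> e' \<noteq> {}\<rbrakk> \<Longrightarrow> \<phi> e \<noteq> \<phi> e'"
    and "m \<in> D \<Longrightarrow> inj_on (f m) (nbhd F m)" "m \<in> D \<Longrightarrow> f m ` nbhd F m \<subseteq> {..2 * h}"
    and "\<lbrakk>m \<in> D; l \<in> D; {m, l} \<in> F; r \<in> nbhd F m; beats h (f m l) (f m r); e \<in> F; l \<in> e; e \<noteq> {m, l}\<rbrakk>
      \<Longrightarrow> \<phi> e \<noteq> \<phi> {m, r}"
    and "\<lbrakk>m \<in> D; m' \<in> D; S x y; {m, x} \<in> F; {m', y} \<in> F\<rbrakk> \<Longrightarrow> \<phi> {m, x} \<noteq> \<phi> {m', y}"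
proof -
  note c = assms[unfolded tree_coloring_def]
  note c1 = c[THEN conjunct1] and ca = c[THEN conjunct2]
  note c2 = ca[THEN conjunct1] and cb = ca[THEN conjunct2]
  note c3 = cb[THEN conjunct1] and cc = cb[THEN conjunct2]
  note c4 = cc[THEN conjunct1] and c5 = cc[THEN conjunct2]
  show "\<phi> e \<in> L e" if "e \<in> F" "e \<inter> D \<noteq> {}" using bspec[OF c1 that(1)] that(2) by simp
  show "\<phi> e \<noteq> \<phi> e'" if "e \<in> F" "e' \<in> F" "e \<inter> D \<noteq> {}" "e' \<inter> D \<noteq> {}" "e \<noteq> e'" "e \<inter> e' \<noteq> {}"
    using bspec[OF bspec[OF c2 that(1)] that(2)] that(3-) by simp
  show "inj_on (f m) (nbhd F m)" "f m ` nbhd F m \<subseteq> {..2 * h}" if "m \<in> D"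
    using bspec[OF c3 that] by simp_all
  show "\<phi> e \<noteq> \<phi> {m, r}" if "m \<in> D" "l \<in> D" "{m, l} \<in> F" "r \<in> nbhd F m" "beats h (f m l) (f m r)"
    "e \<in> F" "l \<in> e" "e \<noteq> {m, l}"
    using bspec[OF bspec[OF bspec[OF c4 that(1), THEN bspec, OF that(2), THEN mp, OF that(3)] that(4),
        THEN mp, OF that(5)] that(6)] that(7,8) by simp
  show "\<phi> {m, x} \<noteq> \<phi> {m', y}" if "m \<in> D" "m' \<in> D" "S x y" "{m, x} \<in> F" "{m', y} \<in> F"
    using bspec[OF bspec[OF c5[THEN spec, THEN spec, of x y] that(1)] that(2)] that(3-) by simp
qed

lemma tree_coloring_root:
  assumes T: "tree V F" and r: "r \<in> V - leaves V F"
    and deg: "degree F r \<le> \<Delta>" "\<Delta> \<le> 2 * h + 1"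
    and L: "\<And>e. e \<in> F \<Longrightarrow> finite (L e) \<and> \<Delta> \<le> card (L e)"
    and irr: "\<And>x. \<not> S x x"
  shows "\<exists>\<phi> f. tree_coloring F S h L {r} \<phi> f"
proof -
  note G = tree_simple[OF T]
  define W where "W = {e \<in> F. r \<in> e}"
  have W: "finite W" "card W \<le> \<Delta>" using finite_edges[OF G] deg by (auto simp: W_def degree_def)
  \<comment> \<open>With \<open>Z = W\<close> and \<open>k = 0\<close> this is one plain greedy
    pass.\<close>
  have "\<exists>g. inj_on g W \<and> (\<forall>w\<in>W. g w \<in> L w)"
    by (rule sdr_two_stage[OF W(1) order_refl W(2), of 0]) (use L in \<open>auto simp: W_def\<close>)
  then obtain \<phi> where \<phi>: "inj_on \<phi> W" "\<forall>w\<in>W. \<phi> w \<in> L w" by blast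
  have "card (nbhd F r) \<le> card {..2 * h}" using deg by (simp add: degree_eq_card_nbhd[OF G])
  then obtain \<nu> where \<nu>: "\<nu> ` nbhd F r \<subseteq> {..2 * h}" "inj_on \<nu> (nbhd F r)"
    using card_le_inj[OF finite_nbhd[OF G] finite_atMost] by blast
  have "tree_coloring F S h L {r} \<phi> (\<lambda>_. \<nu>)"
    unfolding tree_coloring_def
  proof (intro conjI ballI allI impI)
    fix e assume "e \<in> F" "e \<inter> {r} \<noteq> {}"
    then show "\<phi> e \<in> L e" using \<phi> by (auto simp: W_def)
  next
    fix e e' assume "e \<in> F" "e' \<in> F" "e \<inter> {r} \<noteq> {} \<and> e' \<inter> {r} \<noteq> {} \<and> e \<noteq> e' \<and> e \<inter> e' \<noteq> {}"
    then show "\<phi> e \<noteq> \<phi> e'" using \<phi>(1) by (auto simp: W_def inj_on_def)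
  next
    fix m l assume "m \<in> {r}" "l \<in> {r}" "{m, l} \<in> F"
    then have False using simple_graph_edgeD(1)[OF G, of r r] by auto
    then show "\<phi> e \<noteq> \<phi> {m, r'}" for e r' by simp
  next
    fix x y m m' assume *: "m \<in> {r}" "m' \<in> {r}" "S x y \<and> {m, x} \<in> F \<and> {m', y} \<in> F"
    then have "{r, x} \<noteq> {r, y}" using irr by (auto simp: doubleton_eq_iff)
    then show "\<phi> {m, x} \<noteq> \<phi> {m', y}" using \<phi>(1) * by (auto simp: W_def inj_on_def)
  qed (use \<nu> in auto)
  then show ?thesis by blast
qed

text \<open>Colors come first and labels second. The new edges at \<open>m\<close> are colored to
  respect the tournament at \<open>p\<close>; only then are the labels at \<open>m\<close> chosen,
  so that \<open>p\<close> beats no neighbor whose color recurs at \<open>p\<close>. The threshold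
  in \<open>free\<close> is where the greedy count stops working by itself: up to
  \<open>h + 3\<close> forbidden colors leave \<Delta> - 3, which suffices for degree at most
  \<Delta> - 2.\<close>

lemma tree_coloring_step:
  fixes \<phi> :: "'v set \<Rightarrow> 'c"
  assumes T: "tree V F" and conn: "graph_connected D F" and D: "D \<subseteq> V - leaves V F"
    and m: "m \<in> V - leaves V F" "m \<notin> D" and p: "p \<in> D" "{p, m} \<in> F" and nb: "nbhd F m \<inter> D = {p}"
    and col: "tree_coloring F S h L D \<phi> f"
    and deg: "\<And>v. degree F v \<le> \<Delta>" "\<Delta> \<le> 2 * h + 1"
    and L: "\<And>e. e \<in> F \<Longrightarrow> finite (L e) \<and> \<Delta> + h \<le> card (L e)"
    and S: "\<And>x y. S x y \<Longrightarrow> S y x" "\<And>x. \<not> S x x" "\<And>x. finite {y. S x y} \<and> card {y. S x y} \<le> 2"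
      "\<And>x y. S x y \<Longrightarrow> x \<in> leaves V F"
    and free: "\<Delta> \<le> degree F m + 1 \<Longrightarrow> 3 \<le> card {z \<in> nbhd F m. \<forall>y. S z y \<longrightarrow> y \<in> nbhd F m}"
  shows "\<exists>\<phi>' f'. tree_coloring F S h L (insert m D) \<phi>' f'"
proof -
  note G = tree_simple[OF T]
  note cL = tree_coloringD(1)[OF col] and cP = tree_coloringD(2)[OF col]
    and cI = tree_coloringD(3,4)[OF col] and cB = tree_coloringD(5)[OF col] and cS = tree_coloringD(6)[OF col]
  have conn': "graph_connected (insert m D) F" by (rule graph_connected_insert[OF conn m(2) p])
  have D'V: "insert m D \<subseteq> V" using D m by blast
  define W where "W = nbhd F m - {p}"
  have pm: "p \<in> nbhd F m" "m \<in> nbhd F p" using p by (auto simp: nbhd_iff insert_commute)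
  have fin: "finite (nbhd F v)" for v by (rule finite_nbhd[OF G])
  have cardN: "card (nbhd F m) \<le> \<Delta>" using deg(1)[of m] by (simp add: degree_eq_card_nbhd[OF G])
  have cardW: "card W = card (nbhd F m) - 1" "finite W" using pm fin by (auto simp: W_def)
  have W_D: "w \<notin> D" "w \<noteq> m" "{m, w} \<in> F" if w: "w \<in> W" for w
  proof -
    have "w \<in> nbhd F m" "w \<noteq> p" using w by (simp_all add: W_def)
    then show mw: "{m, w} \<in> F" and "w \<notin> D" using nb by (simp add: nbhd_iff, blast)
    show "w \<noteq> m" using simple_graph_edgeD(1)[OF G mw] by simp
  qed
  \<comment> \<open>Among the edges colored after this step, \<open>{m, w}\<close> is the only one
    at \<open>w\<close>; new conflicts between adjacent edges therefore arise at \<open>m\<close>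
    alone.\<close>
  have W_edge: "e = {m, w}" if w: "w \<in> W" "e \<in> F" "w \<in> e" "e \<inter> insert m D \<noteq> {}" for w e
  proof -
    obtain u where u: "e = {w, u}" "u \<noteq> w" "u \<in> nbhd F w"
      by (rule simple_graph_edgeE[OF G w(2,3)])
    then have uD: "u \<in> insert m D" using w(4) W_D[OF w(1)] by auto
    have "{w, u} \<in> F" "{w, m} \<in> F" using u W_D[OF w(1)] by (simp_all add: nbhd_iff insert_commute)
    then have "u = m"
      using nbr_unique_of_connected[OF T conn' D'V, of w u m] W_D[OF w(1)] uD by simp
    then show ?thesis using u by auto
  qed
  \<comment> \<open>Colors of the tree edges at those cycle neighbors of \<open>w\<close> that hang
    from other vertices; \<open>THE\<close> picks the unique tree neighbor of a leaf. If such an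
    edge is still uncolored, an arbitrary value is avoided as well, which is harmless. Cycle
    neighbors that hang from \<open>m\<close> are handled by injectivity.\<close>
  define Fx where "Fx w = (\<lambda>y. \<phi> {THE m'. {m', y} \<in> F, y}) ` {y. S w y \<and> y \<notin> nbhd F m}" for w
  define B where "B = insert (\<phi> {m, p})
     ((\<lambda>r. \<phi> {p, r}) ` {r \<in> nbhd F p. beats h (f p m) (f p r)})"
  have cardB: "finite B" "card B \<le> h + 1"
  proof -
    have "card {r \<in> nbhd F p. beats h (f p m) (f p r)} \<le> h"
    proof (rule card_labels_le[OF cI[OF p(1)] fin])
      show "card {b. b \<le> 2 * h \<and> beats h (f p m) b} \<le> h"
        using card_beats_out cI[OF p(1)] pm by blast
    qed
    then show "finite B" "card B \<le> h + 1"
      unfolding B_def using fin[of p] card_image_le[of "{r \<in> nbhd F p. beats h (f p m) (f p r)}"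
        "\<lambda>r. \<phi> {p, r}"]
      by (auto simp: card_insert_if)
  qed
  have cardFx: "finite (Fx w)" "card (Fx w) \<le> 2" for w
  proof -
    have "finite {y. S w y \<and> y \<notin> nbhd F m}" "card {y. S w y \<and> y \<notin> nbhd F m} \<le> card {y. S w y}"
      using S(3)[of w] by (auto intro: finite_subset card_mono)
    then show "finite (Fx w)" "card (Fx w) \<le> 2"
      unfolding Fx_def using S(3)[of w] card_image_le[of "{y. S w y \<and> y \<notin> nbhd F m}"]
      by (auto intro: le_trans)
  qed
  define Z where "Z = {z \<in> W. \<forall>y. S z y \<longrightarrow> y \<in> nbhd F m}"
  have cardWZ: "card (W - Z) \<le> \<Delta> - 3"
  proof (cases "\<Delta> \<le> degree F m + 1")
    case True
    \<comment> \<open>One of the three free neighbors may be \<open>p\<close>, so two of them are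
      known to lie in \<open>W\<close>, which has at most \<Delta> - 1 elements.\<close>
    have "card {z \<in> nbhd F m. \<forall>y. S z y \<longrightarrow> y \<in> nbhd F m} \<le> card (insert p Z)"
      using fin[of m] by (intro card_mono) (auto simp: Z_def W_def)
    then have "2 \<le> card Z" using free[OF True] cardW fin[of m]
      by (auto simp: card_insert_if Z_def split: if_splits)
    then show ?thesis using cardW cardN card_Diff_subset[of Z W] by (auto simp: Z_def)
  next
    case False
    then have "card W \<le> \<Delta> - 3" using cardW by (simp add: degree_eq_card_nbhd[OF G])
    then show ?thesis using card_mono[of W "W - Z"] cardW by (meson Diff_subset le_trans)
  qed
  have "\<exists>g. inj_on g W \<and> (\<forall>w\<in>W. g w \<in> L {m, w} - (B \<union> Fx w))"
  proof (rule sdr_two_stage[OF cardW(2) _ _ cardWZ])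
    show "Z \<subseteq> W" by (auto simp: Z_def)
    show "card W \<le> \<Delta> - 1" using cardW cardN by simp
  next
    fix w assume w: "w \<in> W"
    have "card (B \<union> Fx w) \<le> h + 3" using card_Un_le[of B "Fx w"] cardB cardFx[of w] by linarith
    then have "\<Delta> + h - (h + 3) \<le> card (L {m, w} - (B \<union> Fx w))"
      using L[of "{m, w}"] W_D[OF w] diff_card_le_card_Diff[of "B \<union> Fx w" "L {m, w}"] cardB cardFx[of w]
      by fastforce
    then show "finite (L {m, w} - (B \<union> Fx w)) \<and> \<Delta> - 3 \<le> card (L {m, w} - (B \<union> Fx w))"
      using L[of "{m, w}"] W_D[OF w] by simp
  next
    fix w assume w: "w \<in> Z"
    then have "w \<in> W" "Fx w = {}" by (auto simp: Z_def Fx_def)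
    then show "\<Delta> - 1 \<le> card (L {m, w} - (B \<union> Fx w))"
      using L[of "{m, w}"] W_D diff_card_le_card_Diff[of "B" "L {m, w}"] cardB by fastforce
  qed
  then obtain g where g: "inj_on g W" "\<And>w. w \<in> W \<Longrightarrow> g w \<in> L {m, w} - (B \<union> Fx w)" by blast
  \<comment> \<open>Neighbors whose new color recurs at \<open>p\<close>. Since \<open>B\<close> was
    avoided, the recurring color belongs to some \<open>s\<close> that \<open>m\<close> does not
    beat at \<open>p\<close>, hence to one that beats \<open>m\<close>; there are at most
    \<open>h\<close> of these.\<close>
  define A where "A = {r \<in> W. \<exists>s\<in>nbhd F p - {m}. g r = \<phi> {p, s}}"
  have cardA: "card A \<le> h"
  proof -
    define Q where "Q = {s \<in> nbhd F p. beats h (f p s) (f p m)}"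
    have "card Q \<le> h" unfolding Q_def
    proof (rule card_labels_le[OF cI[OF p(1)] fin])
      show "card {b. b \<le> 2 * h \<and> beats h b (f p m)} \<le> h"
        using card_beats_in cI[OF p(1)] pm by blast
    qed
    moreover have "g ` A \<subseteq> (\<lambda>s. \<phi> {p, s}) ` Q"
    proof
      fix c assume "c \<in> g ` A"
      then obtain r s where rs: "r \<in> W" "s \<in> nbhd F p" "s \<noteq> m" "c = g r" "g r = \<phi> {p, s}"
        by (auto simp: A_def)
      have "\<not> beats h (f p m) (f p s)" using g(2)[OF rs(1)] rs by (auto simp: B_def)
      moreover have "f p m \<noteq> f p s" using cI[OF p(1)] pm rs by (auto simp: inj_on_def)
      ultimately have "beats h (f p s) (f p m)" using beats_total by blast
      then show "c \<in> (\<lambda>s. \<phi> {p, s}) ` Q" using rs by (auto simp: Q_def)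
    qed
    moreover have "finite Q" using fin[of p] by (simp add: Q_def)
    ultimately have "card (g ` A) \<le> h"
      using card_mono[of "(\<lambda>s. \<phi> {p, s}) ` Q" "g ` A"] card_image_le[of Q "\<lambda>s. \<phi> {p, s}"] by simp
    moreover have "card (g ` A) = card A" using g(1) by (intro card_image) (auto simp: A_def inj_on_def)
    ultimately show ?thesis by simp
  qed
  obtain \<nu> where \<nu>: "inj_on \<nu> (nbhd F m)" "\<nu> ` nbhd F m \<subseteq> {..2 * h}" "\<nu> p = 0" "\<nu> ` A \<subseteq> {1..h}"
  proof -
    have "card (nbhd F m) \<le> 2 * h + 1" "A \<subseteq> nbhd F m - {p}" using cardN deg(2)
      by (auto simp: A_def W_def)
    from labelling_exists[OF fin this(1) pm(1) this(2) cardA] show thesis using that by blast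
  qed
  define \<phi>' where "\<phi>' e = (if e \<inter> D = {} then g (THE w. w \<in> W \<and> e = {m, w}) else \<phi> e)" for e
  define f' where "f' = f(m := \<nu>)"
  have new: "\<phi>' {m, w} = g w" if "w \<in> W" for w
  proof -
    have "{m, w} \<inter> D = {}" using m W_D that by auto
    moreover have "(THE w'. w' \<in> W \<and> {m, w} = {m, w'}) = w"
      using that by (intro the_equality) (auto simp: doubleton_eq_iff)
    ultimately show ?thesis by (simp add: \<phi>'_def)
  qed
  have old: "\<phi>' e = \<phi> e" if "e \<inter> D \<noteq> {}" for e using that by (simp add: \<phi>'_def)
  have new_edge: "\<exists>w\<in>W. e = {m, w}" if e: "e \<in> F" "e \<inter> insert m D \<noteq> {}" "e \<inter> D = {}" for e
  proof -
    have "m \<in> e" using e by auto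
    then obtain w where w: "e = {m, w}" "w \<in> nbhd F m" using simple_graph_edgeE[OF G e(1)] by blast
    then have "w \<in> W" using e p by (auto simp: W_def)
    then show ?thesis using w by blast
  qed
  have p_edge: "e = {m, p}" if "e \<in> F" "m \<in> e" "e \<inter> D \<noteq> {}" for e
    using simple_graph_edgeE[OF G that(1,2)] nb that m
      by (metis Int_iff disjoint_iff insertE singletonD)
  have pW: "\<phi> {m, p} \<noteq> g w" if "w \<in> W" for w using g(2)[OF that] by (auto simp: B_def)
  have leaf_nbr: "(THE m'. {m', y} \<in> F) = m'" if "S x y" "{m', y} \<in> F" for x y m'
  proof (rule the_equality)
    show "{m', y} \<in> F" by fact
    have "degree F y = 1" using S(1,4) that by (auto simp: leaves_def)
    then have "card (nbhd F y) = 1" by (simp add: degree_eq_card_nbhd[OF G])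
    then obtain z where "nbhd F y = {z}" by (auto simp: card_1_singleton_iff)
    moreover have "m' \<in> nbhd F y" using \<open>{m', y} \<in> F\<close> by (simp add: nbhd_iff insert_commute)
    moreover have "k \<in> nbhd F y" if "{k, y} \<in> F" for k using that by (simp add: nbhd_iff insert_commute)
    ultimately show "k = m'" if "{k, y} \<in> F" for k using that by simp
  qed
  have "tree_coloring F S h L (insert m D) \<phi>' f'"
    unfolding tree_coloring_def
  proof (intro conjI ballI allI impI)
    fix e assume e: "e \<in> F" "e \<inter> insert m D \<noteq> {}"
    show "\<phi>' e \<in> L e"
    proof (cases "e \<inter> D = {}")
      case True
      then obtain w where "w \<in> W" "e = {m, w}" using new_edge[OF e] by blast
      then show ?thesis using new g(2) by auto
    next
      case False then show ?thesis using old cL e by simp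
    qed
  next
    fix e e' assume "e \<in> F" "e' \<in> F" and
      "e \<inter> insert m D \<noteq> {} \<and> e' \<inter> insert m D \<noteq> {} \<and> e \<noteq> e' \<and> e \<inter> e' \<noteq> {}"
    then have e: "e \<in> F" "e' \<in> F" "e \<inter> insert m D \<noteq> {}" "e' \<inter> insert m D \<noteq> {}" "e \<noteq> e'"
      "e \<inter> e' \<noteq> {}" by auto
    have mixed: "\<phi>' e \<noteq> \<phi>' e'"
      if h: "e \<in> F" "e' \<in> F" "e \<inter> insert m D \<noteq> {}" "e' \<inter> insert m D \<noteq> {}" "e \<noteq> e'" "e \<inter> e' \<noteq> {}"
      "e \<inter> D = {}" "e' \<inter> D \<noteq> {}" for e e'
    proof -
      obtain w where w: "w \<in> W" "e = {m, w}" using new_edge[OF h(1,3,7)] by blast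
      have "w \<notin> e'" using W_edge[OF w(1) h(2) _ h(4)] w h by blast
      then have "e' = {m, p}" using p_edge[OF h(2) _ h(8)] w h by blast
      then show ?thesis using old[OF h(8)] new[OF w(1)] pW[OF w(1)] w by simp
    qed
    consider "e \<inter> D = {}" "e' \<inter> D = {}" | "e \<inter> D = {}" "e' \<inter> D \<noteq> {}" | "e \<inter> D \<noteq> {}" "e' \<inter> D = {}"
      | "e \<inter> D \<noteq> {}" "e' \<inter> D \<noteq> {}" by blast
    then show "\<phi>' e \<noteq> \<phi>' e'"
    proof cases
      case 1
      obtain w w' where "w \<in> W" "e = {m, w}" "w' \<in> W" "e' = {m, w'}"
        using new_edge[OF e(1,3) 1(1)] new_edge[OF e(2,4) 1(2)] by blast
      then show ?thesis using new e g(1) by (auto simp: inj_on_def)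
    next
      case 2 then show ?thesis using mixed e by blast
    next
      case 3 then show ?thesis using mixed[of e' e] e by (metis Int_commute)
    next
      case 4 then show ?thesis using old cP e by simp
    qed
  next
    fix k assume "k \<in> insert m D"
    then show "inj_on (f' k) (nbhd F k)" "f' k ` nbhd F k \<subseteq> {..2 * h}"
      using cI[of k] \<nu> by (auto simp: f'_def)
  next
    fix k l r e assume k: "k \<in> insert m D" "l \<in> insert m D" "{k, l} \<in> F" "r \<in> nbhd F k"
      "beats h (f' k l) (f' k r)" "e \<in> F" and "l \<in> e \<and> e \<noteq> {k, l}"
    then have e: "l \<in> e" "e \<noteq> {k, l}" by auto
    have kl: "k \<noteq> l" using simple_graph_edgeD(1)[OF G k(3)] .
    consider "k \<in> D" "l \<in> D" | "k = m" "l \<in> D" | "k \<in> D" "l = m" using k kl by blast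
    then show "\<phi>' e \<noteq> \<phi>' {k, r}"
    proof cases
      case 1
      have "k \<noteq> m" using 1 m by blast
      then have b: "beats h (f k l) (f k r)" using k(5) by (simp add: f'_def)
      have "e \<inter> D \<noteq> {}" "{k, r} \<inter> D \<noteq> {}" using e 1 by blast+
      then show ?thesis using old cB[OF 1 k(3,4) b k(6) e] by simp
    next
      case 2
      then have "l \<in> nbhd F m \<inter> D" using k(3) by (simp add: nbhd_iff)
      then have l: "l = p" using nb by simp
      have b: "beats h 0 (\<nu> r)" using k(5) 2 l \<nu>(3) by (simp add: f'_def)
      then have "r \<noteq> p" using \<nu>(3) by (auto simp: beats_def)
      then have rW: "r \<in> W" using k(4) 2 by (simp add: W_def)
      \<comment> \<open>At \<open>m\<close> the vertex \<open>p\<close> has label 0, which beats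
        only labels above \<open>h\<close>, whereas \<open>A\<close> received labels from
        \<open>1..h\<close>.\<close>
      have "r \<notin> A"
      proof
        assume "r \<in> A"
        then have "\<nu> r \<in> {1..h}" using \<nu>(4) by blast
        then show False using b by (simp add: beats_def)
      qed
      obtain s where s: "e = {p, s}" "s \<in> nbhd F p"
        using simple_graph_edgeE[OF G k(6), of p] e(1) l by blast
      then have "s \<noteq> m" using e(2) 2 l by (auto simp: insert_commute)
      then have "g r \<noteq> \<phi> {p, s}" using \<open>r \<notin> A\<close> rW s by (auto simp: A_def)
      moreover have "\<phi>' e = \<phi> {p, s}" using old[of e] s p by simp
      ultimately show ?thesis using new[OF rW] 2 by simp
    next
      case 3
      then have "k \<in> nbhd F m \<inter> D" using k(3) by (simp add: nbhd_iff insert_commute)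
      then have kp: "k = p" using nb by simp
      have "p \<noteq> m" using m p by blast
      then have b: "beats h (f p m) (f p r)" using k(5) 3 kp by (simp add: f'_def)
      have me: "m \<in> e" using e 3 by simp
      have eD: "e \<inter> D = {}"
      proof (rule ccontr)
        assume "e \<inter> D \<noteq> {}"
        from p_edge[OF k(6) me this] show False using e 3 kp by (simp add: insert_commute)
      qed
      have "e \<inter> insert m D \<noteq> {}" using me by blast
      from new_edge[OF k(6) this eD] obtain w where w: "w \<in> W" "e = {m, w}" by blast
      have "\<phi> {p, r} \<in> B" using b k(4) kp by (simp add: B_def)
      then have "g w \<noteq> \<phi> {p, r}" using g(2)[OF w(1)] by auto
      moreover have "\<phi>' {k, r} = \<phi> {p, r}" using old[of "{k, r}"] kp p by simp
      ultimately show ?thesis using new[OF w(1)] w by simp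
    qed
  next
    fix x y k k' assume k: "k \<in> insert m D" "k' \<in> insert m D" and "S x y \<and> {k, x} \<in> F \<and> {k', y} \<in> F"
    then have xy: "S x y" "{k, x} \<in> F" "{k', y} \<in> F" by simp_all
    have xp: "x \<noteq> p" if "S x y" for x y using S(4)[OF that] D p(1) by blast
    have mixed: "\<phi>' {m, x} \<noteq> \<phi>' {k, y}" if h: "k \<in> D" "S x y" "{m, x} \<in> F" "{k, y} \<in> F" for k x y
    proof -
      have xW: "x \<in> W" using h(3) xp[OF h(2)] by (simp add: W_def nbhd_iff)
      have "y \<notin> nbhd F m"
      proof
        assume "y \<in> nbhd F m"
        then have "{m, y} \<in> F" by (simp add: nbhd_iff)
        then have "m = k" using leaf_nbr[OF h(2), of m] leaf_nbr[OF h(2) h(4)] by simp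
        then show False using h(1) m(2) by simp
      qed
      then have "y \<in> {y. S x y \<and> y \<notin> nbhd F m}" using h(2) by simp
      from imageI[OF this] have "\<phi> {THE m'. {m', y} \<in> F, y} \<in> Fx x" unfolding Fx_def .
      then have "\<phi> {k, y} \<in> Fx x" unfolding leaf_nbr[OF h(2,4)] .
      moreover have "\<phi>' {k, y} = \<phi> {k, y}" using old[of "{k, y}"] h(1) by simp
      ultimately show ?thesis using new[OF xW] g(2)[OF xW] by auto
    qed
    consider "k \<in> D" "k' \<in> D" | "k = m" "k' \<in> D" | "k \<in> D" "k' = m" | "k = m" "k' = m" using k by blast
    then show "\<phi>' {k, x} \<noteq> \<phi>' {k', y}"
    proof cases
      case 1 then show ?thesis using old[of "{k, x}"] old[of "{k', y}"] cS[OF 1 xy] by simp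
    next
      case 2
      then have "{m, x} \<in> F" using xy by simp
      from mixed[OF 2(2) xy(1) this xy(3)] show ?thesis using 2 by simp
    next
      case 3
      then have "{m, y} \<in> F" using xy by simp
      from mixed[OF 3(1) S(1)[OF xy(1)] this xy(2)] show ?thesis using 3 by metis
    next
      case 4
      have "x \<noteq> y" using xy(1) S(2) by blast
      moreover have "x \<in> W" "y \<in> W"
        using 4 xy xp[OF xy(1)] xp[OF S(1)[OF xy(1)]] by (simp_all add: W_def nbhd_iff)
      ultimately show ?thesis using new 4 g(1) by (simp add: inj_on_eq_iff)
    qed
  qed
  then show ?thesis by blast
qed

lemma tree_coloring_exists:
  fixes L :: "'v set \<Rightarrow> 'c set"
  assumes T: "tree V F" and r: "r \<in> V - leaves V F"
    and deg: "\<And>v. degree F v \<le> \<Delta>" "\<Delta> \<le> 2 * h + 1"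
    and L: "\<And>e. e \<in> F \<Longrightarrow> finite (L e) \<and> \<Delta> + h \<le> card (L e)"
    and S: "\<And>x y. S x y \<Longrightarrow> S y x" "\<And>x. \<not> S x x" "\<And>x. finite {y. S x y} \<and> card {y. S x y} \<le> 2"
      "\<And>x y. S x y \<Longrightarrow> x \<in> leaves V F"
    and free: "\<And>m. m \<in> V - leaves V F \<Longrightarrow> \<Delta> \<le> degree F m + 1 \<Longrightarrow>
      3 \<le> card {z \<in> nbhd F m. \<forall>y. S z y \<longrightarrow> y \<in> nbhd F m}"
  shows "\<exists>\<phi> f. tree_coloring F S h L (V - leaves V F) \<phi> f"
  using T r
proof (induction rule: tree_grow_induct)
  case root
  have "finite (L e) \<and> \<Delta> \<le> card (L e)" if "e \<in> F" for e using L[OF that] by auto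
  then show ?case by (intro tree_coloring_root[OF T r deg]) (use S in auto)
next
  case (step D m p)
  obtain \<phi> f where "tree_coloring F S h L D \<phi> f" using step.IH by blast
  then show ?case
    by (rule tree_coloring_step[OF T \<open>graph_connected D F\<close> \<open>D \<subseteq> V - leaves V F\<close>
          \<open>m \<in> V - leaves V F\<close> \<open>m \<notin> D\<close> \<open>p \<in> D\<close> \<open>{p, m} \<in> F\<close> \<open>nbhd F m \<inter> D = {p}\<close> _ deg L S
          free[OF \<open>m \<in> V - leaves V F\<close>]])
qed

section \<open>The outer cycle of a plane graph\<close>

lemma walk_edges_append:
  "p \<noteq> [] \<Longrightarrow> q \<noteq> [] \<Longrightarrow> walk_edges (p @ q) = walk_edges p @ {last p, hd q} # walk_edges q"
  by (induction p rule: walk_edges.induct) (auto simp: walk_edges_Cons)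

lemma walk_edges_join: "walk_edges (p @ v # q) = walk_edges (p @ [v]) @ walk_edges (v # q)"
  by (cases "p = []"; cases "q = []") (simp_all add: walk_edges_append walk_edges_Cons)

lemma set_cycle_edges_rotate: "set (cycle_edges (p @ q)) = set (cycle_edges (q @ p))"
proof (cases "p = [] \<or> q = []")
  case False
  then have "cycle_edges (p @ q) = walk_edges p @ {last p, hd q} # walk_edges q @ [{last q, hd p}]"
    "cycle_edges (q @ p) = walk_edges q @ {last q, hd p} # walk_edges p @ [{last p, hd q}]"
    by (simp_all add: cycle_edges_def walk_edges_append)
  then show ?thesis by auto
qed auto

lemma cycle_edges_split:
  "cycle_edges (x # A @ x' # B) = walk_edges (x # A @ [x']) @ walk_edges (x' # B @ [x])"
  using walk_edges_join[of "x # A" x' "B @ [x]"] by (simp add: cycle_edges_def)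

lemma walk_edge_subset: "e \<in> set (walk_edges p) \<Longrightarrow> e \<subseteq> set p"
  by (auto simp: set_walk_edges)

lemma walk_edge_meets_inner:
  assumes "e \<in> set (walk_edges (x # A @ [x']))" "A \<noteq> []"
  shows "e \<inter> set A \<noteq> {}"
proof -
  have "walk_edges (x # A @ [x']) = {x, hd A} # walk_edges A @ [{last A, x'}]"
    using assms(2) by (simp add: walk_edges_Cons walk_edges_snoc)
  then consider "e = {x, hd A}" | "e \<in> set (walk_edges A)" | "e = {last A, x'}" using assms(1) by auto
  then show ?thesis
  proof cases
    case 2
    then obtain i where "Suc i < length A" "e = {A ! i, A ! Suc i}" by (auto simp: set_walk_edges)
    then show ?thesis by auto
  qed (use assms(2) in auto)
qed

section \<open>Plane paths as arcs\<close>

lemma plane_vertex_on_edge: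
  assumes pe: "plane_embedding V E pos \<gamma>" and e: "e \<in> E" "e \<subseteq> V" and u: "u \<in> V"
    "pos u \<in> path_image (\<gamma> e)"
  shows "u \<in> e"
proof -
  have "pos u \<in> pos ` e"
  proof (rule ccontr)
    assume "pos u \<notin> pos ` e"
    then have "pos u \<in> (path_image (\<gamma> e) - pos ` e) \<inter> pos ` V" using u by blast
    then show False using pe e(1) unfolding plane_embedding_def by blast
  qed
  then show ?thesis using pe e(2) u(1) by (auto simp: plane_embedding_def inj_on_def)
qed

lemma plane_edges_meet:
  assumes pe: "plane_embedding V E pos \<gamma>" and e: "e \<in> E" "e \<subseteq> V" and f: "f \<in> E" "f \<subseteq> V" "e \<noteq> f"
  shows "path_image (\<gamma> e) \<inter> path_image (\<gamma> f) \<subseteq> pos ` (e \<inter> f)"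
proof
  fix z assume z: "z \<in> path_image (\<gamma> e) \<inter> path_image (\<gamma> f)"
  have "(path_image (\<gamma> e) - pos ` e) \<inter> path_image (\<gamma> f) = {}"
    using pe e(1) f(1,3) unfolding plane_embedding_def by blast
  then obtain u where u: "u \<in> e" "z = pos u" using z by blast
  then have "u \<in> f" using plane_vertex_on_edge[OF pe f(1,2), of u] z e by blast
  then show "z \<in> pos ` (e \<inter> f)" using u by blast
qed

lemma plane_walks_meet:
  assumes pe: "plane_embedding V E pos \<gamma>" and V: "\<And>e. e \<in> E \<Longrightarrow> e \<subseteq> V"
    and P: "set (walk_edges p) \<subseteq> E" and Q: "set (walk_edges q) \<subseteq> E"
    and disj: "set (walk_edges p) \<inter> set (walk_edges q) = {}"
  shows "(\<Union>e\<in>set (walk_edges p). path_image (\<gamma> e)) \<inter> (\<Union>e\<in>set (walk_edges q). path_image (\<gamma> e))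
    \<subseteq> pos ` (set p \<inter> set q)"
proof
  fix z assume "z \<in> (\<Union>e\<in>set (walk_edges p). path_image (\<gamma> e)) \<inter> (\<Union>e\<in>set (walk_edges q). path_image (\<gamma> e))"
  then obtain e f where ef: "e \<in> set (walk_edges p)" "f \<in> set (walk_edges q)"
    "z \<in> path_image (\<gamma> e) \<inter> path_image (\<gamma> f)" by blast
  have "e \<in> E" "f \<in> E" "e \<noteq> f" using ef P Q disj by blast+
  then have "z \<in> pos ` (e \<inter> f)" using plane_edges_meet[OF pe _ V _ V] ef(3) by blast
  then show "z \<in> pos ` (set p \<inter> set q)" using walk_edge_subset ef(1,2) by blast
qed

lemma plane_edge_arc:
  assumes pe: "plane_embedding V E pos \<gamma>" and e: "{u, v} \<in> E" "u \<in> V" "v \<in> V" "u \<noteq> v"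
  obtains g where "arc g" "pathstart g = pos u" "pathfinish g = pos v"
    "path_image g = path_image (\<gamma> {u, v})"
proof -
  have a: "arc (\<gamma> {u, v})" "{pathstart (\<gamma> {u, v}), pathfinish (\<gamma> {u, v})} = {pos u, pos v}"
    using pe e(1) unfolding plane_embedding_def by (metis, metis image_empty image_insert)
  consider "pathstart (\<gamma> {u, v}) = pos u" "pathfinish (\<gamma> {u, v}) = pos v"
    | "pathstart (\<gamma> {u, v}) = pos v" "pathfinish (\<gamma> {u, v}) = pos u"
    using a(2) by (auto simp: doubleton_eq_iff)
  then show thesis
  proof cases
    case 1 then show thesis using that a by blast
  next
    case 2
    show thesis by (rule that[of "reversepath (\<gamma> {u, v})"]) (use a 2 in \<open>simp_all add: arc_reversepath\<close>)
  qed
qed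

lemma plane_path_arc:
  assumes pe: "plane_embedding V E pos \<gamma>" and V: "\<And>e. e \<in> E \<Longrightarrow> e \<subseteq> V"
    and p: "distinct p" "set (walk_edges p) \<subseteq> E" "set p \<subseteq> V" "2 \<le> length p"
  shows "\<exists>g. arc g \<and> pathstart g = pos (hd p) \<and> pathfinish g = pos (last p) \<and>
    path_image g = (\<Union>e\<in>set (walk_edges p). path_image (\<gamma> e))"
  using p
proof (induction p)
  case (Cons u p)
  then obtain v q where p: "p = v # q" by (cases p) auto
  have uv: "{u, v} \<in> E" "u \<in> V" "v \<in> V" "u \<noteq> v" using Cons.prems p by auto
  obtain g1 where g1: "arc g1" "pathstart g1 = pos u" "pathfinish g1 = pos v"
    "path_image g1 = path_image (\<gamma> {u, v})" by (rule plane_edge_arc[OF pe uv])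
  show ?case
  proof (cases "q = []")
    case True
    then show ?thesis using g1 p by (intro exI[of _ g1]) simp
  next
    case False
    then have "2 \<le> length p" using p by (cases q) auto
    then obtain g2 where g2: "arc g2" "pathstart g2 = pos v" "pathfinish g2 = pos (last p)"
      "path_image g2 = (\<Union>e\<in>set (walk_edges p). path_image (\<gamma> e))"
      using Cons.IH Cons.prems p by (auto simp: walk_edges_Cons)
    have "path_image g1 \<inter> path_image g2 \<subseteq> pos ` (set [u, v] \<inter> set p)"
    proof -
      have "{u, v} \<notin> set (walk_edges p)" using walk_edge_subset[of "{u, v}" p] Cons.prems(1) by auto
      then show ?thesis
        using plane_walks_meet[OF pe V, of "[u, v]" p] g1(4) g2(4) Cons.prems uv p
        by (simp add: walk_edges_Cons)
    qed
    also have "\<dots> \<subseteq> {pathstart g2}" using Cons.prems(1) p g2 by auto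
    finally have "arc (g1 +++ g2)" using arc_join[OF g1(1) g2(1)] g1 g2 by simp
    moreover have "path_image (g1 +++ g2) = path_image g1 \<union> path_image g2"
      using path_image_join g1 g2 by metis
    ultimately show ?thesis using g1 g2 p False by (intro exI[of _ "g1 +++ g2"]) simp
  qed
qed simp

text \<open>The set \<open>outside C\<close> is connected and misses \<open>C\<close>, the frontier
  of \<open>outside D\<close>; so it cannot leave \<open>outside D\<close>, and the two coincide.
  Consequently everything drawn off the outer cycle lies inside it.\<close>

lemma inside_of_exterior_frontier:
  fixes D C :: "complex set"
  assumes D: "compact D" and C: "C \<subseteq> D" and fr: "frontier (outside D) = C"
  shows "D - C \<subseteq> inside C"
proof -
  have bC: "bounded C" using D C bounded_subset compact_imp_bounded by blast
  have sub: "outside D \<subseteq> outside C" by (rule outside_mono[OF C])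
  have "outside D \<noteq> {}" using outside_bounded_nonempty D compact_imp_bounded by blast
  have "outside C \<subseteq> outside D"
  proof (rule ccontr)
    assume "\<not> outside C \<subseteq> outside D"
    then have "outside C - outside D \<noteq> {}" "outside C \<inter> outside D \<noteq> {}"
      using sub \<open>outside D \<noteq> {}\<close> by auto
    moreover have "connected (outside C)" using connected_outside[OF bC] by simp
    ultimately have "outside C \<inter> frontier (outside D) \<noteq> {}" using connected_Int_frontier by blast
    then show False using fr outside_no_overlap by blast
  qed
  then have "D \<inter> outside C = {}" using outside_no_overlap[of D] by blast
  then show ?thesis using inside_Un_outside[of C] by blast
qed

lemma compact_drawing:
  assumes "plane_embedding V E pos \<gamma>" "finite V" "finite E"
  shows "compact (drawing V E pos \<gamma>)"
  unfolding drawing_def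
proof (intro compact_Un compact_UN)
  show "compact (pos ` V)" using assms(2) by (simp add: finite_imp_compact)
  show "compact (path_image (\<gamma> e))" if "e \<in> E" for e
    using assms(1) that by (auto simp: plane_embedding_def intro: compact_path_image arc_imp_path)
qed (use assms in auto)

text \<open>Paths joining alternating vertices of the outer cycle would have to cross: \<open>x # P @ [x']\<close>
  cuts the inside of the cycle in two, with \<open>y\<close> and \<open>y'\<close> on different sides.\<close>

lemma outer_cycle_no_crossing:
  assumes G: "simple_graph V E" and pe: "plane_embedding V E pos \<gamma>"
    and fr: "frontier (exterior_face V E pos \<gamma>) = (\<Union>e\<in>set (cycle_edges c). path_image (\<gamma> e))"
    and c: "graph_cycle V E c" "c = x # A @ x' # B" and y: "y \<in> set A" "y' \<in> set B"
    and P: "graph_path V E (x # P @ [x'])" "P \<noteq> []" "set P \<inter> set c = {}"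
    and Q: "graph_path V E (y # Q @ [y'])" "Q \<noteq> []" "set Q \<inter> set c = {}"
    and PQ: "set P \<inter> set Q = {}"
  shows False
proof -
  have V: "e \<subseteq> V" if "e \<in> E" for e using G that by (simp add: simple_graph_def)
  let ?im = "\<lambda>p. \<Union>e\<in>set (walk_edges p). path_image (\<gamma> e)"
  let ?p1 = "x # A @ [x']" and ?p2 = "x' # B @ [x]" and ?p = "x # P @ [x']" and ?q = "y # Q @ [y']"
  have dc: "distinct c" "set c \<subseteq> V" "set (cycle_edges c) \<subseteq> E" using c(1) by (auto simp: graph_cycle_def)
  have ce: "set (cycle_edges c) = set (walk_edges ?p1) \<union> set (walk_edges ?p2)"
    unfolding c(2) cycle_edges_split by simp
  have ne: "A \<noteq> []" "B \<noteq> []" using y by auto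
  have E1: "set (walk_edges ?p1) \<subseteq> E" and E2: "set (walk_edges ?p2) \<subseteq> E" using ce dc by auto
  have E3: "set (walk_edges ?p) \<subseteq> E" and E4: "set (walk_edges ?q) \<subseteq> E"
    using P Q by (auto simp: graph_path_def)
  obtain g1 where g1: "arc g1" "pathstart g1 = pos x" "pathfinish g1 = pos x'" "path_image g1 = ?im ?p1"
    using plane_path_arc[OF pe V, of ?p1] E1 dc c(2) by auto
  obtain g2 where g2: "arc g2" "pathstart g2 = pos x'" "pathfinish g2 = pos x" "path_image g2 = ?im ?p2"
    using plane_path_arc[OF pe V, of ?p2] E2 dc c(2) by auto
  obtain g where g: "arc g" "pathstart g = pos x" "pathfinish g = pos x'" "path_image g = ?im ?p"
    using plane_path_arc[OF pe V, of ?p] P by (auto simp: graph_path_def)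
  obtain k where k: "arc k" "pathstart k = pos y" "pathfinish k = pos y'" "path_image k = ?im ?q"
    using plane_path_arc[OF pe V, of ?q] Q by (auto simp: graph_path_def)
  have inj: "inj_on pos V" using pe by (simp add: plane_embedding_def)
  have xV: "x \<in> V" "x' \<in> V" "y \<in> V" "y' \<in> V" using dc c(2) y by auto
  have xx': "pos x \<noteq> pos x'" using inj xV dc c(2) by (auto simp: inj_on_def)
  have disj: "set (walk_edges (u # R @ [u'])) \<inter> set (walk_edges p) = {}"
    if "set R \<inter> set p = {}" "R \<noteq> []" for u u' :: 'a and R p
    using walk_edge_meets_inner[of _ u R u'] walk_edge_subset[of _ p] that by blast
  have m12: "path_image g1 \<inter> path_image g2 \<subseteq> {pos x, pos x'}"
  proof -
    have "path_image g1 \<inter> path_image g2 \<subseteq> pos ` (set ?p1 \<inter> set ?p2)"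
      unfolding g1 g2 by (rule plane_walks_meet[OF pe V E1 E2 disj]) (use dc c(2) ne in auto)
    also have "\<dots> \<subseteq> {pos x, pos x'}" using dc c(2) by auto
    finally show ?thesis .
  qed
  have m1: "path_image g1 \<inter> path_image g \<subseteq> {pos x, pos x'}"
  proof -
    have "path_image g \<inter> path_image g1 \<subseteq> pos ` (set ?p \<inter> set ?p1)"
      unfolding g1 g by (rule plane_walks_meet[OF pe V E3 E1 disj]) (use P c(2) in auto)
    also have "\<dots> \<subseteq> {pos x, pos x'}" using P(3) c(2) by auto
    finally show ?thesis by blast
  qed
  have m2: "path_image g2 \<inter> path_image g \<subseteq> {pos x, pos x'}"
  proof -
    have "path_image g \<inter> path_image g2 \<subseteq> pos ` (set ?p \<inter> set ?p2)"
      unfolding g2 g by (rule plane_walks_meet[OF pe V E3 E2 disj]) (use P c(2) in auto)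
    also have "\<dots> \<subseteq> {pos x, pos x'}" using P(3) c(2) by auto
    finally show ?thesis by blast
  qed
  have mk: "path_image k \<inter> path_image g = {}"
  proof -
    have yx: "y \<notin> {x, x'}" "y' \<notin> {x, x'}" using y dc c(2) by auto
    have "path_image g \<inter> path_image k \<subseteq> pos ` (set ?p \<inter> set ?q)"
      unfolding g k by (rule plane_walks_meet[OF pe V E3 E4 disj]) (use P PQ y c(2) in auto)
    moreover have "set ?p \<inter> set ?q = {}" using PQ P(3) Q(3) y c(2) yx by auto
    ultimately show ?thesis by blast
  qed
  have mk1: "path_image k \<inter> path_image g1 \<subseteq> {pos y}"
  proof -
    have "path_image k \<inter> path_image g1 \<subseteq> pos ` (set ?q \<inter> set ?p1)"
      unfolding g1 k by (rule plane_walks_meet[OF pe V E4 E1 disj]) (use Q c(2) in auto)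
    also have "\<dots> \<subseteq> {pos y}" using Q(3) c(2) dc y by auto
    finally show ?thesis .
  qed
  have mk2: "path_image k \<inter> path_image g2 \<subseteq> {pos y'}"
  proof -
    have "path_image k \<inter> path_image g2 \<subseteq> pos ` (set ?q \<inter> set ?p2)"
      unfolding g2 k by (rule plane_walks_meet[OF pe V E4 E2 disj]) (use Q c(2) in auto)
    also have "\<dots> \<subseteq> {pos y'}" using Q(3) c(2) dc y by auto
    finally show ?thesis .
  qed
  define C where "C = path_image g1 \<union> path_image g2"
  have C: "C = (\<Union>e\<in>set (cycle_edges c). path_image (\<gamma> e))" unfolding C_def g1 g2 ce by blast
  have "drawing V E pos \<gamma> - C \<subseteq> inside C"
  proof (rule inside_of_exterior_frontier)
    show "compact (drawing V E pos \<gamma>)"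
      using compact_drawing[OF pe] G finite_edges[OF G] by (simp add: simple_graph_def)
    show "C \<subseteq> drawing V E pos \<gamma>" unfolding C drawing_def using dc by blast
    show "frontier (outside (drawing V E pos \<gamma>)) = C" using fr C by (simp add: exterior_face_def)
  qed
  moreover have "path_image g \<subseteq> drawing V E pos \<gamma>" "path_image k \<subseteq> drawing V E pos \<gamma>"
    unfolding g k drawing_def using E3 E4 by blast+
  ultimately have in_g: "path_image g - C \<subseteq> inside C" and in_k: "path_image k - C \<subseteq> inside C" by blast+
  have ends: "pos x \<in> path_image g1" "pos x' \<in> path_image g1" "pos x \<in> path_image g2"
    "pos x' \<in> path_image g2"
     "pos x \<in> path_image g" "pos x' \<in> path_image g" "pos y \<in> path_image k" "pos y' \<in> path_image k"
    using g1 g2 g k pathstart_in_path_image pathfinish_in_path_image by metis+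
  \<comment> \<open>A point of \<open>g\<close> off the outer cycle; the splitting below needs
    \<open>g\<close> to enter the inside.\<close>
  have "g (1/2) \<noteq> pos x" "g (1/2) \<noteq> pos x'"
    using g(1) g(2,3)[symmetric] unfolding arc_def pathstart_def pathfinish_def
    by (auto simp: inj_on_eq_iff)
  moreover have "g (1/2) \<in> path_image g" by (simp add: path_image_def)
  ultimately have "g (1/2) \<in> path_image g - C" using m1 m2 unfolding C_def by blast
  then have gin: "path_image g \<inter> inside (path_image g1 \<union> path_image g2) \<noteq> {}" using in_g
    unfolding C_def by blast
  \<comment> \<open>The arcs \<open>g1\<close>, \<open>g2\<close> and \<open>g\<close> form a theta
    curve, and \<open>g\<close> divides the inside of the outer cycle into two regions. As
    \<open>g2\<close> runs from \<open>pos x'\<close> to \<open>pos x\<close>, it is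
    reversed.\<close>
  obtain split: "inside (path_image g1 \<union> path_image g) \<inter> inside (path_image g2 \<union> path_image g) = {}"
    "inside (path_image g1 \<union> path_image g) \<union> inside (path_image g2 \<union> path_image g) \<union>
       (path_image g - {pos x, pos x'}) = inside (path_image g1 \<union> path_image g2)"
  proof (rule split_inside_simple_closed_curve[of g1 "pos x" "pos x'" "reversepath g2" g])
    show "simple_path g1" "simple_path (reversepath g2)" "simple_path g"
      using g1 g2 g by (simp_all add: arc_imp_simple_path arc_reversepath)
  qed (use g1 g2 g xx' m12 m1 m2 ends gin in auto)
  let ?I1 = "inside (path_image g1 \<union> path_image g)" and ?I2 = "inside (path_image g2 \<union> path_image g)"
  have cl: "closed (path_image g1 \<union> path_image g)" "closed (path_image g2 \<union> path_image g)"
    by (intro closed_Un closed_path_image arc_imp_path g1(1) g2(1) g(1))+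
  have op: "open ?I1" "open ?I2" using cl by (simp_all add: open_inside)
  define W where "W = path_image k - {pos y, pos y'}"
  have yC: "pos y \<in> path_image g1" "pos y' \<in> path_image g2"
  proof -
    have "\<exists>e\<in>set (walk_edges (u # R @ [u'])). v \<in> e" if vR: "v \<in> set R" for u u' v :: 'a and R
    proof -
      obtain R1 R2 where R: "R = R1 @ v # R2" using split_list[OF vR] by blast
      have "walk_edges (u # R @ [u']) = walk_edges (u # R1 @ [v]) @ walk_edges (v # R2 @ [u'])"
        using walk_edges_join[of "u # R1" v "R2 @ [u']"] R by simp
      then show ?thesis by (auto simp: walk_edges_Cons)
    qed
    then obtain e e' where e: "e \<in> set (walk_edges ?p1)" "y \<in> e" "e' \<in> set (walk_edges ?p2)" "y' \<in> e'"
      using y by meson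
    have *: "pos v \<in> path_image (\<gamma> e)" if "e \<in> E" "v \<in> e" for e v
    proof -
      have "{pathstart (\<gamma> e), pathfinish (\<gamma> e)} = pos ` e"
        using pe that(1) unfolding plane_embedding_def by simp
      then have "pos v = pathstart (\<gamma> e) \<or> pos v = pathfinish (\<gamma> e)" using that(2) by blast
      then show ?thesis by auto
    qed
    show "pos y \<in> path_image g1" "pos y' \<in> path_image g2"
      unfolding g1 g2 using *[OF subsetD[OF E1 e(1)] e(2)] *[OF subsetD[OF E2 e(3)] e(4)] e(1,3)
        by blast+
  qed
  have W: "connected W"
    unfolding W_def using connected_simple_path_endless[OF arc_imp_simple_path[OF k(1)]] k by simp
  have "W \<inter> C = {}" using mk1 mk2 unfolding W_def C_def by blast
  then have "W \<subseteq> inside C" using in_k unfolding W_def by blast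
  then have W12: "W \<subseteq> ?I1 \<union> ?I2" using split(2) mk unfolding C_def W_def by blast
  have "y \<noteq> y'" using y dc c(2) by auto
  then have ypos: "pos y \<noteq> pos y'" using inj xV by (simp add: inj_on_eq_iff)
  \<comment> \<open>A connected set with more than one point has no isolated points, and deleting
    the two ends does not change limit points. So the open arc accumulates at both ends.\<close>
  have lim: "pos y \<in> closure W" "pos y' \<in> closure W"
  proof -
    have ns: "\<nexists>a. path_image k = {a}" using ends(7,8) ypos by auto
    have con: "connected (path_image k)" using k(1) by (simp add: arc_imp_path connected_path_image)
    have eq: "path_image k = insert (pos y) (insert (pos y') W)" unfolding W_def using ends(7,8)
      by blast
    have "z islimpt W" if "z \<in> path_image k" for z
      using connected_imp_perfect[OF con, of z] ns that eq by (metis islimpt_insert)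
    then show "pos y \<in> closure W" "pos y' \<in> closure W" using ends(7,8) by (auto simp: closure_def)
  qed
  have IC: "?I1 \<inter> C = {}" "?I2 \<inter> C = {}"
  proof -
    have "?I1 \<subseteq> inside C" "?I2 \<subseteq> inside C" unfolding C_def split(2)[symmetric] by blast+
    then show "?I1 \<inter> C = {}" "?I2 \<inter> C = {}" using inside_no_overlap[of C] by blast+
  qed
  \<comment> \<open>The open arc stays in one region. The closure of \<open>?I1\<close> adds only
    points of \<open>g1\<close> and \<open>g\<close> and thus misses \<open>pos y'\<close>; the
    closure of \<open>?I2\<close> misses \<open>pos y\<close> in the same way.\<close>
  have "W \<subseteq> ?I1 \<or> W \<subseteq> ?I2"
  proof -
    have "?I1 \<inter> ?I2 \<inter> W = {}" using split(1) by blast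
    then have "?I1 \<inter> W = {} \<or> ?I2 \<inter> W = {}" using connectedD[OF W op] W12 by simp
    then show ?thesis using W12 by blast
  qed
  then show False
  proof
    assume "W \<subseteq> ?I1"
    then have "closure W \<subseteq> (path_image g1 \<union> path_image g) \<union> ?I1"
      using closure_mono closure_inside_subset[OF cl(1)] by blast
    then have "pos y' \<in> path_image g1 \<union> path_image g \<union> ?I1" using lim by blast
    moreover have "pos y' \<notin> ?I1" using IC yC unfolding C_def by blast
    moreover have "pos y' \<notin> path_image g" using mk ends(8) by blast
    ultimately have "pos y' \<in> path_image g1" by blast
    then have "pos y' = pos y" using mk1 ends(8) by blast
    then show False using ypos by simp
  next
    assume "W \<subseteq> ?I2"
    then have "closure W \<subseteq> (path_image g2 \<union> path_image g) \<union> ?I2"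
      using closure_mono closure_inside_subset[OF cl(2)] by blast
    then have "pos y \<in> path_image g2 \<union> path_image g \<union> ?I2" using lim by blast
    moreover have "pos y \<notin> ?I2" using IC yC unfolding C_def by blast
    moreover have "pos y \<notin> path_image g" using mk ends(7) by blast
    ultimately have "pos y \<in> path_image g2" by blast
    then have "pos y = pos y'" using mk2 ends(7) by blast
    then show False using ypos by simp
  qed
qed

section \<open>Runs of leaves along the outer cycle\<close>

definition cyc_succ :: "'v list \<Rightarrow> 'v \<Rightarrow> 'v \<Rightarrow> bool" where
  "cyc_succ c x y \<longleftrightarrow> (\<exists>i<length c. x = c ! i \<and> y = c ! (Suc i mod length c))"

lemma nth_snoc_hd: "i < length c \<Longrightarrow> (c @ [hd c]) ! Suc i = c ! (Suc i mod length c)"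
  by (cases "Suc i = length c"; cases c) (auto simp: nth_append)

lemma set_cycle_edges: "set (cycle_edges c) = {{x, y} |x y. cyc_succ c x y}"
proof -
  have "(c @ [hd c]) ! i = c ! i" if "i < length c" for i using that by (simp add: nth_append)
  then have "{{(c @ [hd c]) ! i, (c @ [hd c]) ! Suc i} |i. i < length c} = {{c ! i, c ! (Suc i mod length c)} |i. i < length c}"
    using nth_snoc_hd by (metis (no_types, opaque_lifting))
  then show ?thesis unfolding cycle_edges_def set_walk_edges cyc_succ_def by auto
qed

lemma cyc_succ_rev:
  assumes "cyc_succ c x y"
  shows "cyc_succ (rev c) y x"
proof -
  obtain i where i: "i < length c" "x = c ! i" "y = c ! (Suc i mod length c)"
    using assms by (auto simp: cyc_succ_def)
  let ?j = "length c - 1 - Suc i mod length c"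
  have l: "Suc i mod length c < length c" using i by (intro mod_less_divisor) auto
  have "rev c ! ?j = y" using l i by (subst rev_nth) auto
  moreover have "rev c ! (Suc ?j mod length c) = x"
  proof (cases "Suc i = length c")
    case True
    then have "Suc ?j = length c" using i by simp
    then have "Suc ?j mod length c = 0" by simp
    moreover have "rev c ! 0 = c ! (length c - Suc 0)" using i by (subst rev_nth) auto
    moreover have "length c - Suc 0 = i" using True by simp
    ultimately show ?thesis using i(2) by simp
  next
    case False
    then have "Suc i < length c" using i by simp
    then have "Suc ?j mod length c = length c - 1 - i" by simp
    then show ?thesis using i by (simp add: rev_nth)
  qed
  ultimately show ?thesis unfolding cyc_succ_def using i l by (intro exI[of _ ?j]) auto
qed

lemma graph_cycle_rev:
  assumes "graph_cycle V E c"
  shows "graph_cycle V E (rev c)" "set (cycle_edges (rev c)) = set (cycle_edges c)"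
proof -
  have "cyc_succ (rev c) x y \<longleftrightarrow> cyc_succ c y x" for x y
    using cyc_succ_rev[of c y x] cyc_succ_rev[of "rev c" x y] by auto
  then show *: "set (cycle_edges (rev c)) = set (cycle_edges c)"
    unfolding set_cycle_edges by (auto simp: insert_commute)
  then show "graph_cycle V E (rev c)" using assms by (simp add: graph_cycle_def)
qed

section \<open>Branches of the tree at a vertex\<close>

definition avoid_step :: "'v set set \<Rightarrow> 'v \<Rightarrow> ('v \<times> 'v) set" where
  "avoid_step F m = {(a, b). {a, b} \<in> F \<and> a \<noteq> m \<and> b \<noteq> m}"

text \<open>Deleting \<open>m\<close> splits the tree into branches, and for other vertices
  reachability by \<open>avoid_step\<close> means lying in the same branch. Reachability is composed
  by symmetry and transitivity, which is easier than gluing paths, and is turned back into a path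
  only at the end.\<close>

lemma sym_avoid_step: "sym (avoid_step F m)"
  by (auto simp: sym_def avoid_step_def insert_commute)

lemma path_avoid_step:
  assumes "graph_path V F p" "m \<notin> set p"
  shows "(hd p, last p) \<in> (avoid_step F m)\<^sup>*"
  using assms
proof (induction p)
  case (Cons u p)
  show ?case
  proof (cases "p = []")
    case False
    then have "graph_path V F p" "(u, hd p) \<in> avoid_step F m"
      using Cons.prems by (cases p; auto simp: graph_path_def avoid_step_def)+
    then show ?thesis using Cons False by (auto intro: converse_rtrancl_into_rtrancl)
  qed simp
qed (simp add: graph_path_def)

lemma avoid_step_path:
  assumes G: "simple_graph V F" and "(a, b) \<in> (avoid_step F m)\<^sup>*" "a \<in> V" "a \<noteq> m"
  shows "\<exists>p. graph_path V F p \<and> hd p = a \<and> last p = b \<and> m \<notin> set p"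
  using assms(2-)
proof (induction rule: rtrancl_induct)
  case base
  then show ?case by (intro exI[of _ "[a]"]) (auto simp: graph_path_def)
next
  case (step b c)
  then obtain p where p: "graph_path V F p" "hd p = a" "last p = b" "m \<notin> set p" by blast
  have bc: "{b, c} \<in> F" "c \<noteq> m" using step by (auto simp: avoid_step_def)
  have pne: "p \<noteq> []" using p by (simp add: graph_path_def)
  show ?case
  proof (cases "c \<in> set p")
    case True
    then obtain p1 p2 where s: "p = p1 @ c # p2" using split_list by metis
    have "walk_edges p = walk_edges (p1 @ [c]) @ walk_edges (c # p2)" unfolding s
      by (rule walk_edges_join)
    then have "graph_path V F (p1 @ [c])" using p s by (auto simp: graph_path_def)
    moreover have "hd (p1 @ [c]) = a" using p s by (cases p1) auto
    ultimately show ?thesis using p s by (intro exI[of _ "p1 @ [c]"]) auto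
  next
    case False
    have "c \<in> V" using simple_graph_edgeD[OF G bc(1)] by simp
    then have "graph_path V F (p @ [c])" using p bc False pne
      by (auto simp: graph_path_def walk_edges_snoc)
    then show ?thesis using p pne bc by (intro exI[of _ "p @ [c]"]) auto
  qed
qed

lemma leaf_nbhd:
  assumes "simple_graph V F" "y \<in> leaves V F" "{y, u} \<in> F"
  shows "nbhd F y = {u}"
proof -
  have "card (nbhd F y) = 1" using assms by (simp add: leaves_def degree_eq_card_nbhd)
  moreover have "u \<in> nbhd F y" using assms by (simp add: nbhd_iff)
  ultimately show ?thesis by (auto simp: card_1_singleton_iff)
qed

lemma path_from_leaf:
  assumes T: "tree V F" and y: "y \<in> leaves V F" and p: "graph_path V F p" "hd p = y" and i:
    "i < length p" "p ! i \<in> leaves V F"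
  shows "i = 0 \<or> Suc i = length p"
proof (rule ccontr)
  assume "\<not> ?thesis"
  then have "2 \<le> degree F (p ! i)" using inner_degree[OF tree_simple[OF T] p(1), of i] i by auto
  then show False using i by (auto simp: leaves_def)
qed

text \<open>The inner vertex \<open>m\<close> excludes the tree with a single edge. A path from
  \<open>y\<close> to \<open>m\<close> passes \<open>u\<close> at once, so \<open>u\<close> is
  \<open>m\<close> itself or interior to the path.\<close>

lemma leaf_nbr_inner:
  assumes T: "tree V F" and m: "m \<in> V - leaves V F" and y: "y \<in> leaves V F" "{y, u} \<in> F"
  shows "u \<in> V - leaves V F"
proof -
  note G = tree_simple[OF T]
  have yV: "y \<in> V" using y by (auto simp: leaves_def)
  obtain p where p: "graph_path V F p" "hd p = y" "last p = m"
    using graph_connectedE[of V F y m] T yV m unfolding tree_def by blast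
  have "y \<noteq> m" using y m by blast
  then have len: "2 \<le> length p" using p by (cases p; cases "tl p") (auto simp: graph_path_def)
  have pne: "p \<noteq> []" using p by (simp add: graph_path_def)
  have "p ! 0 = y" using p(2) pne by (simp add: hd_conv_nth)
  then have "{y, p ! 1} \<in> F" using graph_path_edge[OF p(1), of 0] len by simp
  then have "p ! 1 \<in> nbhd F y" by (simp add: nbhd_iff)
  then have p1: "p ! 1 = u" using leaf_nbhd[OF G y] by simp
  have uV: "u \<in> V" using simple_graph_edgeD[OF G y(2)] by simp
  show ?thesis
  proof (cases "length p = 2")
    case True
    then have "last p = p ! 1" using last_conv_nth[OF pne] by (simp only: True) simp
    then have "u = m" unfolding p1 p(3) by simp
    then show ?thesis using m by simp
  next
    case False
    then have len3: "1 < length p" "Suc 1 \<noteq> length p" using len by simp_all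
    have "u \<notin> leaves V F"
    proof
      assume "u \<in> leaves V F"
      then have "p ! 1 \<in> leaves V F" unfolding p1 .
      from path_from_leaf[OF T y(1) p(1,2) len3(1) this] show False using len3 by simp
    qed
    then show ?thesis using uV by simp
  qed
qed

text \<open>The branch is named by the second vertex of the path from \<open>m\<close> to
  \<open>y\<close>. Since \<open>y\<close> is not adjacent to \<open>m\<close>, that vertex is
  interior to the path and so not a leaf.\<close>

lemma branch_exists:
  assumes T: "tree V F" and m: "m \<in> V - leaves V F" and y: "y \<in> leaves V F" "y \<notin> nbhd F m"
  shows "\<exists>u\<in>nbhd F m - leaves V F. (u, y) \<in> (avoid_step F m)\<^sup>*"
proof -
  note G = tree_simple[OF T]
  have yV: "y \<in> V" using y by (auto simp: leaves_def)
  obtain p where p: "graph_path V F p" "hd p = m" "last p = y"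
    using graph_connectedE[of V F m y] T yV m unfolding tree_def by blast
  have "y \<noteq> m" using y m by blast
  then obtain u q where pq: "p = m # u # q" using p
    by (cases p; cases "tl p") (auto simp: graph_path_def)
  have um: "u \<in> nbhd F m" using p pq by (simp add: graph_path_def nbhd_iff)
  have "q \<noteq> []" using um y pq p by auto
  then have "2 \<le> degree F (p ! 1)" using inner_degree[OF G p(1), of 1] pq by simp
  then have "u \<notin> leaves V F" using pq by (auto simp: leaves_def)
  moreover have "(u, y) \<in> (avoid_step F m)\<^sup>*"
    using path_avoid_step[of V F "u # q" m] p pq by (auto simp: graph_path_def)
  ultimately show ?thesis using um by blast
qed

text \<open>An exit is a leaf at \<open>m\<close> whose successor hangs elsewhere; that successor
  lies in the branch of some inner neighbor of \<open>m\<close>. If two exits \<open>a\<close>,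
  \<open>b\<close> led to the same branch, the path from \<open>a\<close> over \<open>m\<close> to
  \<open>b\<close> would cross a path inside the branch between their successors. So exits inject
  into the inner neighbors.\<close>

lemma exits_le_two:
  assumes T: "tree V F" and G: "simple_graph V E" and E: "F \<subseteq> E"
    and c: "graph_cycle V E c" "set c = leaves V F"
    and pe: "plane_embedding V E pos \<gamma>"
    and fr: "frontier (exterior_face V E pos \<gamma>) = (\<Union>e\<in>set (cycle_edges c). path_image (\<gamma> e))"
    and m: "m \<in> V - leaves V F" "card (nbhd F m - leaves V F) \<le> 2"
  shows "card {x \<in> nbhd F m. \<exists>y. y \<notin> nbhd F m \<and> cyc_succ c x y} \<le> 2"
proof (rule ccontr)
  note GF = tree_simple[OF T]
  let ?X = "nbhd F m" and ?n = "length c"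
  define Ex where "Ex = {x \<in> ?X. \<exists>y. y \<notin> ?X \<and> cyc_succ c x y}"
  assume "\<not> card {x \<in> ?X. \<exists>y. y \<notin> ?X \<and> cyc_succ c x y} \<le> 2"
  then have big: "2 < card Ex" by (simp add: Ex_def)
  have dc: "distinct c" "0 < ?n" using c(1) by (auto simp: graph_cycle_def)
  define I where "I x = (SOME i. i < ?n \<and> x = c ! i \<and> c ! (Suc i mod ?n) \<notin> ?X)" for x
  have I: "I x < ?n" "x = c ! I x" "c ! (Suc (I x) mod ?n) \<notin> ?X" if "x \<in> Ex" for x
  proof -
    have "\<exists>i. i < ?n \<and> x = c ! i \<and> c ! (Suc i mod ?n) \<notin> ?X" using that
      by (auto simp: Ex_def cyc_succ_def)
    from someI_ex[OF this] show "I x < ?n" "x = c ! I x" "c ! (Suc (I x) mod ?n) \<notin> ?X"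
      unfolding I_def by blast+
  qed
  define u where "u x = (SOME u. u \<in> ?X - leaves V F \<and> (u, c ! (Suc (I x) mod ?n)) \<in> (avoid_step F m)\<^sup>*)" for x
  have u: "u x \<in> ?X - leaves V F" "(u x, c ! (Suc (I x) mod ?n)) \<in> (avoid_step F m)\<^sup>*" if "x \<in> Ex" for x
  proof -
    have "c ! (Suc (I x) mod ?n) \<in> leaves V F" using dc c(2) by (metis mod_less_divisor nth_mem)
    then have "\<exists>u. u \<in> ?X - leaves V F \<and> (u, c ! (Suc (I x) mod ?n)) \<in> (avoid_step F m)\<^sup>*"
      using branch_exists[OF T m(1) _ I(3)[OF that]] by blast
    from someI_ex[OF this] show "u x \<in> ?X - leaves V F"
      "(u x, c ! (Suc (I x) mod ?n)) \<in> (avoid_step F m)\<^sup>*"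
      unfolding u_def by blast+
  qed
  have "\<not> inj_on u Ex"
  proof
    assume "inj_on u Ex"
    then have "card Ex \<le> card (?X - leaves V F)"
      by (rule card_inj_on_le) (use u finite_nbhd[OF GF] in auto)
    then show False using big m(2) by simp
  qed
  then obtain a b where ab: "a \<in> Ex" "b \<in> Ex" "a \<noteq> b" "u a = u b" by (auto simp: inj_on_def)
  have False if ab: "a \<in> Ex" "b \<in> Ex" "u a = u b" and ij: "I a < I b" for a b
  proof -
    define i j where "i = I a" and "j = I b"
    have ij: "i < j" "j < ?n" using ij I(1)[OF ab(2)] by (auto simp: i_def j_def)
    have aX: "c ! i \<in> ?X" "c ! j \<in> ?X" using ab I(2) by (auto simp: Ex_def i_def j_def)
    have Si: "c ! Suc i \<notin> ?X" using I(3)[OF ab(1)] ij by (simp add: i_def)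
    \<comment> \<open>The successor of the first exit is not adjacent to \<open>m\<close> but the
      second exit is, so the stretch \<open>A\<close> between the exits is not empty.\<close>
    then have Sij: "Suc i \<noteq> j" using aX by metis
    define y y' where "y = c ! Suc i" and "y' = c ! (Suc j mod ?n)"
    have y': "y' \<notin> ?X" using I(3)[OF ab(2)] by (simp add: y'_def j_def)
    \<comment> \<open>The cycle is rotated to start at the first exit; the successors
      \<open>y\<close> and \<open>y'\<close> then fall into the two stretches \<open>A\<close> and
      \<open>B\<close>.\<close>
    define A where "A = take (j - Suc i) (drop (Suc i) c)"
    define B where "B = drop (Suc j) c @ take i c"
    have dec: "c = take i c @ c ! i # A @ c ! j # drop (Suc j) c"
    proof -
      have "c = take i c @ c ! i # drop (Suc i) c" using ij by (intro id_take_nth_drop) simp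
      moreover have "drop (Suc i) c = A @ c ! j # drop (Suc j) c"
        unfolding A_def using id_take_nth_drop[of "j - Suc i" "drop (Suc i) c"] ij Sij by simp
      ultimately show ?thesis by metis
    qed
    let ?c = "c ! i # A @ c ! j # B"
    have c': "set (cycle_edges ?c) = set (cycle_edges c)"
      using set_cycle_edges_rotate[of "take i c" "c ! i # A @ c ! j # drop (Suc j) c"] dec
        by (simp add: B_def)
    have sc: "set ?c = set c" "length ?c = length c" "distinct ?c"
    proof -
      have "mset ?c = mset (take i c @ c ! i # A @ c ! j # drop (Suc j) c)" by (simp add: B_def)
      then have "mset ?c = mset c" using dec by simp
      then show "set ?c = set c" "length ?c = length c" "distinct ?c"
        using dc(1) by (metis mset_eq_setD, metis mset_eq_length, metis mset_eq_imp_distinct_iff)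
    qed
    have cyc: "graph_cycle V E ?c" using c(1) c' sc by (simp add: graph_cycle_def)
    have yA: "y \<in> set A"
    proof -
      have "A ! 0 = y" "0 < length A" using ij Sij by (auto simp: A_def y_def)
      then show ?thesis using nth_mem by metis
    qed
    have yB: "y' \<in> set B"
    proof (cases "Suc j < ?n")
      case True
      then have "drop (Suc j) c ! 0 = y'" "0 < length (drop (Suc j) c)" by (auto simp: y'_def)
      then have "y' \<in> set (drop (Suc j) c)" using nth_mem by metis
      then show ?thesis by (simp add: B_def)
    next
      case False
      then have "Suc j = ?n" using ij by simp
      then have "y' = c ! 0" by (simp add: y'_def)
      \<comment> \<open>Otherwise the successor \<open>y'\<close>, wrapping around, would be the
        first exit, which is adjacent to \<open>m\<close>.\<close>
      moreover have "i \<noteq> 0" using aX y' calculation by metis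
      ultimately have "take i c ! 0 = y'" "0 < length (take i c)" using dc ij by auto
      then have "y' \<in> set (take i c)" using nth_mem by metis
      then show ?thesis by (simp add: B_def)
    qed
    have lv: "c ! i \<in> leaves V F" "c ! j \<in> leaves V F" "y \<in> leaves V F" "y' \<in> leaves V F"
      using sc c(2) yA yB by auto
    have P: "graph_path V E (c ! i # [m] @ [c ! j])"
      using aX E m lv c(1) dc ij unfolding graph_path_def
      by (auto simp: nbhd_iff insert_commute nth_eq_iff_index_eq leaves_def)
    have "(y, u a) \<in> (avoid_step F m)\<^sup>*"
      using u(2)[OF ab(1)] sym_rtrancl[OF sym_avoid_step, of F m] ij by (auto simp: y_def i_def sym_def)
    moreover have "(u a, y') \<in> (avoid_step F m)\<^sup>*"
      using u(2)[OF ab(2)] ab(3) by (simp add: y'_def j_def)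
    ultimately have yy': "(y, y') \<in> (avoid_step F m)\<^sup>*" by (rule rtrancl_trans)
    have yV: "y \<in> V" "y \<noteq> m" using lv m by (auto simp: leaves_def)
    obtain q where q: "graph_path V F q" "hd q = y" "last q = y'" "m \<notin> set q"
      using avoid_step_path[OF GF yy' yV] by blast
    have ne: "y \<noteq> y'" using sc(3) yA yB by auto
    \<comment> \<open>Leaves can only be ends of a tree path, so the interior of \<open>q\<close>
      avoids the outer cycle.\<close>
    have qinner: "q ! k \<notin> leaves V F" if "0 < k" "Suc k < length q" for k
      using path_from_leaf[OF T lv(3) q(1,2), of k] that by auto
    have "q \<noteq> []" using q by (simp add: graph_path_def)
    then obtain r where r: "q = y # r" using q(2) by (cases q) auto
    have "r \<noteq> []" using r q ne by auto
    then obtain Q where Q: "q = y # Q @ [y']" using r q(3) by (cases r rule: rev_cases) auto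
    have "Q \<noteq> []"
    proof
      assume "Q = []"
      then have "{y, y'} \<in> F" using q Q by (simp add: graph_path_def)
      then show False using leaf_nbr_inner[OF T m(1) lv(3)] lv(4) by blast
    qed
    moreover have "set Q \<inter> leaves V F = {}"
    proof -
      have "z \<notin> leaves V F" if z: "z \<in> set Q" for z
      proof -
        obtain k where "k < length Q" "z = Q ! k" using z by (auto simp: in_set_conv_nth)
        then show ?thesis using qinner[of "Suc k"] Q by (simp add: nth_append)
      qed
      then show ?thesis by blast
    qed
    moreover have "graph_path V E (y # Q @ [y'])" using q Q E by (auto simp: graph_path_def)
    moreover have "m \<notin> leaves V F" "m \<notin> set Q" using m q(4) Q by auto
    moreover have "set ?c = leaves V F" using sc(1) c(2) by simp
    ultimately show False
      using outer_cycle_no_crossing[OF G pe _ cyc refl yA yB P, of Q] fr[folded c'] by auto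
  qed
  from this[of a b] this[of b a] show False
    using ab I(2) by (metis linorder_neqE_nat)
qed

text \<open>Inner neighbors have no \<open>S\<close>-neighbors, so three of them suffice. Otherwise
  the bound on exits is applied to both orientations of the cycle: at most four leaves at
  \<open>m\<close> have a cycle neighbor elsewhere, and degree 9 leaves more than three.\<close>

lemma inner_runs:
  assumes T: "tree V F" and G: "simple_graph V E" and E: "F \<subseteq> E"
    and c: "graph_cycle V E c" "set c = leaves V F"
    and pe: "plane_embedding V E pos \<gamma>"
    and fr: "frontier (exterior_face V E pos \<gamma>) = (\<Union>e\<in>set (cycle_edges c). path_image (\<gamma> e))"
    and m: "m \<in> V - leaves V F" and deg: "9 \<le> degree F m"
    and S: "\<And>x y. S x y \<Longrightarrow> x \<in> leaves V F \<and> {x, y} \<in> set (cycle_edges c)"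
  shows "3 \<le> card {z \<in> nbhd F m. \<forall>y. S z y \<longrightarrow> y \<in> nbhd F m}" (is "3 \<le> card ?Z")
proof (cases "card (nbhd F m - leaves V F) \<le> 2")
  case False
  have fin: "finite (nbhd F m)" by (rule finite_nbhd[OF tree_simple[OF T]])
  have "nbhd F m - leaves V F \<subseteq> ?Z" using S by blast
  then have "card (nbhd F m - leaves V F) \<le> card ?Z" using fin by (intro card_mono) auto
  then show ?thesis using False by simp
next
  case True
  note GF = tree_simple[OF T]
  have fin: "finite (nbhd F m)" by (rule finite_nbhd[OF GF])
  define Ex where "Ex c = {x \<in> nbhd F m. \<exists>y. y \<notin> nbhd F m \<and> cyc_succ c x y}" for c
  have e1: "card (Ex c) \<le> 2" unfolding Ex_def by (rule exits_le_two[OF T G E c pe fr m True])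
  have e2: "card (Ex (rev c)) \<le> 2"
    unfolding Ex_def
    by (rule exits_le_two[OF T G E _ _ pe _ m True]) (use graph_cycle_rev[OF c(1)] c fr in simp_all)
  have sub: "nbhd F m - (Ex c \<union> Ex (rev c)) \<subseteq> ?Z"
  proof
    fix z assume z: "z \<in> nbhd F m - (Ex c \<union> Ex (rev c))"
    have "y \<in> nbhd F m" if "S z y" for y
    proof -
      have "{z, y} \<in> set (cycle_edges c)" using S[OF that] by simp
      then have "cyc_succ c z y \<or> cyc_succ c y z" unfolding set_cycle_edges
        by (auto simp: doubleton_eq_iff)
      then have "cyc_succ c z y \<or> cyc_succ (rev c) z y" using cyc_succ_rev by metis
      then show ?thesis using z by (auto simp: Ex_def)
    qed
    then show "z \<in> ?Z" using z by simp
  qed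
  have "finite (Ex c \<union> Ex (rev c))" using fin by (simp add: Ex_def)
  then have "card (nbhd F m) - card (Ex c \<union> Ex (rev c)) \<le> card (nbhd F m - (Ex c \<union> Ex (rev c)))"
    by (rule diff_card_le_card_Diff)
  also have "\<dots> \<le> card ?Z" using sub fin by (intro card_mono) auto
  finally show ?thesis
    using card_Un_le[of "Ex c" "Ex (rev c)"] e1 e2 deg by (simp add: degree_eq_card_nbhd[OF GF])
qed

section \<open>The upper bound\<close>

text \<open>Four-edge paths and four-cycles are treated together as walks without backtracking; the
  walk is closed if \<open>v0 = v4\<close>. For a proper coloring, two colors on such a walk must
  alternate.\<close>

lemma star_edge_coloringI:
  assumes G: "simple_graph V E"
    and adj: "\<And>v a b. \<lbrakk>{v, a} \<in> E; {v, b} \<in> E; a \<noteq> b\<rbrakk> \<Longrightarrow> \<phi> {v, a} \<noteq> \<phi> {v, b}"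
    and path: "\<And>v0 v1 v2 v3 v4. \<lbrakk>{v0, v1} \<in> E; {v1, v2} \<in> E; {v2, v3} \<in> E; {v3, v4} \<in> E;
      v0 \<noteq> v2; v1 \<noteq> v3; v2 \<noteq> v4; \<phi> {v0, v1} = \<phi> {v2, v3}; \<phi> {v1, v2} = \<phi> {v3, v4}\<rbrakk> \<Longrightarrow> False"
  shows "star_edge_coloring V E \<phi>"
proof -
  have walk: "card (\<phi> ` {{v0, v1}, {v1, v2}, {v2, v3}, {v3, v4}}) \<noteq> 2"
    if e: "{v0, v1} \<in> E" "{v1, v2} \<in> E" "{v2, v3} \<in> E" "{v3, v4} \<in> E" "v0 \<noteq> v2" "v1 \<noteq> v3" "v2 \<noteq> v4"
    for v0 v1 v2 v3 v4
  proof
    let ?a = "\<phi> {v0, v1}" and ?b = "\<phi> {v1, v2}" and ?c = "\<phi> {v2, v3}" and ?d = "\<phi> {v3, v4}"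
    assume "card (\<phi> ` {{v0, v1}, {v1, v2}, {v2, v3}, {v3, v4}}) = 2"
    then have "card {?a, ?b, ?c, ?d} = 2" by simp
    moreover have "?a \<noteq> ?b" "?b \<noteq> ?c" "?c \<noteq> ?d"
      using adj[of v1 v0 v2] adj[of v2 v1 v3] adj[of v3 v2 v4] e by (simp_all add: insert_commute)
    ultimately have "?a = ?c" "?b = ?d" by (auto simp: card_insert_if split: if_splits)
    then show False using path[of v0 v1 v2 v3 v4] e by blast
  qed
  show ?thesis
    unfolding star_edge_coloring_def
  proof (intro conjI allI impI)
    show "proper_edge_coloring E \<phi>"
      unfolding proper_edge_coloring_def
    proof (intro ballI impI)
      fix e f assume ef: "e \<in> E" "f \<in> E" "e \<noteq> f \<and> e \<inter> f \<noteq> {}"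
      then obtain v where v: "v \<in> e" "v \<in> f" by blast
      obtain a where "e = {v, a}" by (rule simple_graph_edgeE[OF G ef(1) v(1)])
      moreover obtain b where "f = {v, b}" by (rule simple_graph_edgeE[OF G ef(2) v(2)])
      ultimately show "\<phi> e \<noteq> \<phi> f" using adj[of v a b] ef by blast
    qed
  next
    fix p assume p: "graph_path V E p \<and> length p = 5"
    then obtain v0 v1 v2 v3 v4 where "p = [v0, v1, v2, v3, v4]"
      by (auto simp: numeral_eq_Suc length_Suc_conv)
    then show "\<not> bichromatic \<phi> (set (walk_edges p))"
      using walk[of v0 v1 v2 v3 v4] p by (simp add: bichromatic_def graph_path_def)
  next
    fix p assume p: "graph_cycle V E p \<and> length p = 4"
    then obtain v0 v1 v2 v3 where "p = [v0, v1, v2, v3]"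
      by (auto simp: numeral_eq_Suc length_Suc_conv)
    then show "\<not> bichromatic \<phi> (set (cycle_edges p))"
      using walk[of v0 v1 v2 v3 v0] p by (auto simp: bichromatic_def graph_cycle_def cycle_edges_def)
  qed
qed

lemma cyc_succ_unique:
  assumes "distinct c" "cyc_succ c x y" "cyc_succ c x y'"
  shows "y = y'"
  using assms by (auto simp: cyc_succ_def nth_eq_iff_index_eq)

lemma card_at_most_one:
  assumes "\<And>y y'. P y \<Longrightarrow> P y' \<Longrightarrow> y = y'"
  shows "finite {y. P y} \<and> card {y. P y} \<le> 1"
proof (cases "\<exists>y. P y")
  case True
  then obtain y where "P y" by blast
  then have "{y. P y} = {y}" using assms by blast
  then show ?thesis by simp
qed simp

lemma cycle_nbhd_card:
  assumes "distinct c"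
  shows "finite {y. {x, y} \<in> set (cycle_edges c)}" "card {y. {x, y} \<in> set (cycle_edges c)} \<le> 2"
proof -
  have eq: "{y. {x, y} \<in> set (cycle_edges c)} = {y. cyc_succ c x y} \<union> {y. cyc_succ c y x}"
    unfolding set_cycle_edges by (auto simp: doubleton_eq_iff)
  have a: "finite {y. cyc_succ c x y} \<and> card {y. cyc_succ c x y} \<le> 1"
    by (rule card_at_most_one) (rule cyc_succ_unique[OF assms])
  have b: "finite {y. cyc_succ c y x} \<and> card {y. cyc_succ c y x} \<le> 1"
  proof (rule card_at_most_one)
    fix y y' assume "cyc_succ c y x" "cyc_succ c y' x"
    from this[THEN cyc_succ_rev] show "y = y'" using cyc_succ_unique[of "rev c"] assms by simp
  qed
  show "finite {y. {x, y} \<in> set (cycle_edges c)}" unfolding eq using a b by simp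
  show "card {y. {x, y} \<in> set (cycle_edges c)} \<le> 2"
    unfolding eq using card_Un_le[of "{y. cyc_succ c x y}" "{y. cyc_succ c y x}"] a b by linarith
qed

text \<open>Indices range over all naturals modulo the length, which removes the special case of the
  closing edge. The third claim uses length at least three: an edge read in both directions would
  make the length divide 2.\<close>

lemma cycle_index_edges:
  assumes n: "3 \<le> length c" and d: "distinct c"
  defines "xs \<equiv> \<lambda>i. c ! (i mod length c)"
  shows "set (cycle_edges c) = {{xs i, xs (i + 1)} |i. True}"
    and "xs i = xs j \<longleftrightarrow> i mod length c = j mod length c"
    and "{xs i, xs (i + 1)} = {xs j, xs (j + 1)} \<Longrightarrow> i mod length c = j mod length c"
proof -
  let ?n = "length c"
  have pos: "0 < ?n" using n by linarith
  have lt: "i mod ?n < ?n" for i using pos by simp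
  show inj: "xs i = xs j \<longleftrightarrow> i mod ?n = j mod ?n" for i j
    using nth_eq_iff_index_eq[OF d lt lt] by (simp add: xs_def)
  have "cyc_succ c x y \<longleftrightarrow> (\<exists>i. x = xs i \<and> y = xs (i + 1))" for x y
  proof
    assume "cyc_succ c x y"
    then obtain i where "i < ?n" "x = c ! i" "y = c ! (Suc i mod ?n)" by (auto simp: cyc_succ_def)
    then show "\<exists>i. x = xs i \<and> y = xs (i + 1)" by (intro exI[of _ i]) (simp add: xs_def)
  next
    assume "\<exists>i. x = xs i \<and> y = xs (i + 1)"
    then obtain i where "x = xs i" "y = xs (i + 1)" by blast
    then show "cyc_succ c x y"
      unfolding cyc_succ_def xs_def using lt[of i]
        by (intro exI[of _ "i mod ?n"]) (simp add: mod_Suc_eq)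
  qed
  then show "set (cycle_edges c) = {{xs i, xs (i + 1)} |i. True}" unfolding set_cycle_edges by auto
  show "i mod ?n = j mod ?n" if "{xs i, xs (i + 1)} = {xs j, xs (j + 1)}"
  proof (rule ccontr)
    assume "i mod ?n \<noteq> j mod ?n"
    then have "xs i \<noteq> xs j" using inj by simp
    then have "xs i = xs (j + 1)" "xs (i + 1) = xs j" using that by (auto simp: doubleton_eq_iff)
    then have "i mod ?n = (j + 1) mod ?n" "(i + 1) mod ?n = j mod ?n" using inj by auto
    then have "(j + 2) mod ?n = j mod ?n" by (metis add.assoc mod_add_left_eq one_add_one)
    then have "?n dvd 2" by (metis add_diff_cancel_left' le_add1 mod_eq_dvd_iff_nat)
    then show False using n by (auto dest: dvd_imp_le)
  qed
qed

text \<open>A four-edge walk is judged by its middle vertex. At an inner vertex the tournament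
  decides. At a leaf, the walk leaves along the parent edge or a cycle edge on either side, and only
  tree edges of nearby leaves and four consecutive cycle edges can matter.\<close>

lemma halin_star_edge_choosable:
  assumes H: "generalized_halin_graph V E" and \<Delta>: "13 \<le> max_degree V E"
  shows "star_edge_choosable V E (max_degree V E + max_degree V E div 2)"
  unfolding star_edge_choosable_def
proof (intro allI impI)
  define \<Delta> where "\<Delta> = max_degree V E"
  define h where "h = \<Delta> div 2"
  have \<Delta>13: "13 \<le> \<Delta>" using \<Delta> by (simp add: \<Delta>_def)
  \<comment> \<open>The budget of a cycle edge: \<open>h\<close> colors for the tournament at each
    parent, four tree edges, and three colors left over.\<close>
  have h: "\<Delta> \<le> 2 * h + 1" "2 * h + 4 + 3 \<le> \<Delta> + h" unfolding h_def using \<Delta>13 by linarith+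
  fix L :: "'a set \<Rightarrow> nat set"
  assume "\<forall>e\<in>E. finite (L e) \<and> max_degree V E + max_degree V E div 2 \<le> card (L e)"
  then have L: "finite (L e) \<and> \<Delta> + h \<le> card (L e)" if "e \<in> E" for e
    using that by (simp add: \<Delta>_def h_def)
  obtain F c pos \<gamma> where T: "tree V F" and c: "graph_cycle V E c" "set c = leaves V F"
    and E: "E = F \<union> set (cycle_edges c)" and pe: "plane_embedding V E pos \<gamma>"
    and fr: "frontier (exterior_face V E pos \<gamma>) = (\<Union>e\<in>set (cycle_edges c). path_image (\<gamma> e))"
    using H unfolding generalized_halin_graph_def by blast
  note GF = tree_simple[OF T]
  let ?N = "V - leaves V F" and ?n = "length c"
  have dc: "distinct c" "3 \<le> ?n" using c(1) by (auto simp: graph_cycle_def)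
  define xs where "xs i = c ! (i mod ?n)" for i
  have pos: "0 < ?n" using dc(2) by linarith
  have ce: "set (cycle_edges c) = {{xs i, xs (i + 1)} |i. True}"
    and xs_inj: "\<And>i j. xs i = xs j \<longleftrightarrow> i mod ?n = j mod ?n"
    and xs_edge: "\<And>i j. {xs i, xs (i + 1)} = {xs j, xs (j + 1)} \<Longrightarrow> i mod ?n = j mod ?n"
    using cycle_index_edges[OF dc(2,1)] unfolding xs_def by blast+
  have xs_leaf: "xs i \<in> leaves V F" for i using c(2) pos by (simp add: xs_def flip: c(2))
  have xs_per: "xs (i + ?n) = xs i" for i by (simp add: xs_def)
  \<comment> \<open>The shift by two gives the two preceding vertices of the cycle nonnegative
    indices.\<close>
  have leaf_xs: "\<exists>k. x = xs (k + 2)" if x: "x \<in> leaves V F" for x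
  proof -
    obtain i where "i < ?n" "x = c ! i" using x c(2) by (metis in_set_conv_nth)
    then have "x = xs (i + ?n)" by (simp add: xs_def)
    moreover have "i + ?n = (i + ?n - 2) + 2" using dc by simp
    ultimately have "x = xs ((i + ?n - 2) + 2)" by simp
    then show ?thesis by blast
  qed
  have sub: "leaves V F \<subseteq> V" by (auto simp: leaves_def)
  have xs_ne: "xs i \<noteq> xs (i + 1)" for i
  proof
    assume "xs i = xs (i + 1)"
    then have "i mod ?n = (i + 1) mod ?n" using xs_inj by blast
    then have "?n dvd (i + 1) - i" using mod_eq_dvd_iff_nat[of i "i + 1" ?n] by simp
    then show False using dc(2) by simp
  qed
  have G: "simple_graph V E"
    using GF xs_leaf sub xs_ne unfolding simple_graph_def E ce by (auto simp: card_insert_if)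
  have FE: "F \<subseteq> E" using E by blast
  have finN: "finite (nbhd F v)" for v by (rule finite_nbhd[OF GF])
  have degE: "degree E v \<le> \<Delta>" if "v \<in> V" for v
    unfolding \<Delta>_def max_degree_def using G that by (intro Max_ge) (auto simp: simple_graph_def)
  have degF: "degree F v \<le> \<Delta>" for v
  proof (cases "v \<in> V")
    case True
    have "degree F v \<le> degree E v"
      unfolding degree_def using finite_edges[OF G] FE by (intro card_mono) auto
    then show ?thesis using degE[OF True] by simp
  next
    case False
    then have "nbhd F v = {}" using simple_graph_edgeD[OF GF] by (auto simp: nbhd_iff)
    then show ?thesis by (simp add: degree_eq_card_nbhd[OF GF])
  qed
  have leaf_deg: "degree E x \<le> 3" if "x \<in> leaves V F" for x
  proof -
    have "nbhd E x = nbhd F x \<union> {y. {x, y} \<in> set (cycle_edges c)}" unfolding E by (auto simp: nbhd_def)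
    then have "card (nbhd E x) \<le> card (nbhd F x) + card {y. {x, y} \<in> set (cycle_edges c)}"
      using card_Un_le by metis
    moreover have "card (nbhd F x) = 1" using that by (simp add: leaves_def degree_eq_card_nbhd[OF GF])
    ultimately show ?thesis using cycle_nbhd_card(2)[OF dc(1), of x]
      by (simp add: degree_eq_card_nbhd[OF G])
  qed
  have NF: "{v, w} \<in> F" if "v \<in> ?N" "{v, w} \<in> E" for v w
  proof -
    have "{v, w} \<notin> set (cycle_edges c)" using that xs_leaf unfolding ce by (auto simp: doubleton_eq_iff)
    then show ?thesis using that E by blast
  qed
  obtain r where r: "r \<in> V" "degree E r = \<Delta>"
  proof -
    have "V \<noteq> {}" using sub xs_leaf by blast
    then have "Max (degree E ` V) \<in> degree E ` V" using G
      by (intro Max_in) (auto simp: simple_graph_def)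
    then show thesis using that by (auto simp: \<Delta>_def max_degree_def)
  qed
  have rN: "r \<in> ?N" using r leaf_deg \<Delta>13 by fastforce
  have n13: "13 \<le> ?n"
  proof -
    have "nbhd E r \<subseteq> nbhd F r" using NF[OF rN] by (auto simp: nbhd_iff)
    then have "degree E r \<le> degree F r"
      using card_mono[OF finN] by (simp add: degree_eq_card_nbhd[OF G] degree_eq_card_nbhd[OF GF])
    also have "\<dots> \<le> card (leaves V F)" by (rule leaves_ge_degree[OF T rN])
    also have "\<dots> = ?n" using c(2) dc(1) distinct_card by metis
    finally show ?thesis using r \<Delta>13 by simp
  qed
  define S where "S x y \<longleftrightarrow> {x, y} \<in> set (cycle_edges c)" for x y
  have S_xs: "S (xs i) (xs (i + 1))" for i unfolding S_def ce by blast
  have S_leaf: "x \<in> leaves V F" if xy: "S x y" for x y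
  proof -
    obtain i where "{x, y} = {xs i, xs (i + 1)}" using xy unfolding S_def ce by blast
    then have "x = xs i \<or> x = xs (i + 1)" by (auto simp: doubleton_eq_iff)
    then show ?thesis using xs_leaf by blast
  qed
  have "\<exists>\<phi> f. tree_coloring F S h L ?N \<phi> f"
  proof (rule tree_coloring_exists[OF T rN degF h(1)])
    show "finite (L e) \<and> \<Delta> + h \<le> card (L e)" if "e \<in> F" for e using L FE that by blast
    show "S y x" if "S x y" for x y using that by (simp add: S_def insert_commute)
    show "\<not> S x x" for x using simple_graph_edgeD(1)[OF G, of x x] E by (auto simp: S_def)
    show "finite {y. S x y} \<and> card {y. S x y} \<le> 2" for x
      using cycle_nbhd_card[OF dc(1), of x] by (simp add: S_def)
    show "x \<in> leaves V F" if "S x y" for x y using S_leaf that .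
    show "3 \<le> card {z \<in> nbhd F m. \<forall>y. S z y \<longrightarrow> y \<in> nbhd F m}"
      if "m \<in> ?N" "\<Delta> \<le> degree F m + 1" for m
      by (rule inner_runs[OF T G FE c pe fr that(1)]) (use that(2) \<Delta>13 S_leaf in \<open>auto simp: S_def\<close>)
  qed
  then obtain \<phi> f where col: "tree_coloring F S h L ?N \<phi> f" by blast
  \<comment> \<open>With all inner vertices treated, the partial coloring covers every tree
    edge.\<close>
  have meets: "e \<inter> ?N \<noteq> {}" if e: "e \<in> F" for e
  proof -
    obtain a b where ab: "e = {a, b}" "a \<in> V"
      using e GF unfolding simple_graph_def by (metis card_2_iff insert_subset)
    show ?thesis
    proof (cases "a \<in> leaves V F")
      case True
      then have "b \<in> ?N" using leaf_nbr_inner[OF T rN True] e ab by blast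
      then show ?thesis using ab by blast
    next
      case False then show ?thesis using ab by blast
    qed
  qed
  have cL: "\<phi> e \<in> L e" if "e \<in> F" for e using tree_coloringD(1)[OF col that meets[OF that]] .
  have cP: "\<phi> e \<noteq> \<phi> e'" if "e \<in> F" "e' \<in> F" "e \<noteq> e'" "e \<inter> e' \<noteq> {}" for e e'
    using tree_coloringD(2)[OF col that(1,2) meets[OF that(1)] meets[OF that(2)] that(3,4)] .
  note cI = tree_coloringD(3,4)[OF col] and cB = tree_coloringD(5)[OF col] and cS = tree_coloringD(6)[OF col]
  define par where "par x = (THE u. nbhd F x = {u})" for x
  have par: "nbhd F x = {par x}" "par x \<in> ?N" "{par x, x} \<in> F" if "x \<in> leaves V F" for x
  proof -
    have "card (nbhd F x) = 1" using that by (simp add: leaves_def degree_eq_card_nbhd[OF GF])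
    then obtain u where u: "nbhd F x = {u}" by (auto simp: card_1_singleton_iff)
    then have pu: "par x = u" unfolding par_def by auto
    then show "nbhd F x = {par x}" using u by simp
    have xu: "{x, u} \<in> F" using u by (auto simp: nbhd_def)
    then show "{par x, x} \<in> F" using pu by (simp add: insert_commute)
    show "par x \<in> ?N" using leaf_nbr_inner[OF T rN that xu] pu by simp
  qed
  define t where "t x = \<phi> {par x, x}" for x
  \<comment> \<open>What the tournament at the parent forbids on further edges at the leaf
    \<open>x\<close>. In \<open>tree_coloring\<close> this is demanded of tree edges at inner
    vertices only; here it is extended to cycle edges.\<close>
  define bad where "bad x = (\<lambda>r. \<phi> {par x, r}) ` {r \<in> nbhd F (par x). beats h (f (par x) x) (f (par x) r)}" for x
  have bad: "finite (bad x)" "card (bad x) \<le> h" if "x \<in> leaves V F" for x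
  proof -
    let ?R = "{r \<in> nbhd F (par x). beats h (f (par x) x) (f (par x) r)}"
    have "x \<in> nbhd F (par x)" using par(3)[OF that] by (simp add: nbhd_iff)
    then have "f (par x) x \<le> 2 * h" using cI(2)[OF par(2)[OF that]] by blast
    then have "card ?R \<le> h"
      by (intro card_labels_le[OF cI[OF par(2)[OF that]] finN] card_beats_out)
    then show "finite (bad x)" "card (bad x) \<le> h"
      unfolding bad_def using finN[of "par x"] card_image_le[of ?R "\<lambda>r. \<phi> {par x, r}"] by auto
  qed
  \<comment> \<open>The four tree edges are those at the two ends, for properness, and at the leaf
    before and the leaf after, for walks centered at a leaf. The index \<open>i + (?n - 1)\<close>
    stands for \<open>i - 1\<close>.\<close>
  define B where "B i = bad (xs i) \<union> bad (xs (i + 1)) \<union> {t (xs (i + (?n - 1))), t (xs i), t (xs (i + 1)), t (xs (i + 2))}" for i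
  have B: "finite (B i)" "card (B i) \<le> 2 * h + 4" for i
  proof -
    show "finite (B i)" unfolding B_def using bad(1) xs_leaf by simp
    have "card (B i) \<le> card (bad (xs i) \<union> bad (xs (i + 1))) + card {t (xs (i + (?n - 1))), t (xs i), t (xs (i + 1)), t (xs (i + 2))}"
      unfolding B_def by (rule card_Un_le)
    also have "card (bad (xs i) \<union> bad (xs (i + 1))) \<le> card (bad (xs i)) + card (bad (xs (i + 1)))"
      by (rule card_Un_le)
    also have "card (bad (xs i)) \<le> h" using bad xs_leaf by simp
    also have "card (bad (xs (i + 1))) \<le> h" using bad xs_leaf by simp
    also have "card {t (xs (i + (?n - 1))), t (xs i), t (xs (i + 1)), t (xs (i + 2))} \<le> 4"
      using card_length[of "[t (xs (i + (?n - 1))), t (xs i), t (xs (i + 1)), t (xs (i + 2))]"] by simp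
    finally show "card (B i) \<le> 2 * h + 4" by simp
  qed
  define M where "M i = L {xs i, xs (i + 1)} - B i" for i
  have "\<exists>g. (\<forall>i. g (i + ?n) = g i) \<and> (\<forall>i. g i \<in> M i) \<and> star_periodic g"
  proof (rule cycle_list_coloring)
    show "6 \<le> ?n" using n13 by simp
    show "3 \<le> card (M i)" for i
    proof -
      have "{xs i, xs (i + 1)} \<in> E" unfolding E ce by blast
      then have "\<Delta> + h \<le> card (L {xs i, xs (i + 1)})" using L by blast
      then show ?thesis
        unfolding M_def using diff_card_le_card_Diff[OF B(1)[of i], of
          "L {xs i, xs (i + 1)}"] B(2)[of i] h(2)
        by linarith
    qed
    have sh: "xs (i + ?n + k) = xs (i + k)" for i k using xs_per[of "i + k"]
      by (simp add: algebra_simps)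
    show "M (i + ?n) = M i" for i
      unfolding M_def B_def by (simp only: sh xs_per)
  qed
  then obtain g where g_per: "\<And>i. g (i + ?n) = g i" and gM: "\<And>i. g i \<in> M i" and g_star:
    "star_periodic g" by blast
  define \<psi> where "\<psi> e = (if e \<in> F then \<phi> e else g (SOME i. e = {xs i, xs (i + 1)}))" for e
  have \<psi>F: "\<psi> e = \<phi> e" if "e \<in> F" for e using that by (simp add: \<psi>_def)
  \<comment> \<open>The index picked by \<open>SOME\<close> is determined only modulo the length,
    which is enough because \<open>g\<close> is periodic.\<close>
  have \<psi>C: "\<psi> {xs i, xs (i + 1)} = g i" for i
  proof -
    have "{xs i, xs (i + 1)} \<notin> F" using meets[of "{xs i, xs (i + 1)}"] xs_leaf by auto
    moreover define j where "j = (SOME j. {xs i, xs (i + 1)} = {xs j, xs (j + 1)})"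
    have "{xs i, xs (i + 1)} = {xs j, xs (j + 1)}" unfolding j_def by (rule someI[of _ i]) simp
    then have "i mod ?n = j mod ?n" by (rule xs_edge)
    then have "g i = g j" using periodic_mod[of g ?n, OF g_per] by metis
    ultimately show ?thesis by (simp add: \<psi>_def j_def)
  qed
  have \<psi>C': "\<psi> {xs (i + 1), xs i} = g i" for i using \<psi>C[of i] by (simp add: insert_commute)
  have g_t: "g i \<noteq> t (xs i)" "g i \<noteq> t (xs (i + 1))" "g i \<noteq> t (xs (i + 2))" "g (i + 1) \<noteq> t (xs i)" for i
  proof -
    show "g i \<noteq> t (xs i)" "g i \<noteq> t (xs (i + 1))" "g i \<noteq> t (xs (i + 2))" using gM[of i]
      by (auto simp: M_def B_def)
    have "i + 1 + (?n - 1) = i + ?n" using pos by simp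
    then have "xs (i + 1 + (?n - 1)) = xs i" using xs_per[of i] by metis
    moreover have "g (i + 1) \<noteq> t (xs (i + 1 + (?n - 1)))" using gM[of "i + 1"] unfolding M_def B_def
      by blast
    ultimately show "g (i + 1) \<noteq> t (xs i)" by metis
  qed
  have g_bad: "g i \<notin> bad (xs i)" "g i \<notin> bad (xs (i + 1))" for i using gM[of i]
    by (auto simp: M_def B_def)
  have t_ne: "t (xs i) \<noteq> t (xs (i + 1))" for i
    unfolding t_def by (rule cS[OF par(2)[OF xs_leaf] par(2)[OF xs_leaf] S_xs par(3)[OF xs_leaf] par(3)[OF xs_leaf]])
  have \<psi>t: "\<psi> {xs i, par (xs i)} = t (xs i)" "\<psi> {par (xs i), xs i} = t (xs i)" for i
    using \<psi>F[OF par(3)[OF xs_leaf[of i]]] by (simp_all add: t_def insert_commute)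
  have nbrs: "w = par (xs (i + 1)) \<or> w = xs i \<or> w = xs (i + 2)" if w: "{xs (i + 1), w} \<in> E" for w i
  proof (cases "{xs (i + 1), w} \<in> F")
    case True
    then have "w \<in> nbhd F (xs (i + 1))" by (simp add: nbhd_iff)
    then show ?thesis using par(1)[OF xs_leaf] by auto
  next
    case False
    then obtain j where j: "{xs (i + 1), w} = {xs j, xs (j + 1)}" using w unfolding E ce by blast
    then consider "xs (i + 1) = xs j" "w = xs (j + 1)" | "xs (i + 1) = xs (j + 1)" "w = xs j"
      by (auto simp: doubleton_eq_iff)
    then show ?thesis
    proof cases
      case 1
      then have "(i + 1) mod ?n = j mod ?n" using xs_inj by blast
      then have "(i + 2) mod ?n = (j + 1) mod ?n" by (metis add.assoc mod_add_left_eq one_add_one)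
      then show ?thesis using xs_inj[of "i + 2" "j + 1"] 1 by simp
    next
      case 2
      then have "(i + 1) mod ?n = (j + 1) mod ?n" using xs_inj by blast
      then have "(i + 1 + (?n - 1)) mod ?n = (j + 1 + (?n - 1)) mod ?n" by (metis mod_add_left_eq)
      then have "i mod ?n = j mod ?n" using pos by simp
      then show ?thesis using xs_inj[of i j] 2 by simp
    qed
  qed
  show "\<exists>\<psi>. star_edge_coloring V E \<psi> \<and> (\<forall>e\<in>E. \<psi> e \<in> L e)"
  proof (intro exI[of _ \<psi>] conjI ballI)
    fix e assume "e \<in> E"
    then consider "e \<in> F" | i where "e = {xs i, xs (i + 1)}" unfolding E ce by blast
    then show "\<psi> e \<in> L e"
    proof cases
      case 1 then show ?thesis using \<psi>F cL by simp
    next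
      case 2 then show ?thesis using \<psi>C[of i] gM[of i] by (simp add: M_def)
    qed
  next
    show "star_edge_coloring V E \<psi>"
    proof (rule star_edge_coloringI[OF G])
      fix v a b assume e: "{v, a} \<in> E" "{v, b} \<in> E" "a \<noteq> b"
      have "v \<in> V" using simple_graph_edgeD[OF G e(1)] by simp
      show "\<psi> {v, a} \<noteq> \<psi> {v, b}"
      proof (cases "v \<in> leaves V F")
        case False
        then have "{v, a} \<in> F" "{v, b} \<in> F" using NF \<open>v \<in> V\<close> e by blast+
        moreover have "{v, a} \<noteq> {v, b}" using e(3) by (auto simp: doubleton_eq_iff)
        ultimately show ?thesis using cP[of "{v, a}" "{v, b}"] \<psi>F by auto
      next
        case True
        then obtain k where k: "v = xs (k + 2)" using leaf_xs by blast
        have eq: "xs (k + 1 + 1) = xs (k + 2)" "xs (k + 1 + 2) = xs (k + 3)"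
          "xs (k + 2 + 1) = xs (k + 3)"
          by (simp_all add: eval_nat_numeral)
        have col: "\<psi> {v, par v} = t (xs (k + 2))" "\<psi> {v, xs (k + 1)} = g (k + 1)"
          "\<psi> {v, xs (k + 3)} = g (k + 2)"
          using \<psi>t(1)[of "k + 2"] \<psi>C'[of "k + 1"] \<psi>C[of "k + 2"] k eq by simp_all
        have ne: "t (xs (k + 2)) \<noteq> g (k + 1)" "t (xs (k + 2)) \<noteq> g (k + 2)" "g (k + 1) \<noteq> g (k + 2)"
          using g_t(2)[of "k + 1"] g_t(1)[of
            "k + 2"] g_star[unfolded star_periodic_def, THEN conjunct1, THEN spec, of "k + 1"] eq
          by (simp_all add: eval_nat_numeral)
        have "w = par v \<or> w = xs (k + 1) \<or> w = xs (k + 3)" if "{v, w} \<in> E" for w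
          using nbrs[of "k + 1" w] that k eq by simp
        from this[OF e(1)] this[OF e(2)] show ?thesis using col ne e(3) by metis
      qed
    next
      fix v0 v1 v2 v3 v4
      assume e: "{v0, v1} \<in> E" "{v1, v2} \<in> E" "{v2, v3} \<in> E" "{v3, v4} \<in> E"
        and ne: "v0 \<noteq> v2" "v1 \<noteq> v3" "v2 \<noteq> v4"
        and eq: "\<psi> {v0, v1} = \<psi> {v2, v3}" "\<psi> {v1, v2} = \<psi> {v3, v4}"
      have v2V: "v2 \<in> V" using simple_graph_edgeD[OF G e(2)] by simp
      show False
      proof (cases "v2 \<in> leaves V F")
        case False
        then have v2: "v2 \<in> ?N" using v2V by blast
        have "{v2, v1} \<in> E" using e(2) by (simp add: insert_commute)
        from NF[OF v2 this] NF[OF v2 e(3)] have F: "{v2, v1} \<in> F" "{v2, v3} \<in> F" .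
        \<comment> \<open>An edge beyond \<open>l\<close> with the color of \<open>{v2, r}\<close>
          rules out that \<open>l\<close> beats \<open>r\<close>. The walk supplies this in both
          directions, contradicting totality of the tournament.\<close>
        have not_beats: "\<not> beats h (f v2 l) (f v2 r)"
          if a: "{v2, l} \<in> F" "{v2, r} \<in> F" "{k, l} \<in> E" "k \<noteq> v2" "\<psi> {k, l} = \<psi> {v2, r}" for l r k
        proof
          assume b: "beats h (f v2 l) (f v2 r)"
          have rn: "r \<in> nbhd F v2" using a by (simp add: nbhd_iff)
          have kl: "{k, l} \<noteq> {v2, l}" using a(4) by (auto simp: doubleton_eq_iff)
          show False
          proof (cases "l \<in> leaves V F")
            case True
            then have "v2 \<in> nbhd F l" using a(1) by (simp add: nbhd_iff insert_commute)
            then have p: "par l = v2" using par(1)[OF True] by simp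
            have "\<phi> {v2, r} \<in> bad l" unfolding bad_def p using rn b by blast
            moreover have "\<psi> {k, l} \<notin> bad l"
            proof -
              have "{k, l} \<notin> F"
              proof
                assume "{k, l} \<in> F"
                then have "k \<in> nbhd F l" by (simp add: nbhd_iff insert_commute)
                then show False using par(1)[OF True] p a(4) by simp
              qed
              then obtain i where i: "{k, l} = {xs i, xs (i + 1)}" using a(3) unfolding E ce by blast
              then have "l = xs i \<or> l = xs (i + 1)" by (auto simp: doubleton_eq_iff)
              then show ?thesis using \<psi>C[of i] g_bad[of i] i by auto
            qed
            ultimately show False using a(5) \<psi>F[OF a(2)] by simp
          next
            case False
            have "l \<in> V" using simple_graph_edgeD[OF GF a(1)] by simp
            then have l: "l \<in> ?N" using False by simp
            then have "{k, l} \<in> F" using NF[OF l, of k] a(3) by (simp add: insert_commute)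
            then show False using cB[OF v2 l a(1) rn b, of "{k, l}"] kl a(5) \<psi>F[OF a(2)] \<psi>F[of
              "{k, l}"] by simp
          qed
        qed
        have "\<not> beats h (f v2 v1) (f v2 v3)" by (rule not_beats[OF F e(1) ne(1) eq(1)])
        moreover have "\<not> beats h (f v2 v3) (f v2 v1)"
          by (rule not_beats[OF F(2,1), of v4]) (use e(4) ne(3) eq(2) in \<open>simp_all add: insert_commute\<close>)
        moreover have "f v2 v1 \<noteq> f v2 v3"
          using cI(1)[OF v2] F ne(2) by (simp add: inj_on_eq_iff nbhd_iff)
        ultimately show False using beats_total by blast
      next
        case True
        then obtain k where k: "v2 = xs (k + 2)" using leaf_xs by blast
        have ar: "k + 1 + 1 = k + 2" "k + 1 + 2 = k + 3" "k + 2 + 1 = k + 3" "k + 2 + 2 = k + 4"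
          "k + 3 + 1 = k + 4"
          by simp_all
        have n2: "w = par v2 \<or> w = xs (k + 1) \<or> w = xs (k + 3)" if "{v2, w} \<in> E" for w
          using nbrs[of "k + 1" w, unfolded ar] that k by simp
        have n1: "w = par (xs (k + 1)) \<or> w = xs k" if "{xs (k + 1), w} \<in> E" "w \<noteq> v2" for w
          using nbrs[of k w] that k by blast
        have n3: "w = par (xs (k + 3)) \<or> w = xs (k + 4)" if "{xs (k + 3), w} \<in> E" "w \<noteq> v2" for w
          using nbrs[of "k + 2" w, unfolded ar] that k by blast
        note star = g_star[unfolded star_periodic_def, THEN conjunct2, THEN spec, THEN mp, of k]
        \<comment> \<open>Both middle edges lie on the cycle. An end at a parent would be a tree
          edge one leaf away from the cycle edge of its color; so all four edges lie on the cycle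
          and \<open>star_periodic\<close> applies.\<close>
        have both: False if a: "v1 = xs (k + 1)" "v3 = xs (k + 3)" "{v0, v1} \<in> E" "{v3, v4} \<in> E"
          "v0 \<noteq> v2" "v4 \<noteq> v2"
          "\<psi> {v0, v1} = \<psi> {v2, v3}" "\<psi> {v1, v2} = \<psi> {v3, v4}" for v0 v1 v3 v4
        proof -
          have c23: "\<psi> {v2, v3} = g (k + 2)" "\<psi> {v1, v2} = g (k + 1)"
            using \<psi>C[of "k + 2", unfolded ar] \<psi>C[of "k + 1", unfolded ar] a k ar by simp_all
          have "v0 \<noteq> par (xs (k + 1))"
            using \<psi>t(2)[of "k + 1"] g_t(4)[of "k + 1", unfolded ar] a c23 ar by auto
          then have "v0 = xs k" using n1[of v0] a by (auto simp: insert_commute)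
          then have 1: "g k = g (k + 2)" using \<psi>C[of k] a c23 by simp
          have "v4 \<noteq> par (xs (k + 3))"
            using \<psi>t(1)[of "k + 3"] g_t(3)[of "k + 1", unfolded ar] a c23 ar by auto
          then have "v4 = xs (k + 4)" using n3[of v4] a by auto
          then have "g (k + 1) = g (k + 3)" using \<psi>C[of "k + 3", unfolded ar] a c23 ar by simp
          then show False using star[OF 1] by simp
        qed
        \<comment> \<open>One middle edge is the parent edge of \<open>v2\<close>. The coincidence
          of its color with that of \<open>{v3, v4}\<close> is already impossible, so the other end
          of the walk is not examined.\<close>
        have par1: False if a: "v1 = par v2" "v3 = xs (k + 1) \<or> v3 = xs (k + 3)" "{v3, v4} \<in> E"
          "v4 \<noteq> v2"
          "\<psi> {v1, v2} = \<psi> {v3, v4}" for v1 v3 v4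
        proof -
          have tt: "\<psi> {v3, v4} = t (xs (k + 2))" using \<psi>t(2)[of "k + 2"] a k by simp
          show False
          proof (cases "v3 = xs (k + 1)")
            case True
            then consider "v4 = par (xs (k + 1))" | "v4 = xs k" using n1[of v4] a by blast
            then show False
            proof cases
              case 1
              then show False using tt \<psi>t(1)[of "k + 1"] t_ne[of "k + 1", unfolded ar] True ar by simp
            next
              case 2
              then show False using tt \<psi>C'[of k] g_t(3)[of k] True by simp
            qed
          next
            case False
            then have v3: "v3 = xs (k + 3)" using a by simp
            then consider "v4 = par (xs (k + 3))" | "v4 = xs (k + 4)" using n3[of v4] a by blast
            then show False
            proof cases
              case 1
              then show False using tt \<psi>t(1)[of "k + 3"] t_ne[of "k + 2", unfolded ar] v3 ar by simp
            next
              case 2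
              then show False using tt \<psi>C[of "k + 3", unfolded ar] g_t(4)[of
                "k + 2", unfolded ar] v3 ar by simp
            qed
          qed
        qed
        have e': "{v2, v1} \<in> E" "{v1, v0} \<in> E" "{v4, v3} \<in> E" using e by (simp_all add: insert_commute)
        have eq': "\<psi> {v4, v3} = \<psi> {v2, v1}" "\<psi> {v3, v2} = \<psi> {v1, v0}" using eq
          by (simp_all add: insert_commute)
        from n2[OF e'(1)] n2[OF e(3)] ne(2)
        consider "v1 = par v2" "v3 = xs (k + 1) \<or> v3 = xs (k + 3)" | "v3 = par v2"
          "v1 = xs (k + 1) \<or> v1 = xs (k + 3)"
          | "v1 = xs (k + 1)" "v3 = xs (k + 3)" | "v1 = xs (k + 3)" "v3 = xs (k + 1)" by metis
        then show False
        proof cases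
          case 1
          show False by (rule par1[OF 1 e(4) ne(3)[symmetric] eq(2)])
        next
          case 2
          show False by (rule par1[OF 2 e'(2) ne(1) eq'(2)])
        next
          case 3
          show False by (rule both[OF 3 e(1) e(4) ne(1) ne(3)[symmetric] eq])
        next
          case 4
          show False by (rule both[OF 4(2,1) e'(3) e'(2) ne(3)[symmetric] ne(1) eq'])
        qed
      qed
    qed
  qed
qed

section \<open>Color counting and polar drawings\<close>

text \<open>Vertices are attached in increasing order. At the largest vertex of a cycle both cycle
  neighbors would be smaller, hence both equal to its parent.\<close>

lemma parent_tree:
  fixes par :: "nat \<Rightarrow> nat"
  assumes par: "\<And>v. 1 \<le> v \<Longrightarrow> v \<le> n \<Longrightarrow> par v < v"
  shows "tree {..n} ((\<lambda>v. {par v, v}) ` {1..n})"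
proof -
  let ?F = "(\<lambda>v. {par v, v}) ` {1..n}"
  have edge: "b = par a" if "{a, b} \<in> ?F" "b < a" for a b
  proof -
    obtain v where v: "v \<in> {1..n}" "{a, b} = {par v, v}" using \<open>{a, b} \<in> ?F\<close> by blast
    have "par v < v" using par v(1) by simp
    then show ?thesis using v(2) \<open>b < a\<close> by (auto simp: doubleton_eq_iff)
  qed
  have G: "simple_graph {..n} ?F"
    unfolding simple_graph_def
  proof (intro conjI ballI)
    fix e assume "e \<in> ?F"
    then obtain v where v: "v \<in> {1..n}" "e = {par v, v}" by blast
    then show "e \<subseteq> {..n}" "card e = 2" using par[of v] by auto
  qed simp
  have "graph_connected {..k} ?F" if "k \<le> n" for k
    using that
  proof (induction k)
    case 0
    have "graph_path {..0} ?F [0] \<and> hd [0] = (0::nat) \<and> last [0] = (0::nat)"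
      by (simp add: graph_path_def)
    then show ?case unfolding graph_connected_def by auto
  next
    case (Suc k)
    have p: "par (Suc k) \<in> {..k}" using par[of "Suc k"] Suc.prems by simp
    have "{par (Suc k), Suc k} \<in> ?F" using Suc.prems by auto
    from graph_connected_insert[OF _ _ p this] have "graph_connected (insert (Suc k) {..k}) ?F"
      using Suc by simp
    then show ?case by (simp add: atMost_Suc)
  qed
  then have con: "graph_connected {..n} ?F" by blast
  have "False" if c: "graph_cycle {..n} ?F c" for c
  proof -
    have l: "3 \<le> length c" and d: "distinct c" and ce: "set (cycle_edges c) \<subseteq> ?F" and "c \<noteq> []"
      using c by (auto simp: graph_cycle_def)
    define xs where "xs i = c ! (i mod length c)" for i
    have e: "set (cycle_edges c) = {{xs i, xs (i + 1)} |i. True}"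
      and inj: "\<And>i j. xs i = xs j \<longleftrightarrow> i mod length c = j mod length c"
      using cycle_index_edges[OF l d] unfolding xs_def by blast+
    have "Max (set c) \<in> set c" using \<open>c \<noteq> []\<close> by (intro Max_in) auto
    then obtain i where i: "i < length c" "c ! i = Max (set c)" by (metis in_set_conv_nth)
    \<comment> \<open>An index for the predecessor of the largest vertex, shifted by a full turn to
      stay nonnegative.\<close>
    define k where "k = i + length c - 1"
    have "k + 1 = i + length c" using l by (simp add: k_def)
    then have x: "xs (k + 1) = Max (set c)" using i by (simp add: xs_def)
    have mem: "xs j \<in> set c" for j using \<open>c \<noteq> []\<close> by (simp add: xs_def)
    have le: "xs j \<le> xs (k + 1)" for j unfolding x by (rule Max_ge[OF _ mem]) simp
    have ed: "{xs (k + 1), xs k} \<in> ?F" "{xs (k + 1), xs (k + 2)} \<in> ?F"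
    proof -
      have F: "{xs j, xs (j + 1)} \<in> ?F" for j using subsetD[OF ce] unfolding e by blast
      show "{xs (k + 1), xs k} \<in> ?F" using F[of k] by (simp only: insert_commute)
      show "{xs (k + 1), xs (k + 2)} \<in> ?F" using F[of "k + 1"] by (simp only: add.assoc one_add_one)
    qed
    have "xs k \<noteq> xs (k + 1)" "xs (k + 2) \<noteq> xs (k + 1)"
      using simple_graph_edgeD(1)[OF G ed(1)] simple_graph_edgeD(1)[OF G ed(2)] by auto
    then have "xs k < xs (k + 1)" "xs (k + 2) < xs (k + 1)" using le by (auto simp: le_less)
    then have "xs k = xs (k + 2)" using edge[OF ed(1)] edge[OF ed(2)] by simp
    then have "k mod length c = (k + 2) mod length c" using inj by blast
    then have "length c dvd (k + 2) - k" using mod_eq_dvd_iff_nat[of k "k + 2" "length c"] by simp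
    then show False using l by (auto dest: dvd_imp_le)
  qed
  then show ?thesis using G con by (auto simp: tree_def)
qed

text \<open>The counterpart of the tournament: \<open>R\<close> records that \<open>u\<close> reuses
  the color of the edge from \<open>v\<close> to \<open>w\<close>, and a star coloring makes
  \<open>R\<close> asymmetric. Averaging gives a vertex \<open>u\<close> with few reused colors; the
  edges at \<open>v\<close> and at \<open>u\<close> then show many colors.\<close>

lemma star_coloring_color_count:
  fixes \<phi> :: "'v set \<Rightarrow> nat"
  assumes G: "simple_graph V E" and v: "card (nbhd E v) = d" "0 < d"
    and u: "\<And>u. u \<in> nbhd E v \<Longrightarrow> card (nbhd E u) = d"
    and uu: "\<And>u u'. \<lbrakk>u \<in> nbhd E v; u' \<in> nbhd E v; u \<noteq> u'\<rbrakk> \<Longrightarrow> nbhd E u \<inter> nbhd E u' = {v} \<and> u \<notin> nbhd E u'"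
    and col: "star_edge_coloring V E \<phi>" and C: "\<And>e. e \<in> E \<Longrightarrow> \<phi> e \<in> C" "finite C"
  shows "d + d div 2 \<le> card C"
proof -
  let ?U = "nbhd E v"
  have fin: "finite (nbhd E x)" for x by (rule finite_nbhd[OF G])
  have adj: "\<phi> {x, a} \<noteq> \<phi> {x, b}" if "{x, a} \<in> E" "{x, b} \<in> E" "a \<noteq> b" for x a b
  proof -
    have "{x, a} \<noteq> {x, b}" using that(3) by (auto simp: doubleton_eq_iff)
    moreover have pc: "\<forall>e\<in>E. \<forall>f\<in>E. e \<noteq> f \<and> e \<inter> f \<noteq> {} \<longrightarrow> \<phi> e \<noteq> \<phi> f"
      using col by (simp add: star_edge_coloring_def proper_edge_coloring_def)
    ultimately show ?thesis using bspec[OF bspec[OF pc that(1)] that(2)] by simp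
  qed
  define a where "a u = \<phi> {v, u}" for u
  define S where "S u = (\<lambda>x. \<phi> {u, x}) ` (nbhd E u - {v})" for u
  define R where "R = {(u, w). u \<in> ?U \<and> w \<in> ?U \<and> u \<noteq> w \<and> a w \<in> S u}"
  have vU: "v \<in> nbhd E u" "{v, u} \<in> E" "u \<noteq> v" if uv: "u \<in> ?U" for u
  proof -
    show vu: "{v, u} \<in> E" using uv by (simp add: nbhd_iff)
    show "v \<in> nbhd E u" using vu by (simp add: nbhd_iff insert_commute)
    show "u \<noteq> v" using simple_graph_edgeD(1)[OF G vu] by simp
  qed
  have a_inj: "inj_on a ?U" 
  proof (rule inj_onI, rule ccontr)
    fix x y assume "x \<in> ?U" "y \<in> ?U" "a x = a y" "x \<noteq> y"
    then show False using adj[of v x y] by (simp add: a_def nbhd_iff)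
  qed
  have asym: "(w, u) \<notin> R" if "(u, w) \<in> R" for u w
  proof
    assume "(w, u) \<in> R"
    then obtain x y where x: "x \<in> nbhd E u" "x \<noteq> v" "a w = \<phi> {u, x}"
      and y: "y \<in> nbhd E w" "y \<noteq> v" "a u = \<phi> {w, y}"
      using \<open>(u, w) \<in> R\<close> by (auto simp: R_def S_def)
    have uw: "u \<in> ?U" "w \<in> ?U" "u \<noteq> w" using \<open>(u, w) \<in> R\<close> by (auto simp: R_def)
    \<comment> \<open>The distance conditions in \<open>uu\<close> make the five vertices
      \<open>x\<close>, \<open>u\<close>, \<open>v\<close>, \<open>w\<close>, \<open>y\<close>
      distinct, as a path requires.\<close>
    have ne: "x \<noteq> y" "x \<noteq> w" "y \<noteq> u"
    proof -
      have "nbhd E u \<inter> nbhd E w = {v}" "u \<notin> nbhd E w" using uu[OF uw] by simp_all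
      moreover have "w \<notin> nbhd E u" using uu[OF uw(2,1)] uw(3) by simp
      ultimately show "x \<noteq> y" "x \<noteq> w" "y \<noteq> u" using x(1,2) y(1) by blast+
    qed
    have xy: "{u, x} \<in> E" "{w, y} \<in> E" using x(1) y(1) by (simp_all add: nbhd_iff)
    have xy': "x \<noteq> u" "y \<noteq> w"
      using simple_graph_edgeD(1)[OF G xy(1)] simple_graph_edgeD(1)[OF G xy(2)] by simp_all
    have inV: "u \<in> V" "x \<in> V" "w \<in> V" "y \<in> V" "v \<in> V"
      using simple_graph_edgeD(2,3)[OF G xy(1)] simple_graph_edgeD(2,3)[OF G xy(2)]
        simple_graph_edgeD(2)[OF G vU(2)[OF uw(1)]] by simp_all
    have "graph_path V E [x, u, v, w, y]"
      using ne xy xy' x(2) y(2) uw(3) inV vU(2,3)[OF uw(1)] vU(2,3)[OF uw(2)]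
      unfolding graph_path_def by (simp add: insert_commute)
    moreover have "bichromatic \<phi> (set (walk_edges [x, u, v, w, y]))"
    proof -
      have "a u \<noteq> a w" using inj_onD[OF a_inj _ uw(1,2)] uw(3) by blast
      moreover have "\<phi> ` set (walk_edges [x, u, v, w, y]) = {a u, a w}"
      proof -
        have "\<phi> {x, u} = a w" "\<phi> {u, v} = a u" "\<phi> {v, w} = a w" "\<phi> {w, y} = a u"
          unfolding x(3) y(3) by (simp_all only: insert_commute x(3)[unfolded a_def] y(3)[symmetric] a_def)
        then show ?thesis by auto
      qed
      ultimately show ?thesis by (simp add: bichromatic_def)
    qed
    moreover have "\<forall>p. graph_path V E p \<and> length p = 5 \<longrightarrow> \<not> bichromatic \<phi> (set (walk_edges p))"
      using col by (simp add: star_edge_coloring_def)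
    from spec[OF this, of "[x, u, v, w, y]"] have
      "graph_path V E [x, u, v, w, y] \<longrightarrow> \<not> bichromatic \<phi> (set (walk_edges [x, u, v, w, y]))"
      by simp
    ultimately show False by blast
  qed
  have "2 * card R \<le> d * (d - 1)"
  proof -
    have fR: "finite R" using fin by (auto simp: R_def intro: finite_subset[of _ "?U \<times> ?U"])
    have "card (R \<union> R\<inverse>) = card R + card (R\<inverse>)"
      using asym fR by (intro card_Un_disjoint) auto
    moreover have "card (R\<inverse>) = card R" by (simp add: card_inverse)
    moreover have "card (R \<union> R\<inverse>) \<le> card (?U \<times> ?U - (\<lambda>x. (x, x)) ` ?U)"
      using fin by (intro card_mono) (auto simp: R_def)
    moreover have "card (?U \<times> ?U - (\<lambda>x. (x, x)) ` ?U) = d * d - d"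
      using fin v by (subst card_Diff_subset) (auto simp: card_cartesian_product card_image inj_on_def)
    ultimately show ?thesis by (simp add: diff_mult_distrib2)
  qed
  moreover have "card R = (\<Sum>u\<in>?U. card {w. (u, w) \<in> R})"
  proof -
    have "R = (SIGMA u:?U. {w. (u, w) \<in> R})" by (auto simp: R_def)
    moreover have "finite {w. (u, w) \<in> R}" for u using fin[of v] by (auto simp: R_def)
    ultimately show ?thesis using card_SigmaI[OF fin] by metis
  qed
  ultimately have sum: "(\<Sum>u\<in>?U. 2 * card {w. (u, w) \<in> R}) \<le> d * (d - 1)"
    by (simp add: sum_distrib_left)
  obtain u where uU: "u \<in> ?U" and ur: "2 * card {w. (u, w) \<in> R} \<le> d - 1"
  proof (rule ccontr)
    assume "\<not> thesis"
    then have "\<forall>u\<in>?U. d - 1 < 2 * card {w. (u, w) \<in> R}" using that by (meson not_le)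
    moreover have "?U \<noteq> {}" using v by auto
    ultimately have "(\<Sum>u\<in>?U. d - 1) < (\<Sum>u\<in>?U. 2 * card {w. (u, w) \<in> R})"
      using fin by (intro sum_strict_mono) auto
    then show False using sum v by simp
  qed
  have cS: "card (S u) = d - 1"
  proof -
    have "inj_on (\<lambda>x. \<phi> {u, x}) (nbhd E u - {v})"
    proof (rule inj_onI, rule ccontr)
      fix x y assume "x \<in> nbhd E u - {v}" "y \<in> nbhd E u - {v}" "\<phi> {u, x} = \<phi> {u, y}" "x \<noteq> y"
      then show False using adj[of u x y] by (simp add: nbhd_iff)
    qed
    then have "card (S u) = card (nbhd E u - {v})" unfolding S_def by (rule card_image)
    then show ?thesis using vU(1)[OF uU] u[OF uU] fin by simp
  qed
  have "a ` ?U \<inter> S u = a ` {w. (u, w) \<in> R}"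
  proof -
    have "a u \<notin> S u"
    proof
      assume "a u \<in> S u"
      then obtain x where x: "x \<in> nbhd E u" "x \<noteq> v" "a u = \<phi> {u, x}" unfolding S_def by blast
      have "{u, v} \<in> E" "{u, x} \<in> E" using vU(1)[OF uU] x(1) by (simp_all add: nbhd_iff)
      then have "\<phi> {u, v} \<noteq> \<phi> {u, x}" using adj x(2) by metis
      then show False using x(3) by (simp add: a_def insert_commute)
    qed
    then show ?thesis using uU unfolding R_def by blast
  qed
  moreover have "finite {w. (u, w) \<in> R}" using fin[of v] by (simp add: R_def)
  ultimately have "card (a ` ?U \<inter> S u) \<le> card {w. (u, w) \<in> R}" using card_image_le by metis
  moreover have "card (a ` ?U) = d" using a_inj v by (simp add: card_image)
  moreover have "card (a ` ?U) + card (S u) = card (a ` ?U \<union> S u) + card (a ` ?U \<inter> S u)"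
    using fin by (intro card_Un_Int) (auto simp: S_def)
  moreover have "card (a ` ?U \<union> S u) \<le> card C"
  proof (rule card_mono[OF C(2)])
    have "a w \<in> C" if "w \<in> ?U" for w using C(1)[OF vU(2)[OF that]] by (simp add: a_def)
    moreover have "\<phi> {u, x} \<in> C" if "x \<in> nbhd E u" for x using C(1) that by (simp add: nbhd_iff)
    ultimately show "a ` ?U \<union> S u \<subseteq> C" unfolding S_def by blast
  qed
  ultimately have le: "d + (d - 1) \<le> card C + card {w. (u, w) \<in> R}" unfolding cS by linarith
  \<comment> \<open>Since \<open>q\<close> is at most \<open>(d - 1) div 2\<close>, the difference
    \<open>d - 1 - q\<close> is at least \<open>d div 2\<close>.\<close>
  define q where "q = card {w. (u, w) \<in> R}"
  have "2 * q \<le> d - 1" "d + (d - 1) \<le> card C + q" using ur le by (simp_all add: q_def)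
  then show ?thesis using v(2) by presburger
qed

section \<open>Drawings in polar coordinates\<close>

lemma plane_embeddingI:
  assumes inj: "inj_on pos V"
    and arc: "\<And>e. e \<in> E \<Longrightarrow> arc (\<gamma> e)"
    and ends: "\<And>e. e \<in> E \<Longrightarrow> {\<gamma> e 0, \<gamma> e 1} = pos ` e" and sub: "\<And>e. e \<in> E \<Longrightarrow> e \<subseteq> V"
    and vert: "\<And>e v t. \<lbrakk>e \<in> E; v \<in> V; 0 < t; t < 1\<rbrakk> \<Longrightarrow> \<gamma> e t \<noteq> pos v"
    and cross: "\<And>e f s t. \<lbrakk>e \<in> E; f \<in> E; e \<noteq> f; 0 < s; s < 1; 0 < t; t < 1\<rbrakk> \<Longrightarrow> \<gamma> e s \<noteq> \<gamma> f t"
  shows "plane_embedding V E pos \<gamma>"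
proof -
  have int: "\<exists>t. 0 < t \<and> t < 1 \<and> z = \<gamma> e t" if e: "e \<in> E" and z: "z \<in> path_image (\<gamma> e) - pos ` e"
    for e z
  proof -
    obtain t where t: "t \<in> {0..1}" "z = \<gamma> e t" using z by (auto simp: path_image_def)
    have "\<gamma> e 0 \<in> pos ` e" "\<gamma> e 1 \<in> pos ` e" using ends[OF e] by blast+
    then have "t \<noteq> 0" "t \<noteq> 1" using t(2) z by auto
    then have "0 < t" "t < 1" using t(1) by simp_all
    then show ?thesis using t(2) by blast
  qed
  show ?thesis
    unfolding plane_embedding_def
  proof (intro conjI ballI impI inj)
    fix e assume e: "e \<in> E"
    show "arc (\<gamma> e)" "{pathstart (\<gamma> e), pathfinish (\<gamma> e)} = pos ` e"
      using arc[OF e] ends[OF e] by (simp_all add: pathstart_def pathfinish_def)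
    show "(path_image (\<gamma> e) - pos ` e) \<inter> pos ` V = {}"
    proof (rule equals0I)
      fix z assume z: "z \<in> (path_image (\<gamma> e) - pos ` e) \<inter> pos ` V"
      then obtain v where v: "v \<in> V" "z = pos v" by blast
      obtain t where "0 < t" "t < 1" "z = \<gamma> e t" using int[OF e, of z] z by blast
      then show False using vert[OF e v(1)] v(2) by metis
    qed
    fix f assume f: "f \<in> E" "e \<noteq> f"
    show "(path_image (\<gamma> e) - pos ` e) \<inter> path_image (\<gamma> f) = {}"
    proof (rule ccontr)
      assume "\<not> ?thesis"
      then obtain z where z: "z \<in> path_image (\<gamma> e) - pos ` e" "z \<in> path_image (\<gamma> f)" by blast
      obtain s where s: "0 < s" "s < 1" "z = \<gamma> e s" using int[OF e z(1)] by blast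
      show False
      proof (cases "z \<in> pos ` f")
        case True
        then obtain v where "v \<in> V" "z = pos v" using sub[OF f(1)] by blast
        then show False using vert[OF e _ s(1,2)] s(3) by metis
      next
        case False
        then obtain t where "0 < t" "t < 1" "z = \<gamma> f t" using int[OF f(1), of z] z(2) by blast
        then show False using cross[OF e f s(1,2)] s(3) by metis
      qed
    qed
  qed
qed

text \<open>Angles are measured in full turns, so the period is 1 and positions on the circle become
  fractions.\<close>

definition polar :: "real \<Rightarrow> real \<Rightarrow> complex" where
  "polar r \<theta> = of_real r * cis (2 * pi * \<theta>)"

lemma norm_polar: "0 \<le> r \<Longrightarrow> norm (polar r \<theta>) = r"
  by (simp add: polar_def norm_mult)

lemma polar_eqD:
  assumes "polar r \<theta> = polar r' \<theta>'" "0 \<le> r" "0 \<le> r'"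
  shows "r = r'" "\<lbrakk>0 < r; \<bar>\<theta> - \<theta>'\<bar> < 1\<rbrakk> \<Longrightarrow> \<theta> = \<theta>'"
proof -
  show r: "r = r'" using assms norm_polar by metis
  assume "0 < r" and lt: "\<bar>\<theta> - \<theta>'\<bar> < 1"
  then have "cis (2 * pi * \<theta>) = cis (2 * pi * \<theta>')" using assms(1) r by (simp add: polar_def)
  then have "sin (2 * pi * \<theta>) = sin (2 * pi * \<theta>') \<and> cos (2 * pi * \<theta>) = cos (2 * pi * \<theta>')"
    by (simp add: complex_eq_iff)
  then obtain n :: int where n: "2 * pi * \<theta> = 2 * pi * \<theta>' + 2 * pi * n"
    using sin_cos_eq_iff by blast
  then have "2 * pi * (\<theta> - \<theta>' - n) = 0" by (simp add: algebra_simps)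
  then have "\<theta> - \<theta>' = n" by simp
  then have "\<bar>real_of_int n\<bar> < 1" using lt by simp
  then have "n = 0" by linarith
  then show "\<theta> = \<theta>'" using \<open>\<theta> - \<theta>' = n\<close> by simp
qed

lemma polar_add_one: "polar r (\<theta> + 1) = polar r \<theta>"
  by (simp add: polar_def distrib_left flip: cis_mult)

lemma arc_polar:
  assumes "continuous_on {0..1} \<rho>" "continuous_on {0..1} \<theta>" "\<And>t. t \<in> {0..1} \<Longrightarrow> 0 \<le> \<rho> t"
    and "\<And>s t. \<lbrakk>s \<in> {0..1}; t \<in> {0..1}; polar (\<rho> s) (\<theta> s) = polar (\<rho> t) (\<theta> t)\<rbrakk> \<Longrightarrow> s = t"
  shows "arc (\<lambda>t. polar (\<rho> t) (\<theta> t))"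
  unfolding arc_def path_def
proof
  show "continuous_on {0..1} (\<lambda>t. polar (\<rho> t) (\<theta> t))"
    unfolding polar_def using assms(1,2) by (intro continuous_intros)
  show "inj_on (\<lambda>t. polar (\<rho> t) (\<theta> t)) {0..1}" using assms(4) by (rule inj_onI)
qed

text \<open>As \<open>outside\<close> is antitone, the set is squeezed between the outside of the
  disc and that of the circle, and both are the complement of the closed disc.\<close>

lemma frontier_outside_disc:
  fixes D :: "complex set"
  assumes "sphere 0 1 \<subseteq> D" "D \<subseteq> cball 0 1"
  shows "frontier (outside D) = sphere 0 1"
proof -
  have "outside (cball 0 1 :: complex set) \<subseteq> outside D" by (rule outside_mono[OF assms(2)])
  moreover have "outside (cball 0 1 :: complex set) = - cball 0 1"
    by (intro outside_convex convex_cball)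
  moreover have "outside D \<subseteq> outside (sphere 0 1)" by (rule outside_mono[OF assms(1)])
  moreover have "outside (sphere 0 1 :: complex set) = - cball 0 1"
    using outside_frontier_eq_complement_closure[of "cball 0 1 :: complex set"] by simp
  ultimately have "outside D = - cball 0 1" by blast
  then show ?thesis by (simp add: frontier_complement)
qed

lemma unit_circle_polar:
  assumes "norm z = 1"
  obtains \<theta> where "0 \<le> \<theta>" "\<theta> < 1" "z = polar 1 \<theta>"
proof
  have "z = of_real (norm z) * exp (\<i> * of_real (Arg2pi z))" by (rule Arg2pi_eq)
  then show "z = polar 1 (Arg2pi z / (2 * pi))" using assms by (simp add: polar_def cis_conv_exp)
  show "0 \<le> Arg2pi z / (2 * pi)" "Arg2pi z / (2 * pi) < 1"
    using Arg2pi_ge_0[of z] Arg2pi_lt_2pi[of z] by (auto simp: field_simps)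
qed

section \<open>The tight example\<close>

text \<open>The tight example of maximum degree \<open>M + 1\<close>: the center \<open>0\<close>, its neighbors
  \<open>1, \<dots>, M + 1\<close>, and \<open>M\<close> leaves at each of them, numbered consecutively from \<open>M + 2\<close>.\<close>

definition ex_leaves :: "nat \<Rightarrow> nat" where
  "ex_leaves M = (M + 1) * M"

definition ex_parent :: "nat \<Rightarrow> nat \<Rightarrow> nat" where
  "ex_parent M v = (if v \<le> M + 1 then 0 else Suc ((v - (M + 2)) div M))"

definition ex_tree :: "nat \<Rightarrow> nat set set" where
  "ex_tree M = (\<lambda>v. {ex_parent M v, v}) ` {1..M + 1 + ex_leaves M}"

definition ex_cycle :: "nat \<Rightarrow> nat list" where
  "ex_cycle M = [M + 2..<M + 2 + ex_leaves M]"

definition ex_edges :: "nat \<Rightarrow> nat set set" where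
  "ex_edges M = ex_tree M \<union> set (cycle_edges (ex_cycle M))"

text \<open>Edges are numbered: first the tree edges by their lower end, then the edges of the cycle.\<close>

definition ex_edge :: "nat \<Rightarrow> nat \<Rightarrow> nat set" where
  "ex_edge M a = (if a \<le> M + 1 + ex_leaves M then {ex_parent M a, a}
     else (let k = a - (M + 2 + ex_leaves M) in {M + 2 + k, M + 2 + Suc k mod ex_leaves M}))"

text \<open>The neighbors of the center are evenly spaced on the circle of radius 1/2, the leaves on
  the unit circle. Each neighbor has the same angle as its first leaf, so its leaves fill the sector
  starting there.\<close>

definition ex_pos :: "nat \<Rightarrow> nat \<Rightarrow> complex" where
  "ex_pos M v = (if v = 0 then 0
     else if v \<le> M + 1 then polar (1/2) ((real v - 1) / (M + 1))
     else polar 1 ((real v - (M + 2)) / ex_leaves M))"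

text \<open>At interior parameters the radius tells the kinds of edges apart: below 1/2 at the
  center, strictly between 1/2 and 1 at the leaves, and exactly 1 on the cycle. Only edges of the
  same kind can meet.\<close>

definition ex_radius :: "nat \<Rightarrow> nat \<Rightarrow> real \<Rightarrow> real" where
  "ex_radius M a t = (if a \<le> M + 1 then t / 2 else if a \<le> M + 1 + ex_leaves M then (1 + t) / 2 else 1)"

text \<open>The middle case moves linearly from the angle of the parent to that of the leaf, which
  keeps the edge inside the sector of its parent.\<close>

definition ex_angle :: "nat \<Rightarrow> nat \<Rightarrow> real \<Rightarrow> real" where
  "ex_angle M a t = (if a \<le> M + 1 then (real a - 1) / (M + 1)
     else if a \<le> M + 1 + ex_leaves M
     then (M * real ((a - (M + 2)) div M) + t * real ((a - (M + 2)) mod M)) / ex_leaves M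
     else (real (a - (M + 2 + ex_leaves M)) + t) / ex_leaves M)"

definition ex_curve :: "nat \<Rightarrow> nat \<Rightarrow> real \<Rightarrow> complex" where
  "ex_curve M a t = polar (ex_radius M a t) (ex_angle M a t)"

text \<open>\<open>N\<close> is the number of leaves and of cycle edges, \<open>n\<close> the
  largest vertex; edges are numbered from 1 to \<open>n + N\<close>.\<close>

locale tight_example =
  fixes M N n :: nat
  assumes M: "2 \<le> M" and N_def: "N = ex_leaves M" and n_def: "n = M + 1 + ex_leaves M"
begin

lemma ex_pos_N: "M < N" "3 \<le> N" "real N = (M + 1) * real M"
proof -
  have "3 * M \<le> N" using M by (simp add: N_def ex_leaves_def)
  then show "M < N" "3 \<le> N" using M by linarith+
  show "real N = (M + 1) * real M" by (simp add: N_def ex_leaves_def algebra_simps)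
qed

lemma n_eq: "n = M + 1 + N"
  by (simp add: n_def N_def)

lemma ex_leaf_div: "k < N \<Longrightarrow> k div M \<le> M"
proof -
  assume "k < N"
  then have "k div M < M + 1" using M by (simp add: N_def ex_leaves_def div_less_iff_less_mult)
  then show ?thesis by simp
qed

lemma ex_parent_le: "v \<le> n \<Longrightarrow> ex_parent M v \<le> M + 1"
proof -
  assume v: "v \<le> n"
  show ?thesis
  proof (cases "v \<le> M + 1")
    case False
    then have "v - (M + 2) < N" using v unfolding n_eq by linarith
    from ex_leaf_div[OF this] show ?thesis using False by (simp add: ex_parent_def)
  qed (simp add: ex_parent_def)
qed

lemma ex_parent_less: "1 \<le> v \<Longrightarrow> v \<le> n \<Longrightarrow> ex_parent M v < v"
proof -
  assume v: "1 \<le> v" "v \<le> n"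
  show ?thesis
  proof (cases "v \<le> M + 1")
    case True
    then show ?thesis using v by (simp add: ex_parent_def)
  next
    case False
    then show ?thesis using ex_parent_le[OF v(2)] by linarith
  qed
qed

lemma ex_is_tree: "tree {..n} (ex_tree M)"
  unfolding ex_tree_def n_def[symmetric] by (rule parent_tree) (rule ex_parent_less)

lemma ex_tree_iff: "{v, w} \<in> ex_tree M \<longleftrightarrow>
  (1 \<le> w \<and> w \<le> n \<and> v = ex_parent M w) \<or> (1 \<le> v \<and> v \<le> n \<and> w = ex_parent M v)"
proof -
  have "{v, w} \<in> ex_tree M \<longleftrightarrow> (\<exists>x\<in>{1..n}. {v, w} = {ex_parent M x, x})"
    unfolding ex_tree_def n_def by (simp only: image_iff)
  then show ?thesis by (simp only: doubleton_eq_iff bex_simps Bex_def atLeastAtMost_iff) blast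
qed

lemma ex_cycle_nth: "length (ex_cycle M) = N" "i < N \<Longrightarrow> ex_cycle M ! i = M + 2 + i"
  "set (ex_cycle M) = {M + 2..n}" "distinct (ex_cycle M)"
proof -
  show "length (ex_cycle M) = N" "distinct (ex_cycle M)"
    by (simp_all add: ex_cycle_def N_def del: upt_Suc)
  show "i < N \<Longrightarrow> ex_cycle M ! i = M + 2 + i" by (simp add: ex_cycle_def N_def del: upt_Suc)
  show "set (ex_cycle M) = {M + 2..n}" unfolding ex_cycle_def set_upt n_def by auto
qed

lemma ex_cycle_edges: "set (cycle_edges (ex_cycle M)) = {{M + 2 + k, M + 2 + Suc k mod N} |k. k < N}"
proof -
  have lt: "Suc k mod N < N" for k using ex_pos_N by simp
  have "cyc_succ (ex_cycle M) x y \<longleftrightarrow> (\<exists>k<N. x = M + 2 + k \<and> y = M + 2 + Suc k mod N)" for x y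
    unfolding cyc_succ_def ex_cycle_nth(1) using ex_cycle_nth(2) lt by auto
  then have "set (cycle_edges (ex_cycle M)) = {{x, y} |x y. \<exists>k<N. x = M + 2 + k \<and> y = M + 2 + Suc k mod N}"
    by (simp only: set_cycle_edges)
  also have "\<dots> = {{M + 2 + k, M + 2 + Suc k mod N} |k. k < N}" by blast
  finally show ?thesis .
qed

section \<open>Neighborhoods, degrees and colors in the example\<close>

lemma ex_nbhd_center: "nbhd (ex_tree M) 0 = {1..M + 1}"
proof (intro set_eqI)
  fix x
  show "x \<in> nbhd (ex_tree M) 0 \<longleftrightarrow> x \<in> {1..M + 1}"
    unfolding nbhd_iff ex_tree_iff n_def by (simp add: ex_parent_def)
qed

lemma ex_nbhd_inner:
  assumes u: "1 \<le> u" "u \<le> M + 1"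
  shows "nbhd (ex_tree M) u = insert 0 {M + 2 + (u - 1) * M..<M + 2 + u * M}"
proof -
  obtain w where w: "u = Suc w" using u by (cases u) auto
  have "u * M \<le> N" using mult_le_mono1[OF u(2), of M] by (simp add: N_def ex_leaves_def)
  then have le: "x < M + 2 + u * M \<Longrightarrow> x \<le> n" for x unfolding n_eq by linarith
  have "y div M = w \<longleftrightarrow> w * M \<le> y \<and> y < Suc w * M" for y
  proof
    assume "y div M = w"
    moreover have "M * (y div M) \<le> y" "y < M * Suc (y div M)"
      using M by (simp_all add: dividend_less_times_div times_div_less_eq_dividend)
    ultimately show "w * M \<le> y \<and> y < Suc w * M" by (simp only: mult.commute)
  next
    assume "w * M \<le> y \<and> y < Suc w * M"
    then show "y div M = w" by (intro div_nat_eqI) (simp_all only: mult.commute)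
  qed
  then have "(x - (M + 2)) div M = w \<longleftrightarrow> w * M \<le> x - (M + 2) \<and> x - (M + 2) < Suc w * M" for x
    by blast
  then have "(x - (M + 2)) div M = w \<longleftrightarrow> x \<in> {M + 2 + w * M..<M + 2 + Suc w * M}" if "M + 2 \<le> x" for x
    unfolding atLeastLessThan_iff using that by (metis add.commute le_diff_conv2 less_diff_conv2)
  then have *: "u = ex_parent M x \<longleftrightarrow> x \<in> {M + 2 + w * M..<M + 2 + Suc w * M}" if "M + 2 \<le> x" for x
    using that by (auto simp: ex_parent_def w)
  have mem: "x \<in> nbhd (ex_tree M) u \<longleftrightarrow> x = 0 \<or> (M + 2 \<le> x \<and> x \<le> n \<and> u = ex_parent M x)" for x
  proof -
    have "ex_parent M u = 0" "u \<le> n" using u by (simp_all add: ex_parent_def n_eq)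
    moreover have "u \<noteq> ex_parent M x" if "x \<le> M + 1" using that u by (simp add: ex_parent_def)
    ultimately show ?thesis
      unfolding nbhd_iff ex_tree_iff using u by (cases "M + 2 \<le> x") auto
  qed
  have "x \<in> nbhd (ex_tree M) u \<longleftrightarrow> x \<in> insert 0 {M + 2 + w * M..<M + 2 + Suc w * M}" for x
  proof (cases "M + 2 \<le> x")
    case True
    then show ?thesis using mem[of x] *[OF True] le[of x] w by auto
  next
    case False
    then show ?thesis using mem[of x] by auto
  qed
  then have "nbhd (ex_tree M) u = insert 0 {M + 2 + w * M..<M + 2 + Suc w * M}" by (rule set_eqI)
  then show ?thesis unfolding w by simp
qed

lemma ex_nbhd_leaf:
  assumes v: "M + 2 \<le> v" "v \<le> n"
  shows "nbhd (ex_tree M) v = {ex_parent M v}"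
proof -
  have "v \<noteq> ex_parent M w" if "w \<le> n" for w using ex_parent_le[OF that] v by linarith
  then show ?thesis unfolding nbhd_def ex_tree_iff using v by auto
qed

lemma ex_degree:
  "degree (ex_tree M) 0 = M + 1" "1 \<le> u \<Longrightarrow> u \<le> M + 1 \<Longrightarrow> degree (ex_tree M) u = M + 1"
  "M + 2 \<le> v \<Longrightarrow> v \<le> n \<Longrightarrow> degree (ex_tree M) v = 1"
proof -
  note G = tree_simple[OF ex_is_tree]
  show "degree (ex_tree M) 0 = M + 1" by (simp add: degree_eq_card_nbhd[OF G] ex_nbhd_center)
  show "degree (ex_tree M) u = M + 1" if u: "1 \<le> u" "u \<le> M + 1"
  proof -
    obtain w where w: "u = Suc w" using u by (cases u) auto
    show ?thesis unfolding degree_eq_card_nbhd[OF G] ex_nbhd_inner[OF u] by (simp add: w)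
  qed
  show "degree (ex_tree M) v = 1" if "M + 2 \<le> v" "v \<le> n"
    unfolding degree_eq_card_nbhd[OF G] ex_nbhd_leaf[OF that] by simp
qed

lemma ex_leaves_eq: "leaves {..n} (ex_tree M) = {M + 2..n}"
proof -
  have "degree (ex_tree M) v = 1 \<longleftrightarrow> M + 2 \<le> v" if "v \<le> n" for v
    using ex_degree(1) ex_degree(2)[of v] ex_degree(3)[of v] that M
      by (cases "v = 0"; cases "v \<le> M + 1") auto
  then show ?thesis by (auto simp: leaves_def)
qed

lemma ex_simple: "simple_graph {..n} (ex_edges M)"
proof -
  have "card {M + 2 + k, M + 2 + Suc k mod N} = 2" if "k < N" for k
    using that ex_pos_N by (auto simp: card_insert_if mod_Suc)
  moreover have "{M + 2 + k, M + 2 + Suc k mod N} \<subseteq> {..n}" if "k < N" for k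
  proof -
    have "Suc k mod N < N" using ex_pos_N by simp
    then have "M + 2 + k \<le> n" "M + 2 + Suc k mod N \<le> n" using that unfolding n_eq by linarith+
    then show ?thesis by simp
  qed
  ultimately show ?thesis
    using tree_simple[OF ex_is_tree] unfolding simple_graph_def ex_edges_def ex_cycle_edges by auto
qed

lemma ex_nbhd_edges: "nbhd (ex_edges M) v = nbhd (ex_tree M) v \<union> {y. {v, y} \<in> set (cycle_edges (ex_cycle M))}"
  by (auto simp: nbhd_def ex_edges_def)

lemma ex_nbhd_edges_inner: "v \<le> M + 1 \<Longrightarrow> nbhd (ex_edges M) v = nbhd (ex_tree M) v"
  unfolding ex_nbhd_edges ex_cycle_edges by (auto simp: doubleton_eq_iff)

lemma ex_max_degree: "max_degree {..n} (ex_edges M) = M + 1" "M + 1 \<le> max_degree {..n} (ex_tree M)"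
proof -
  note G = tree_simple[OF ex_is_tree] and GE = ex_simple
  have inner: "degree (ex_edges M) v = degree (ex_tree M) v" if "v \<le> M + 1" for v
    using ex_nbhd_edges_inner[OF that]
      by (simp add: degree_eq_card_nbhd[OF G] degree_eq_card_nbhd[OF GE])
  have le: "degree (ex_edges M) v \<le> M + 1" if "v \<le> n" for v
  proof (cases "v \<le> M + 1")
    case True
    then show ?thesis using inner[OF True] ex_degree(1) ex_degree(2)[of v] by (cases "v = 0") auto
  next
    case False
    then have "card (nbhd (ex_edges M) v) \<le> 1 + 2"
      unfolding ex_nbhd_edges using ex_nbhd_leaf[of v] cycle_nbhd_card(2)[OF ex_cycle_nth(4), of v] that
      by (intro order_trans[OF card_Un_le add_mono]) auto
    then show ?thesis using M by (simp add: degree_eq_card_nbhd[OF GE])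
  qed
  have "degree (ex_edges M) 0 = M + 1" using inner[of 0] ex_degree(1) by simp
  then have "M + 1 \<in> degree (ex_edges M) ` {..n}" by (metis atMost_iff image_eqI le0)
  then show "max_degree {..n} (ex_edges M) = M + 1"
    unfolding max_degree_def using le by (intro Max_eqI) auto
  have "M + 1 \<in> degree (ex_tree M) ` {..n}" using ex_degree(1) by (metis atMost_iff image_eqI le0)
  then show "M + 1 \<le> max_degree {..n} (ex_tree M)"
    unfolding max_degree_def by (intro Max_ge) auto
qed

lemma ex_color_count:
  assumes "star_edge_coloring {..n} (ex_edges M) \<phi>" "\<And>e. e \<in> ex_edges M \<Longrightarrow> \<phi> e < k"
  shows "M + 1 + (M + 1) div 2 \<le> k"
proof -
  have c0: "nbhd (ex_edges M) 0 = {1..M + 1}" using ex_nbhd_edges_inner[of 0] ex_nbhd_center by simp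
  have inner: "nbhd (ex_edges M) u = insert 0 {M + 2 + (u - 1) * M..<M + 2 + u * M}"
    if "1 \<le> u" "u \<le> M + 1" for u
    using ex_nbhd_edges_inner[OF that(2)] ex_nbhd_inner[OF that] by simp
  have "M + 1 + (M + 1) div 2 \<le> card {..<k}"
  proof (rule star_coloring_color_count[OF ex_simple, of 0 "M + 1" \<phi> "{..<k}"])
    show "card (nbhd (ex_edges M) 0) = M + 1" using c0 by simp
    show "card (nbhd (ex_edges M) u) = M + 1" if "u \<in> nbhd (ex_edges M) 0" for u
      using that ex_degree(2)[of u] ex_nbhd_edges_inner[of u] unfolding c0
      by (simp add: degree_eq_card_nbhd[OF tree_simple[OF ex_is_tree]])
    show "nbhd (ex_edges M) u \<inter> nbhd (ex_edges M) u' = {0} \<and> u \<notin> nbhd (ex_edges M) u'"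
      if "u \<in> nbhd (ex_edges M) 0" "u' \<in> nbhd (ex_edges M) 0" "u \<noteq> u'" for u u'
    proof -
      have u: "1 \<le> u" "u \<le> M + 1" "1 \<le> u'" "u' \<le> M + 1" using that c0 by auto
      have "u * M \<le> (u' - 1) * M \<or> u' * M \<le> (u - 1) * M"
      proof -
        have "u \<le> u' - 1 \<or> u' \<le> u - 1" using that(3) by linarith
        then show ?thesis using mult_le_mono1 by blast
      qed
      have "{M + 2 + (u - 1) * M..<M + 2 + u * M} \<inter> {M + 2 + (u' - 1) * M..<M + 2 + u' * M} = {}"
      proof (intro equals0I)
        fix y assume "y \<in> {M + 2 + (u - 1) * M..<M + 2 + u * M} \<inter> {M + 2 + (u' - 1) * M..<M + 2 + u' * M}"
        then have "M + 2 + (u - 1) * M \<le> y" "y < M + 2 + u * M" "M + 2 + (u' - 1) * M \<le> y"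
          "y < M + 2 + u' * M"
          by (simp_all only: Int_iff atLeastLessThan_iff)
        then show False using \<open>u * M \<le> (u' - 1) * M \<or> u' * M \<le> (u - 1) * M\<close> by linarith
      qed
      moreover have "u \<notin> {M + 2 + (u' - 1) * M..<M + 2 + u' * M}" "u \<noteq> 0" using u by simp_all
      ultimately show ?thesis unfolding inner[OF u(1,2)] inner[OF u(3,4)] by blast
    qed
  qed (use assms in auto)
  then show ?thesis by simp
qed

section \<open>The plane drawing of the example\<close>

lemma ex_edges_codes: "ex_edges M = ex_edge M ` {1..n + N}"
proof -
  have split: "{1..n + N} = {1..n} \<union> (\<lambda>k. n + 1 + k) ` {..<N}"
  proof -
    have "{n + 1..n + N} = (\<lambda>k. n + 1 + k) ` {..<N}"
    proof (intro equalityI subsetI)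
      fix x assume "x \<in> {n + 1..n + N}"
      then have x: "n + 1 \<le> x" "x \<le> n + N" by simp_all
      have "x = n + 1 + (x - (n + 1))" using x by linarith
      moreover have "x - (n + 1) \<in> {..<N}" unfolding lessThan_iff using x ex_pos_N(2) by linarith
      ultimately show "x \<in> (\<lambda>k. n + 1 + k) ` {..<N}" by (rule image_eqI)
    next
      fix x assume "x \<in> (\<lambda>k. n + 1 + k) ` {..<N}"
      then obtain k where "k < N" "x = n + 1 + k" by blast
      then show "x \<in> {n + 1..n + N}" by simp
    qed
    moreover have "{1..n + N} = {1..n} \<union> {n + 1..n + N}" by auto
    ultimately show ?thesis by metis
  qed
  have "ex_edge M ` {1..n} = ex_tree M"
    unfolding ex_tree_def n_def by (intro image_cong) (auto simp: ex_edge_def)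
  moreover have "ex_edge M (n + 1 + k) = {M + 2 + k, M + 2 + Suc k mod N}" for k
    by (simp add: ex_edge_def n_def N_def)
  then have "ex_edge M ` (\<lambda>k. n + 1 + k) ` {..<N} = set (cycle_edges (ex_cycle M))"
    unfolding ex_cycle_edges image_image by (auto simp only: lessThan_iff)
  ultimately show ?thesis unfolding split image_Un ex_edges_def by simp
qed

lemma ex_edge_cases:
  assumes "a \<in> {1..n + N}"
  obtains (spoke) "1 \<le> a" "a \<le> M + 1" "ex_edge M a = {0, a}"
      "\<And>t. ex_curve M a t = polar (t / 2) ((real a - 1) / (M + 1))"
  | (twig) k where "k < N" "a = M + 2 + k" "ex_edge M a = {Suc (k div M), M + 2 + k}"
      "\<And>t. ex_curve M a t = polar ((1 + t) / 2) ((M * real (k div M) + t * real (k mod M)) / N)"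
  | (rim) k where "k < N" "a = n + 1 + k" "ex_edge M a = {M + 2 + k, M + 2 + Suc k mod N}"
      "\<And>t. ex_curve M a t = polar 1 ((real k + t) / N)"
proof -
  consider "a \<le> M + 1" | "M + 2 \<le> a" "a \<le> n" | "n < a" by linarith
  then show thesis
  proof cases
    case 1
    then show thesis using assms
      by (intro spoke) (auto simp: ex_edge_def ex_parent_def ex_curve_def ex_radius_def ex_angle_def add.commute)
  next
    case 2
    define k where "k = a - (M + 2)"
    have "k < N" "a = M + 2 + k" using 2 by (auto simp: k_def n_def N_def)
    then show thesis
      by (intro twig[of k]) (auto simp: ex_edge_def ex_parent_def ex_curve_def ex_radius_def ex_angle_def n_def N_def)
  next
    case 3
    define k where "k = a - (n + 1)"
    have "k < N" "a = n + 1 + k" using 3 assms by (auto simp: k_def)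
    then show thesis
      by (intro rim[of k]) (auto simp: ex_edge_def ex_curve_def ex_radius_def ex_angle_def n_def N_def)
  qed
qed

abbreviation twig_angle :: "nat \<Rightarrow> real \<Rightarrow> real" where
  "twig_angle k t \<equiv> (M * real (k div M) + t * real (k mod M)) / N"

lemma ex_pos_cases:
  assumes "v \<le> n"
  obtains (center) "v = 0" "ex_pos M v = polar 0 0"
  | (inner) "1 \<le> v" "v \<le> M + 1" "ex_pos M v = polar (1/2) ((real v - 1) / (M + 1))"
  | (leaf) k where "k < N" "v = M + 2 + k" "ex_pos M v = polar 1 (real k / N)"
proof -
  consider "v = 0" | "1 \<le> v" "v \<le> M + 1" | "M + 2 \<le> v" by linarith
  then show thesis
  proof cases
    case 1
    then show thesis by (intro center) (simp_all add: ex_pos_def polar_def)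
  next
    case 2
    then show thesis by (intro inner) (simp_all add: ex_pos_def)
  next
    case 3
    define k where "k = v - (M + 2)"
    have "k < N" "v = M + 2 + k" using 3 assms unfolding k_def n_eq by linarith+
    then show thesis by (intro leaf[of k]) (simp_all add: ex_pos_def N_def)
  qed
qed

lemma ex_inner_angle: "1 \<le> v \<Longrightarrow> v \<le> M + 1 \<Longrightarrow> 0 \<le> (real v - 1) / (M + 1) \<and> (real v - 1) / (M + 1) < 1"
  by (simp add: field_simps)

lemma ex_twig_angle:
  assumes k: "k < N" and t: "0 \<le> t" "t \<le> 1"
  shows "0 \<le> twig_angle k t" "twig_angle k t < 1"
proof -
  have "t * real (k mod M) \<le> real (k mod M)" using t by (simp add: mult_left_le_one_le)
  moreover have "real k = M * real (k div M) + real (k mod M)"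
    by (metis mult_div_mod_eq of_nat_add of_nat_mult)
  ultimately have "M * real (k div M) + t * real (k mod M) < N" using k by linarith
  then show "twig_angle k t < 1" using ex_pos_N(2) by (simp add: divide_less_eq)
  show "0 \<le> twig_angle k t" using t by simp
qed

lemma ex_leaf_angle: "k < N \<Longrightarrow> 0 \<le> real k / N \<and> real k / N < 1"
  using ex_pos_N(2) by (simp add: divide_less_eq)

lemma ex_rim_angle: "k < N \<Longrightarrow> 0 \<le> t \<Longrightarrow> t < 1 \<Longrightarrow> 0 \<le> (real k + t) / N \<and> (real k + t) / N < 1"
proof -
  assume k: "k < N" "0 \<le> t" "t < 1"
  have "real k + 1 \<le> real N" using k(1) by linarith
  then show ?thesis using k ex_pos_N(2) by (simp add: divide_less_eq)
qed

lemma inj_ex_pos: "inj_on (ex_pos M) {..n}"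
proof (rule inj_onI)
  fix v w assume v: "v \<in> {..n}" and w: "w \<in> {..n}" and eq: "ex_pos M v = ex_pos M w"
  have "v \<le> n" "w \<le> n" using v w by simp_all
  have radius: "r = r'" if "ex_pos M v = polar r \<theta>" "ex_pos M w = polar r' \<theta>'" "0 \<le> r" "0 \<le> r'"
    for r r' \<theta> \<theta>'
    using polar_eqD(1)[of r \<theta> r' \<theta>'] eq that by simp
  have angle: "\<theta> = \<theta>'" if "ex_pos M v = polar r \<theta>" "ex_pos M w = polar r' \<theta>'" "0 < r" "0 \<le> r'"
    "0 \<le> \<theta>" "\<theta> < 1" "0 \<le> \<theta>'" "\<theta>' < 1" for r r' \<theta> \<theta>'
    using polar_eqD(2)[of r \<theta> r' \<theta>'] eq that by simp
  from \<open>v \<le> n\<close> show "v = w"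
  proof (cases rule: ex_pos_cases)
    case center
    note v = this
    from \<open>w \<le> n\<close> show ?thesis
    proof (cases rule: ex_pos_cases)
      case center then show ?thesis using v by simp
    next
      case inner then show ?thesis using radius[OF v(2) inner(3)] by simp
    next
      case leaf then show ?thesis using radius[OF v(2) leaf(3)] by simp
    qed
  next
    case inner
    note v = this
    from \<open>w \<le> n\<close> show ?thesis
    proof (cases rule: ex_pos_cases)
      case center then show ?thesis using radius[OF v(3) center(2)] by simp
    next
      case inner
      have "(real v - 1) / (M + 1) = (real w - 1) / (M + 1)"
        by (rule angle[OF v(3) inner(3)]) (use ex_inner_angle v(1,2) inner(1,2) in auto)
      then show ?thesis by (simp add: field_simps)
    next
      case leaf then show ?thesis using radius[OF v(3) leaf(3)] by simp
    qed
  next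
    case (leaf k)
    note v = this
    from \<open>w \<le> n\<close> show ?thesis
    proof (cases rule: ex_pos_cases)
      case center then show ?thesis using radius[OF v(3) center(2)] by simp
    next
      case inner then show ?thesis using radius[OF v(3) inner(3)] by simp
    next
      case (leaf l)
      have "real k / N = real l / N"
        by (rule angle[OF v(3) leaf(3)]) (use ex_leaf_angle v(1) leaf(1) in auto)
      then show ?thesis using v leaf ex_pos_N(2) by simp
    qed
  qed
qed

lemma ex_curve_vertex:
  assumes a: "a \<in> {1..n + N}" and v: "v \<le> n" and t: "0 < t" "t < 1"
  shows "ex_curve M a t \<noteq> ex_pos M v"
proof
  assume eq: "ex_curve M a t = ex_pos M v"
  from a show False
  proof (cases rule: ex_edge_cases)
    case spoke
    have r: "t / 2 = r" if "ex_pos M v = polar r \<theta>" "0 \<le> r" for r \<theta>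
      using polar_eqD(1)[of "t / 2" _ r \<theta>] eq that t unfolding spoke(4) by simp
    from v show False by (cases rule: ex_pos_cases) (use r t in force)+
  next
    case (twig k)
    have r: "(1 + t) / 2 = r" if "ex_pos M v = polar r \<theta>" "0 \<le> r" for r \<theta>
      using polar_eqD(1)[of "(1 + t) / 2" _ r \<theta>] eq that t unfolding twig(4) by simp
    from v show False by (cases rule: ex_pos_cases) (use r t in force)+
  next
    case (rim k)
    have r: "1 = r" if "ex_pos M v = polar r \<theta>" "0 \<le> r" for r \<theta>
      using polar_eqD(1)[of 1 _ r \<theta>] eq that t unfolding rim(4) by simp
    from v show False
    proof (cases rule: ex_pos_cases)
      case (leaf l)
      have "(real k + t) / N = real l / N"
      proof (rule polar_eqD(2)[of 1 _ 1])
        show "polar 1 ((real k + t) / N) = polar 1 (real l / N)" using eq rim leaf by simp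
        show "\<bar>(real k + t) / N - real l / N\<bar> < 1"
          using ex_rim_angle[OF rim(1) less_imp_le[OF t(1)] t(2)] ex_leaf_angle[OF leaf(1)] by linarith
      qed simp_all
      then have "real k + t = real l" using ex_pos_N(2) by simp
      then have "k < l \<and> l < k + 1" using t by linarith
      then show False by linarith
    qed (use r in force)+
  qed
qed

text \<open>Equal radii leave only edges of the same kind. Two spokes have different constant
  angles, and two rim edges occupy disjoint open intervals of angles. For two twigs equal radius
  means equal parameter, and then the angles have to be compared.\<close>

lemma ex_curve_cross:
  assumes a: "a \<in> {1..n + N}" and b: "b \<in> {1..n + N}" and ab: "a \<noteq> b"
    and s: "0 < s" "s < 1" and t: "0 < t" "t < 1"
  shows "ex_curve M a s \<noteq> ex_curve M b t"
proof
  assume eq: "ex_curve M a s = ex_curve M b t"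
  have radius: "r = r'" if "ex_curve M a s = polar r \<theta>" "ex_curve M b t = polar r' \<theta>'" "0 \<le> r"
    "0 \<le> r'" for r r' \<theta> \<theta>'
    using polar_eqD(1)[of r \<theta> r' \<theta>'] eq that by simp
  have angle: "\<theta> = \<theta>'" if "ex_curve M a s = polar r \<theta>" "ex_curve M b t = polar r' \<theta>'" "0 < r"
    "0 \<le> r'" "0 \<le> \<theta>" "\<theta> < 1" "0 \<le> \<theta>'" "\<theta>' < 1" for r r' \<theta> \<theta>'
    using polar_eqD(2)[of r \<theta> r' \<theta>'] eq that by simp
  from a show False
  proof (cases rule: ex_edge_cases)
    case spoke
    note A = this
    from b show False
    proof (cases rule: ex_edge_cases)
      case spoke
      have "(real a - 1) / (M + 1) = (real b - 1) / (M + 1)"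
        by (rule angle[OF A(4) spoke(4)]) (use ex_inner_angle A(1,2) spoke(1,2) s t in auto)
      then show False using ab by (simp add: field_simps)
    next
      case twig then show False using radius[OF A(4) twig(4)] s t by simp
    next
      case rim then show False using radius[OF A(4) rim(4)] s t by simp
    qed
  next
    case (twig k)
    note A = this
    from b show False
    proof (cases rule: ex_edge_cases)
      case spoke then show False using radius[OF A(4) spoke(4)] s t by simp
    next
      case (twig l)
      have "(1 + s) / 2 = (1 + t) / 2" by (rule radius[OF A(4) twig(4)]) (use s t in auto)
      then have st: "s = t" by simp
      have "twig_angle k s = twig_angle l t"
        by (rule angle[OF A(4) twig(4)]) (use ex_twig_angle A(1) twig(1) s t in auto)
      then have e: "M * real (k div M) + s * real (k mod M) = M * real (l div M) + s * real (l mod M)"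
        using ex_pos_N(2) st by simp
      \<comment> \<open>The moving part of the angle is less than one sector wide, so equal angles
        force equal parents. The positive parameter \<open>s\<close> can then be cancelled, which
        gives equal remainders.\<close>
      have bnd: "0 \<le> s * real (j mod M) \<and> s * real (j mod M) < M" for j
      proof -
        have "s * real (j mod M) \<le> real (j mod M)" using s by (simp add: mult_left_le_one_le)
        moreover have "real (j mod M) < M" using M by simp
        moreover have "0 \<le> s * real (j mod M)" using s by simp
        ultimately show ?thesis by linarith
      qed
      have "k div M = l div M"
      proof (rule ccontr)
        assume "k div M \<noteq> l div M"
        then consider "k div M + 1 \<le> l div M" | "l div M + 1 \<le> k div M" by linarith
        then show False
        proof cases
          case 1
          then have "M * (real (k div M) + 1) \<le> M * real (l div M)" by (intro mult_left_mono) linarith+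
          then show False using e bnd[of k] bnd[of l] by (simp add: distrib_left)
        next
          case 2
          then have "M * (real (l div M) + 1) \<le> M * real (k div M)" by (intro mult_left_mono) linarith+
          then show False using e bnd[of k] bnd[of l] by (simp add: distrib_left)
        qed
      qed
      moreover from this have "k mod M = l mod M" using e s by simp
      ultimately have "k = l" by (metis div_mult_mod_eq)
      then show False using A twig ab by simp
    next
      case rim then show False using radius[OF A(4) rim(4)] s t by simp
    qed
  next
    case (rim k)
    note A = this
    from b show False
    proof (cases rule: ex_edge_cases)
      case spoke then show False using radius[OF A(4) spoke(4)] s t by simp
    next
      case twig then show False using radius[OF A(4) twig(4)] s t by simp
    next
      case (rim l)
      have "(real k + s) / N = (real l + t) / N"
        by (rule angle[OF A(4) rim(4)]) (use ex_rim_angle A(1) rim(1) s t in auto)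
      then have "real k + s = real l + t" using ex_pos_N(2) by simp
      then have "k < l + 1 \<and> l < k + 1" using s t by linarith
      then show False using A rim ab by simp
    qed
  qed
qed

lemma ex_curve_ends:
  assumes "a \<in> {1..n + N}"
  shows "{ex_curve M a 0, ex_curve M a 1} = ex_pos M ` ex_edge M a"
  using assms
proof (cases rule: ex_edge_cases)
  case spoke
  have "ex_curve M a 0 = ex_pos M 0" unfolding spoke(4) by (simp add: ex_pos_def polar_def)
  moreover have "ex_curve M a 1 = ex_pos M a" unfolding spoke(4) using spoke(1,2)
    by (simp add: ex_pos_def)
  ultimately show ?thesis unfolding spoke(3) by simp
next
  case (twig k)
  have "real k = M * real (k div M) + real (k mod M)"
    by (metis mult_div_mod_eq of_nat_add of_nat_mult)
  then have "ex_curve M a 1 = ex_pos M (M + 2 + k)" unfolding twig(4) by (simp add: ex_pos_def N_def)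
  moreover have "ex_curve M a 0 = ex_pos M (Suc (k div M))"
  proof -
    have "M * real (k div M) / N = real (k div M) / (M + 1)" unfolding ex_pos_N(3) using M by simp
    then show ?thesis unfolding twig(4) using ex_leaf_div[OF twig(1)] by (simp add: ex_pos_def)
  qed
  ultimately show ?thesis unfolding twig(3) by auto
next
  case (rim k)
  have "ex_curve M a 0 = ex_pos M (M + 2 + k)" unfolding rim(4) by (simp add: ex_pos_def N_def)
  moreover have "ex_curve M a 1 = ex_pos M (M + 2 + Suc k mod N)"
  proof (cases "Suc k = N")
    case True
    \<comment> \<open>The last rim edge ends after a full turn, at the angle 0 of the first
      leaf.\<close>
    then have "(real k + 1) / N = 0 + 1" using ex_pos_N(2) by (simp add: field_simps)
    then have "ex_curve M a 1 = polar 1 0" unfolding rim(4) using polar_add_one[of 1 0] by simp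
    then show ?thesis using True by (simp add: ex_pos_def)
  next
    case False
    then have "Suc k mod N = Suc k" using rim(1) by simp
    then show ?thesis unfolding rim(4) by (simp add: ex_pos_def N_def add.commute)
  qed
  ultimately show ?thesis unfolding rim(3) by auto
qed

lemma ex_curve_arc:
  assumes "a \<in> {1..n + N}"
  shows "arc (ex_curve M a)"
  using assms
proof (cases rule: ex_edge_cases)
  case spoke
  have "arc (\<lambda>t. polar (t / 2) ((real a - 1) / (M + 1)))"
  proof (rule arc_polar)
    fix s t :: real assume "s \<in> {0..1}" "t \<in> {0..1}"
      "polar (s / 2) ((real a - 1) / (M + 1)) = polar (t / 2) ((real a - 1) / (M + 1))"
    then show "s = t" using polar_eqD(1)[of "s / 2" _ "t / 2"] by auto
  qed (auto intro!: continuous_intros)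
  then show ?thesis using spoke(4) by presburger
next
  case (twig k)
  have "arc (\<lambda>t. polar ((1 + t) / 2) (twig_angle k t))"
  proof (rule arc_polar)
    fix s t :: real assume "s \<in> {0..1}" "t \<in> {0..1}"
      "polar ((1 + s) / 2) (twig_angle k s) =
       polar ((1 + t) / 2) (twig_angle k t)"
    then show "s = t" using polar_eqD(1)[of "(1 + s) / 2" _ "(1 + t) / 2"] by auto
  qed (use ex_pos_N(2) in \<open>auto intro!: continuous_intros\<close>)
  then show ?thesis using twig(4) by presburger
next
  case (rim k)
  have "arc (\<lambda>t. polar 1 ((real k + t) / N))"
  proof (rule arc_polar)
    fix s t :: real assume st: "s \<in> {0..1}" "t \<in> {0..1}"
      "polar 1 ((real k + s) / N) = polar 1 ((real k + t) / N)"
    have "\<bar>(real k + s) / N - (real k + t) / N\<bar> = \<bar>s - t\<bar> / N"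
      using ex_pos_N(2) by (simp add: diff_divide_distrib[symmetric] abs_divide)
    also have "\<dots> < 1" using st(1,2) ex_pos_N(2) by (auto simp: divide_less_eq)
    finally have "(real k + s) / N = (real k + t) / N" using polar_eqD(2)[OF st(3)] by simp
    then show "s = t" using ex_pos_N(2) by simp
  qed (use ex_pos_N(2) in \<open>auto intro!: continuous_intros\<close>)
  then show ?thesis using rim(4) by presburger
qed

lemma inj_ex_edge: "inj_on (ex_edge M) {1..n + N}"
proof (rule inj_onI)
  fix a b assume a: "a \<in> {1..n + N}" and b: "b \<in> {1..n + N}" and eq: "ex_edge M a = ex_edge M b"
  from a show "a = b"
  proof (cases rule: ex_edge_cases)
    case spoke
    note A = this
    from b show ?thesis
      by (cases rule: ex_edge_cases) (use eq A in \<open>auto simp: doubleton_eq_iff\<close>)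
  next
    case (twig k)
    note A = this ex_leaf_div[OF this(1)]
    from b show ?thesis
      by (cases rule: ex_edge_cases) (use eq A ex_leaf_div in \<open>auto simp: doubleton_eq_iff\<close>)
  next
    case (rim k)
    note A = this
    from b show ?thesis
    proof (cases rule: ex_edge_cases)
      case spoke
      then show ?thesis using eq A by (auto simp: doubleton_eq_iff)
    next
      case (twig l)
      then show ?thesis using eq A ex_leaf_div[OF twig(1)] by (auto simp: doubleton_eq_iff)
    next
      case (rim l)
      \<comment> \<open>Such a pair determines \<open>k\<close> because \<open>N \<ge> 3\<close>;
        with two leaves the two rim edges would coincide.\<close>
      have "{k, Suc k mod N} = {l, Suc l mod N}" using eq A(3) rim(3) by (auto simp: doubleton_eq_iff)
      moreover have "Suc k mod N = (if Suc k = N then 0 else Suc k)"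
        "Suc l mod N = (if Suc l = N then 0 else Suc l)"
        using A(1) rim(1) by auto
      ultimately have "k = l" using ex_pos_N(2) by (auto simp: doubleton_eq_iff split: if_splits)
      then show ?thesis using A rim by simp
    qed
  qed
qed

text \<open>The curves are given by edge numbers, whereas an embedding is indexed by edges;
  injectivity of the numbering translates between the two.\<close>

definition ex_arc :: "nat set \<Rightarrow> real \<Rightarrow> complex" where
  "ex_arc e = ex_curve M (the_inv_into {1..n + N} (ex_edge M) e)"

lemma ex_arc_edge: "a \<in> {1..n + N} \<Longrightarrow> ex_arc (ex_edge M a) = ex_curve M a"
  unfolding ex_arc_def by (simp only: the_inv_into_f_f[OF inj_ex_edge])

lemma ex_plane_embedding: "plane_embedding {..n} (ex_edges M) (ex_pos M) ex_arc"
proof (rule plane_embeddingI[OF inj_ex_pos])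
  fix e assume e: "e \<in> ex_edges M"
  then obtain a where a: "a \<in> {1..n + N}" "e = ex_edge M a" unfolding ex_edges_codes by blast
  show "arc (ex_arc e)" using ex_curve_arc[OF a(1)] ex_arc_edge[OF a(1)] a(2) by simp
  show "{ex_arc e 0, ex_arc e 1} = ex_pos M ` e"
    unfolding a(2) ex_arc_edge[OF a(1)] by (rule ex_curve_ends[OF a(1)])
  show "e \<subseteq> {..n}" using ex_simple e by (simp add: simple_graph_def)
  show "ex_arc e t \<noteq> ex_pos M v" if "v \<in> {..n}" "0 < t" "t < 1" for v t
    unfolding a(2) ex_arc_edge[OF a(1)] using ex_curve_vertex[OF a(1) _ that(2,3)] that(1) by simp
  fix f assume f: "f \<in> ex_edges M" "e \<noteq> f"
  then obtain b where b: "b \<in> {1..n + N}" "f = ex_edge M b" unfolding ex_edges_codes by blast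
  have "a \<noteq> b" using a b f by blast
  then show "ex_arc e s \<noteq> ex_arc f t" if "0 < s" "s < 1" "0 < t" "t < 1" for s t
    unfolding a(2) b(2) ex_arc_edge[OF a(1)] ex_arc_edge[OF b(1)]
    using ex_curve_cross[OF a(1) b(1) _ that] by simp
qed

lemma ex_rim_image: "(\<Union>e\<in>set (cycle_edges (ex_cycle M)). path_image (ex_arc e)) = sphere 0 1"
proof -
  have rim: "path_image (ex_arc {M + 2 + k, M + 2 + Suc k mod N}) = (\<lambda>t. polar 1 ((real k + t) / N)) ` {0..1}"
    if k: "k < N" for k
  proof -
    have a: "n + 1 + k \<in> {1..n + N}" using k by simp
    have "ex_edge M (n + 1 + k) = {M + 2 + k, M + 2 + Suc k mod N}"
      by (simp add: ex_edge_def n_def N_def)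
    moreover have "ex_curve M (n + 1 + k) = (\<lambda>t. polar 1 ((real k + t) / N))"
      by (simp add: fun_eq_iff ex_curve_def ex_radius_def ex_angle_def n_def N_def)
    ultimately show ?thesis using ex_arc_edge[OF a] by (simp add: path_image_def)
  qed
  have "(\<Union>e\<in>set (cycle_edges (ex_cycle M)). path_image (ex_arc e)) =
      (\<Union>k<N. (\<lambda>t. polar 1 ((real k + t) / N)) ` {0..1})"
    unfolding ex_cycle_edges using rim by blast
  also have "\<dots> = sphere 0 1"
  proof (intro equalityI subsetI)
    fix z assume "z \<in> (\<Union>k<N. (\<lambda>t. polar 1 ((real k + t) / N)) ` {0..1})"
    then show "z \<in> sphere 0 1" using norm_polar[of 1] by auto
  next
    fix z :: complex assume "z \<in> sphere 0 1"
    then obtain \<theta> where \<theta>: "0 \<le> \<theta>" "\<theta> < 1" "z = polar 1 \<theta>" using unit_circle_polar[of z] by auto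
    define k where "k = nat \<lfloor>N * \<theta>\<rfloor>"
    have N0: "0 < real N" using ex_pos_N(2) by simp
    have "0 \<le> N * \<theta>" "N * \<theta> < N" using \<theta>(1,2) N0 by simp_all
    then have k: "k < N" "real k \<le> N * \<theta>" "N * \<theta> < real k + 1" unfolding k_def by linarith+
    have "z = polar 1 ((real k + (N * \<theta> - k)) / N)" using \<theta>(3) N0 by simp
    moreover have "N * \<theta> - k \<in> {0..1}" using k by simp
    ultimately show "z \<in> (\<Union>k<N. (\<lambda>t. polar 1 ((real k + t) / N)) ` {0..1})" using k(1) by blast
  qed
  finally show ?thesis .
qed

lemma ex_drawing: "sphere 0 1 \<subseteq> drawing {..n} (ex_edges M) (ex_pos M) ex_arc"
  "drawing {..n} (ex_edges M) (ex_pos M) ex_arc \<subseteq> cball 0 1"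
proof -
  show "sphere 0 1 \<subseteq> drawing {..n} (ex_edges M) (ex_pos M) ex_arc"
    unfolding ex_rim_image[symmetric] drawing_def ex_edges_def by blast
  have "norm (ex_pos M v) \<le> 1" if "v \<le> n" for v
    using that by (cases rule: ex_pos_cases) (simp_all add: norm_polar)
  moreover have "norm (ex_arc e t) \<le> 1" if e: "e \<in> ex_edges M" and t: "t \<in> {0..1}" for e t
  proof -
    obtain a where a: "a \<in> {1..n + N}" "e = ex_edge M a" using e unfolding ex_edges_codes by blast
    show ?thesis
      unfolding a(2) ex_arc_edge[OF a(1)] ex_curve_def
      using t by (subst norm_polar) (auto simp: ex_radius_def)
  qed
  ultimately show "drawing {..n} (ex_edges M) (ex_pos M) ex_arc \<subseteq> cball 0 1"
    unfolding drawing_def path_image_def by (auto simp: subset_iff)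
qed

lemma ex_generalized_halin: "generalized_halin_graph {..n} (ex_edges M)"
  unfolding generalized_halin_graph_def
proof (intro exI conjI)
  show "tree {..n} (ex_tree M)" by (rule ex_is_tree)
  show "3 \<le> max_degree {..n} (ex_tree M)" using ex_max_degree(2) M by linarith
  show "graph_cycle {..n} (ex_edges M) (ex_cycle M)"
    unfolding graph_cycle_def using ex_cycle_nth ex_pos_N(2) by (auto simp: ex_edges_def)
  show "set (ex_cycle M) = leaves {..n} (ex_tree M)" using ex_cycle_nth(3) ex_leaves_eq by simp
  show "ex_edges M = ex_tree M \<union> set (cycle_edges (ex_cycle M))" by (rule ex_edges_def)
  show "plane_embedding {..n} (ex_edges M) (ex_pos M) ex_arc" by (rule ex_plane_embedding)
  show "frontier (exterior_face {..n} (ex_edges M) (ex_pos M) ex_arc) =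
    (\<Union>e\<in>set (cycle_edges (ex_cycle M)). path_image (ex_arc e))"
    unfolding exterior_face_def ex_rim_image by (rule frontier_outside_disc[OF ex_drawing])
qed

end

lemma floor_three_halves: "\<lfloor>3 * real d / 2\<rfloor> = int (d + d div 2)"
proof -
  have "d = 2 * (d div 2) \<or> d = 2 * (d div 2) + 1" by presburger
  then have "real d = 2 * real (d div 2) \<or> real d = 2 * real (d div 2) + 1" by linarith
  then show ?thesis by (intro floor_unique) auto
qed

lemma list_star_chromatic_index_le:
  "star_edge_choosable V E k \<Longrightarrow> list_star_chromatic_index V E \<le> k"
  unfolding list_star_chromatic_index_def by (rule Least_le)

theorem theorem9:
  "(\<forall>(V :: 'v set) E.
      generalized_halin_graph V E \<and> 13 \<le> max_degree V E \<longrightarrow>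
      int (list_star_chromatic_index V E) \<le> \<lfloor>3 * real (max_degree V E) / 2\<rfloor>) \<and>
   (\<forall>\<Delta> :: nat. 13 \<le> \<Delta> \<longrightarrow>
      (\<exists>(V :: nat set) E.
         generalized_halin_graph V E \<and> max_degree V E = \<Delta> \<and>
         int (list_star_chromatic_index V E) = \<lfloor>3 * real \<Delta> / 2\<rfloor>))"
proof (intro conjI allI impI)
  fix V :: "'v set" and E
  assume "generalized_halin_graph V E \<and> 13 \<le> max_degree V E"
  then have "star_edge_choosable V E (max_degree V E + max_degree V E div 2)"
    using halin_star_edge_choosable by blast
  then show "int (list_star_chromatic_index V E) \<le> \<lfloor>3 * real (max_degree V E) / 2\<rfloor>"
    using list_star_chromatic_index_le floor_three_halves by fastforce
next
  fix \<Delta> :: nat assume \<Delta>: "13 \<le> \<Delta>"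
  define M where "M = \<Delta> - 1"
  have \<Delta>_eq: "\<Delta> = M + 1" "2 \<le> M" using \<Delta> by (auto simp: M_def)
  interpret tight_example M "ex_leaves M" "M + 1 + ex_leaves M" by standard (use \<Delta>_eq in auto)
  let ?V = "{..M + 1 + ex_leaves M}" and ?E = "ex_edges M"
  let ?k = "list_star_chromatic_index ?V ?E"
  have deg: "max_degree ?V ?E = \<Delta>" unfolding \<Delta>_eq(1) by (rule ex_max_degree(1))
  have ch: "star_edge_choosable ?V ?E (\<Delta> + \<Delta> div 2)"
    using halin_star_edge_choosable[OF ex_generalized_halin] deg \<Delta> by simp
  then have "?k \<le> \<Delta> + \<Delta> div 2" by (rule list_star_chromatic_index_le)
  moreover have "\<Delta> + \<Delta> div 2 \<le> ?k"
  proof -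
    \<comment> \<open>The minimum is attained, and constant lists \<open>{..<?k}\<close> turn
      choosability into a star coloring with \<open>?k\<close> colors, to which the color count
      applies.\<close>
    have "star_edge_choosable ?V ?E ?k"
      unfolding list_star_chromatic_index_def using ch by (rule LeastI)
    then obtain \<phi> where \<phi>: "star_edge_coloring ?V ?E \<phi>" "\<forall>e\<in>?E. \<phi> e \<in> {..<?k}"
      unfolding star_edge_choosable_def by (elim allE[of _ "\<lambda>_. {..<?k}"]) auto
    then show ?thesis using ex_color_count[of \<phi> ?k] \<Delta>_eq by auto
  qed
  ultimately have "int ?k = \<lfloor>3 * real \<Delta> / 2\<rfloor>" unfolding floor_three_halves by simp
  then show "\<exists>(V :: nat set) E. generalized_halin_graph V E \<and> max_degree V E = \<Delta> \<and>
      int (list_star_chromatic_index V E) = \<lfloor>3 * real \<Delta> / 2\<rfloor>"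
    using ex_generalized_halin deg by blast
qed

end
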